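(* Let $\pi=\{p_1,\dots,p_n\}$ be a set of primes, $\pi'=\mathbb{P}\setminus\pi$, and $\sigma^{0\pi}=\{\{p_1\},\dots,\{p_n\},\pi'\}$. A finite group $G$ is a $\pi$-soluble $P\sigma^{0\pi}T$-group if and only if there are subgroups $D$ and $M$ of $G$ such that the following conditions hold: (i) $G=D\rtimes M$ (with $D$ normal in $G$), where $D$ is an abelian Hall subgroup of $G$ of odd order, $M=O_{p_1}(M)\times\cdots\times O_{p_n}(M)\times O_{\pi'}(M)$, and every element of $G$ induces (by conjugation) a power automorphism in $D$; (ii) $O_{\pi'}(D)$ has a normal complement in a Hall $\pi'$-subgroup of $G$.
   Context: All groups are finite; $\mathbb{P}$ is the set of all primes. $G$ is $\pi$-soluble if every chief factor of $G$ is either a $p$-group for some $p\in\pi$ or a $\pi'$-group. For a set of primes $\tau$, $O_\tau(X)$ is the largest normal $\tau$-subgroup of $X$, and $O_p(X)=O_{\{p\}}(X)$. A power automorphism of $D$ is an automorphism mapping every subgroup of $D$ onto itself. For a partition $\sigma=\{\sigma_i\mid i\in I\}$ of $\mathbb{P}$ let $\sigma(G)$ be the set of those $\sigma_i$ containing a prime divisor of $|G|$. A complete Hall $\sigma$-set of $G$ is a set $\mathcal{H}$ of subgroups of $G$ such that every member $\neq 1$ of $\mathcal{H}$ is a Hall $\sigma_i$-subgroup of $G$ for some $\sigma_i\in\sigma$ and $\mathcal{H}$ contains exactly one Hall $\sigma_i$-subgroup of $G$ for every $\sigma_i\in\sigma(G)$. A subgroup $A$ of $G$ is $\sigma$-permutable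 in $G$ if $G$ possesses a complete Hall $\sigma$-set and $AH=HA$ for every Hall $\sigma_i$-subgroup $H$ of $G$ and all $i\in I$. $G$ is a $P\sigma T$-group if whenever $K$ is a $\sigma$-permutable subgroup of $H$ and $H$ is a $\sigma$-permutable subgroup of $G$, then $K$ is a $\sigma$-permutable subgroup of $G$. A $P\sigma^{0\pi}T$-group is a $P\sigma T$-group for the partition $\sigma=\sigma^{0\pi}=\{\{p_1\},\dots,\{p_n\},\pi'\}$. *)

theory Defs
  imports "HOL-Algebra.Generated_Groups" "HOL-Computational_Algebra.Primes" "HOL-Library.Disjoint_Sets"
begin

text \<open>A subgroup \<open>H\<close> of \<open>G\<close>, viewed as a group in its own right, is \<open>G\<lparr>carrier := H\<rparr>\<close>.
  All notions below are intended for finite groups; sets of primes have type \<open>nat set\<close>.\<close>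

text \<open>A \<open>p\<close>-group is a \<open>\<tau>\<close>-group for \<open>\<tau> = {p}\<close>.\<close>
definition tau_group :: "nat set \<Rightarrow> ('a, 'b) monoid_scheme \<Rightarrow> bool" where
  "tau_group \<tau> X \<longleftrightarrow> group X \<and> (\<forall>p. prime p \<and> p dvd order X \<longrightarrow> p \<in> \<tau>)"

definition all_primes :: "nat set" where
  "all_primes = {p. prime p}"

definition prime_compl :: "nat set \<Rightarrow> nat set" where
  "prime_compl \<tau> = all_primes - \<tau>"

text \<open>\<open>GREATEST\<close> is taken with respect to inclusion of subsets of the carrier.\<close>
definition O_tau :: "nat set \<Rightarrow> ('a, 'b) monoid_scheme \<Rightarrow> 'a set" where
  "O_tau \<tau> X = (GREATEST N. N \<lhd> X \<and> tau_group \<tau> (X\<lparr>carrier := N\<rparr>))"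

text \<open>\<open>chief_factor G H K\<close> says that \<open>H / K\<close> is a chief factor of \<open>G\<close>.\<close>
definition chief_factor :: "('a, 'b) monoid_scheme \<Rightarrow> 'a set \<Rightarrow> 'a set \<Rightarrow> bool" where
  "chief_factor G H K \<longleftrightarrow> H \<lhd> G \<and> K \<lhd> G \<and> K \<subset> H \<and>
     \<not> (\<exists>L. L \<lhd> G \<and> K \<subset> L \<and> L \<subset> H)"

definition pi_soluble :: "nat set \<Rightarrow> ('a, 'b) monoid_scheme \<Rightarrow> bool" where
  "pi_soluble \<pi> G \<longleftrightarrow>
     (\<forall>H K. chief_factor G H K \<longrightarrow>
        (\<exists>p\<in>\<pi>. tau_group {p} (G\<lparr>carrier := H\<rparr> Mod K)) \<or>
        tau_group (prime_compl \<pi>) (G\<lparr>carrier := H\<rparr> Mod K))"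

definition hall_subgroup :: "('a, 'b) monoid_scheme \<Rightarrow> 'a set \<Rightarrow> bool" where
  "hall_subgroup G H \<longleftrightarrow> subgroup H G \<and> coprime (card H) (card (rcosets\<^bsub>G\<^esub> H))"

definition hall_tau_subgroup :: "nat set \<Rightarrow> ('a, 'b) monoid_scheme \<Rightarrow> 'a set \<Rightarrow> bool" where
  "hall_tau_subgroup \<tau> G H \<longleftrightarrow> subgroup H G \<and> tau_group \<tau> (G\<lparr>carrier := H\<rparr>) \<and>
     (\<forall>p. prime p \<and> p dvd card (rcosets\<^bsub>G\<^esub> H) \<longrightarrow> p \<notin> \<tau>)"

text \<open>The set \<open>\<sigma>(G)\<close> of the blocks of \<open>\<sigma>\<close> that contain a prime divisor of \<open>|G|\<close>.\<close>
definition sigma_of :: "nat set set \<Rightarrow> ('a, 'b) monoid_scheme \<Rightarrow> nat set set" where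
  "sigma_of \<sigma> G = {s \<in> \<sigma>. \<exists>p\<in>s. prime p \<and> p dvd order G}"

definition complete_hall_set ::
  "nat set set \<Rightarrow> ('a, 'b) monoid_scheme \<Rightarrow> 'a set set \<Rightarrow> bool" where
  "complete_hall_set \<sigma> G \<H> \<longleftrightarrow>
     (\<forall>H\<in>\<H>. subgroup H G) \<and>
     (\<forall>H\<in>\<H>. H \<noteq> {\<one>\<^bsub>G\<^esub>} \<longrightarrow> (\<exists>s\<in>\<sigma>. hall_tau_subgroup s G H)) \<and>
     (\<forall>s\<in>sigma_of \<sigma> G. \<exists>!H. H \<in> \<H> \<and> hall_tau_subgroup s G H)"

definition sigma_permutable ::
  "nat set set \<Rightarrow> ('a, 'b) monoid_scheme \<Rightarrow> 'a set \<Rightarrow> bool" where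
  "sigma_permutable \<sigma> G A \<longleftrightarrow> subgroup A G \<and> (\<exists>\<H>. complete_hall_set \<sigma> G \<H>) \<and>
     (\<forall>s\<in>\<sigma>. \<forall>H. hall_tau_subgroup s G H \<longrightarrow> A <#>\<^bsub>G\<^esub> H = H <#>\<^bsub>G\<^esub> A)"

definition PsigmaT_group :: "nat set set \<Rightarrow> ('a, 'b) monoid_scheme \<Rightarrow> bool" where
  "PsigmaT_group \<sigma> G \<longleftrightarrow>
     (\<forall>H K. sigma_permutable \<sigma> G H \<and> sigma_permutable \<sigma> (G\<lparr>carrier := H\<rparr>) K
        \<longrightarrow> sigma_permutable \<sigma> G K)"

text \<open>The partition \<open>\<sigma>\<^sup>0\<^sup>\<pi> = {{p\<^sub>1}, \<dots>, {p\<^sub>n}, \<pi>'}\<close> for \<open>\<pi> = {p\<^sub>1, \<dots>, p\<^sub>n}\<close>.\<close>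
definition sigma0 :: "nat set \<Rightarrow> nat set set" where
  "sigma0 \<pi> = insert (prime_compl \<pi>) ((\<lambda>p. {p}) ` \<pi>)"

lemma partition_on_sigma0:
  assumes "finite \<pi>" "\<pi> \<subseteq> all_primes"
  shows "partition_on all_primes (sigma0 \<pi>)"
proof -
  have "prime_compl \<pi> \<noteq> {}"
    using primes_infinite assms(1) unfolding prime_compl_def all_primes_def
    by (metis Diff_eq_empty_iff finite_subset)
  then show ?thesis
    using assms(2)
    by (auto simp: partition_on_def sigma0_def disjoint_def prime_compl_def all_primes_def)
qed

definition complement_in :: "('a, 'b) monoid_scheme \<Rightarrow> 'a set \<Rightarrow> 'a set \<Rightarrow> bool" where
  "complement_in G A B \<longleftrightarrow> subgroup A G \<and> subgroup B G \<and>
     A <#>\<^bsub>G\<^esub> B = carrier G \<and> A \<inter> B = {\<one>\<^bsub>G\<^esub>}"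

text \<open>Internal semidirect product \<open>D \<rtimes> M\<close>.\<close>
definition internal_semidirect :: "('a, 'b) monoid_scheme \<Rightarrow> 'a set \<Rightarrow> 'a set \<Rightarrow> bool" where
  "internal_semidirect G D M \<longleftrightarrow> D \<lhd> G \<and> complement_in G D M"

definition has_normal_complement :: "('a, 'b) monoid_scheme \<Rightarrow> 'a set \<Rightarrow> bool" where
  "has_normal_complement G A \<longleftrightarrow> (\<exists>N. N \<lhd> G \<and> complement_in G A N)"

definition internal_direct_product ::
  "('a, 'b) monoid_scheme \<Rightarrow> 'i set \<Rightarrow> ('i \<Rightarrow> 'a set) \<Rightarrow> bool" where
  "internal_direct_product G I N \<longleftrightarrow>
     (\<forall>i\<in>I. N i \<lhd> G) \<and>
     generate G (\<Union>i\<in>I. N i) = carrier G \<and>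
     (\<forall>i\<in>I. N i \<inter> generate G (\<Union>j\<in>I - {i}. N j) = {\<one>\<^bsub>G\<^esub>})"

definition power_automorphism :: "('a, 'b) monoid_scheme \<Rightarrow> ('a \<Rightarrow> 'a) \<Rightarrow> bool" where
  "power_automorphism D f \<longleftrightarrow> f \<in> iso D D \<and> (\<forall>K. subgroup K D \<longrightarrow> f ` K = K)"

end

theory Submission
  imports Defs "HOL-Algebra.Multiplicative_Group" "HOL-Algebra.Group_Action" "HOL-Algebra.Sylow"
    "HOL-Algebra.SndIsomorphismGrp" "HOL-Number_Theory.Cong"
begin

text \<open>Throughout, \<open>\<sigma>\<close> is a partition of the primes, an \<open>s\<close>-element (\<open>s\<close> a set of primes) is an element whose order
  has all its prime divisors in \<open>s\<close>, and \<open>s'\<close> is the complementary set of primes. Both directions of the theorem pass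
  through one structure, \<open>sigma_structure\<close>: an abelian subgroup \<open>D\<close> containing all \<open>q\<close>-elements of \<open>G\<close> for each
  prime divisor \<open>q\<close> of its order, all of whose subgroups are normal in \<open>G\<close>, such that elements belonging to different
  blocks of \<open>\<sigma>\<close> commute modulo \<open>D\<close>, while the \<open>s\<close>-elements of \<open>G\<close> centralize those of \<open>D\<close> for every block \<open>s\<close>.

  From permutability to structure. If \<open>N \<le> M\<close> are normal in \<open>G\<close> and \<open>M/N\<close> is an \<open>s\<close>-group for a block \<open>s\<close>, then every
  subgroup between \<open>N\<close> and \<open>M\<close> is \<open>\<sigma>\<close>-permutable in \<open>M\<close>, hence in \<open>G\<close>, and therefore it is normalized by every
  \<open>s'\<close>-element \<open>y\<close> (\<open>normalizes_section_subgroups\<close>). So \<open>y\<close> maps each element of \<open>M/N\<close> to one of its powers, and its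
  order is prime to that of \<open>M/N\<close>. Such an automorphism is very restricted: if it moves a single \<open>q\<close>-element, then
  it moves all nontrivial \<open>q\<close>-elements, and these are central (\<open>all_moved\<close>, \<open>moved_central\<close>); on each set of
  \<open>q\<close>-elements it is trivial or one fixed power map, so it commutes with the action of all of \<open>G\<close>
  (\<open>action_commutes\<close>). Consequently, if \<open>x\<close> and \<open>y\<close> belong to different blocks, the commutator \<open>[x, y]\<close> centralizes all
  these sections. Let \<open>D\<close> be generated by these commutators. As the chief factors of \<open>G\<close> are such sections, \<open>D\<close> is
  abelian (\<open>D_abelian\<close>), and the other properties of the structure follow by looking at the action on \<open>D S/Q\<close>, where
  \<open>S\<close> is a Hall \<open>s\<close>-subgroup and \<open>Q\<close> is the \<open>q'\<close>-part of \<open>D\<close> for some \<open>q \<in> s\<close> (\<open>local_structure\<close>). The complement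
  \<open>M\<close> of \<open>D\<close> in \<open>G\<close>, and the normal complement of \<open>O\<^sub>\<pi>\<^sub>'(D)\<close> in a Hall \<open>\<pi>'\<close>-subgroup, come from the Schur-Zassenhaus theorem for an abelian kernel
  (\<open>abelian_normal_complement\<close>), which also provides the Hall \<open>\<pi>'\<close>-subgroups of a \<open>\<pi>\<close>-soluble group
  (\<open>hall_subgroup_exists\<close>).

  From structure to permutability. In a group with this structure and a complete Hall \<open>\<sigma>\<close>-set, a subgroup \<open>K\<close> is \<open>\<sigma>\<close>-permutable if and only if it
  contains every element of \<open>D\<close> of prime power order that is moved by some element of \<open>K\<close> of prime power order
  (\<open>absorbs_of_permutable\<close>, \<open>permutable_of_absorbs\<close>). The structure is inherited by subgroups, and the condition is
  obviously transitive. Finally, a chief factor is covered by a cyclic subgroup of \<open>D\<close> or by a normal subgroup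
  that modulo \<open>D\<close> is an \<open>s\<close>-group for some block \<open>s\<close>, which yields \<open>\<pi>\<close>-solubility.\<close>


section \<open>Numbers attached to a set of primes\<close>

definition tau_number :: "nat set \<Rightarrow> nat \<Rightarrow> bool" where
  "tau_number \<tau> n \<longleftrightarrow> n > 0 \<and> (\<forall>p. prime p \<and> p dvd n \<longrightarrow> p \<in> \<tau>)"

lemma tau_number_mult [simp]: "tau_number \<tau> (m * n) \<longleftrightarrow> tau_number \<tau> m \<and> tau_number \<tau> n"
  by (auto simp: tau_number_def prime_dvd_mult_iff)

lemma tau_number_1 [simp]: "tau_number \<tau> 1" "tau_number \<tau> (Suc 0)"
  by (auto simp: tau_number_def)

lemma tau_number_dvd: "tau_number \<tau> n \<Longrightarrow> m dvd n \<Longrightarrow> tau_number \<tau> m"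
  by (auto simp: dvd_def)

lemma tau_number_mono: "tau_number \<tau> n \<Longrightarrow> \<tau> \<subseteq> \<tau>' \<Longrightarrow> tau_number \<tau>' n"
  by (auto simp: tau_number_def)

lemma tau_number_coprime:
  assumes "tau_number \<tau> m" "tau_number \<tau>' n" "\<tau> \<inter> \<tau>' = {}"
  shows "coprime m n"
proof (rule ccontr)
  assume "\<not> coprime m n"
  then obtain p where "prime p" "p dvd gcd m n"
    using prime_factor_nat[of "gcd m n"] coprime_iff_gcd_eq_1 by blast
  with assms show False by (auto simp: tau_number_def)
qed

lemma tau_number_prime_power: "prime p \<Longrightarrow> p \<in> \<tau> \<Longrightarrow> tau_number \<tau> (p ^ a)"
  by (auto simp: tau_number_def prime_gt_0_nat dest: prime_dvd_power primes_dvd_imp_eq)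

lemma tau_number_single_iff:
  assumes "prime p" shows "tau_number {p} n \<longleftrightarrow> (\<exists>a. n = p ^ a)"
proof
  assume n: "tau_number {p} n"
  then have "n > 0" by (simp add: tau_number_def)
  have "n = p ^ multiplicity p n"
  proof -
    obtain m where m: "n = p ^ multiplicity p n * m" "\<not> p dvd m"
      using multiplicity_decompose'[of n p] \<open>n > 0\<close> assms by (metis mult.commute not_prime_unit gr0_implies_Suc nat.distinct(1))
    have "m = 1"
    proof (rule ccontr)
      assume "m \<noteq> 1"
      then obtain q where "prime q" "q dvd m" using prime_factor_nat by blast
      with n m show False by (metis dvd_mult tau_number_def singletonD)
    qed
    with m show ?thesis by simp
  qed
  then show "\<exists>a. n = p ^ a" ..
qed (use assms tau_number_prime_power in auto)

lemma tau_number_both: "tau_number \<tau> n \<Longrightarrow> tau_number \<tau>' n \<Longrightarrow> \<tau> \<inter> \<tau>' = {} \<Longrightarrow> n = 1"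
  using tau_number_coprime[of \<tau> n \<tau>' n] by simp

lemma prime_compl_disjoint [simp]: "\<tau> \<inter> prime_compl \<tau> = {}" "prime_compl \<tau> \<inter> \<tau> = {}"
  by (auto simp: prime_compl_def)

lemma tau_number_prime_compl: "n > 0 \<Longrightarrow> \<not> p dvd n \<Longrightarrow> tau_number (prime_compl {p}) n"
  by (auto simp: tau_number_def prime_compl_def all_primes_def)

text \<open>In \<open>k\<^sup>d - m\<^sup>d = (k - m) S\<close> the factor \<open>S\<close> is congruent to \<open>d m\<^sup>d\<^sup>-\<^sup>1\<close> modulo \<open>q\<close>, hence prime to \<open>q\<close>.\<close>

lemma cong_of_power_cong:
  fixes k m q d :: nat
  assumes q: "prime q" and d: "coprime d q" and m: "coprime m q"
    and pw: "[k ^ d = m ^ d] (mod q ^ a)" and km: "[k = m] (mod q)"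
  shows "[k = m] (mod q ^ a)"
proof -
  define S where "S = (\<Sum>i<d. int m ^ (d - Suc i) * int k ^ i)"
  have eq: "int k ^ d - int m ^ d = (int k - int m) * S"
    unfolding S_def by (rule power_diff_sumr2)
  have "[S = (\<Sum>i<d. int m ^ (d - Suc i) * int m ^ i)] (mod int q)"
    unfolding S_def using km by (intro cong_sum cong_mult cong_refl cong_pow) (simp add: cong_int_iff)
  also have "(\<Sum>i<d. int m ^ (d - Suc i) * int m ^ i) = (\<Sum>i<d. int m ^ (d - 1))"
    by (intro sum.cong) (auto simp flip: power_add)
  finally have S: "[S = int (d * m ^ (d - 1))] (mod int q)" by simp
  have "coprime (int (d * m ^ (d - 1))) (int q)"
    using d m by (simp only: coprime_int_iff) (simp add: coprime_power_left_iff)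
  then have "coprime S (int q)"
    using S cong_imp_coprime cong_sym by blast
  then have cop: "coprime (int (q ^ a)) S"
    by (simp add: coprime_commute)
  have "int (q ^ a) dvd (int k - int m) * S"
    using pw unfolding eq[symmetric] by (simp flip: cong_int_iff add: cong_iff_dvd_diff)
  then have "int (q ^ a) dvd int k - int m"
    using cop coprime_dvd_mult_left_iff by blast
  then show ?thesis
    by (simp flip: cong_int_iff add: cong_iff_dvd_diff)
qed

section \<open>Conjugation and elements attached to a set of primes\<close>

definition conjugate :: "('a, 'b) monoid_scheme \<Rightarrow> 'a \<Rightarrow> 'a \<Rightarrow> 'a" (infixr \<open>\<bullet>\<index>\<close> 74) where
  "g \<bullet>\<^bsub>G\<^esub> x = g \<otimes>\<^bsub>G\<^esub> x \<otimes>\<^bsub>G\<^esub> inv\<^bsub>G\<^esub> g"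

text \<open>An exponent \<open>n\<close> is used instead of the order of \<open>x\<close>: the condition is then literally the same in \<open>G\<close> and in
  a subgroup of \<open>G\<close>, and it passes to quotients.\<close>

definition tau_elements :: "nat set \<Rightarrow> ('a, 'b) monoid_scheme \<Rightarrow> 'a set" where
  "tau_elements \<tau> G = {x \<in> carrier G. \<exists>n. tau_number \<tau> n \<and> x [^]\<^bsub>G\<^esub> n = \<one>\<^bsub>G\<^esub>}"

context group
begin

lemma inv_mult_cancel [simp]:
  "\<lbrakk>a \<in> carrier G; b \<in> carrier G\<rbrakk> \<Longrightarrow> inv a \<otimes> (a \<otimes> b) = b"
  "\<lbrakk>a \<in> carrier G; b \<in> carrier G\<rbrakk> \<Longrightarrow> a \<otimes> (inv a \<otimes> b) = b"
  by (simp_all flip: m_assoc)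

lemma conj_closed [simp]: "\<lbrakk>g \<in> carrier G; x \<in> carrier G\<rbrakk> \<Longrightarrow> g \<bullet> x \<in> carrier G"
  by (simp add: conjugate_def)

lemma conj_mult: "\<lbrakk>g \<in> carrier G; x \<in> carrier G; y \<in> carrier G\<rbrakk> \<Longrightarrow> g \<bullet> (x \<otimes> y) = (g \<bullet> x) \<otimes> (g \<bullet> y)"
  by (simp add: conjugate_def m_assoc)

lemma conj_one [simp]: "g \<in> carrier G \<Longrightarrow> g \<bullet> \<one> = \<one>" "x \<in> carrier G \<Longrightarrow> \<one> \<bullet> x = x"
  by (simp_all add: conjugate_def)

lemma conj_inv: "\<lbrakk>g \<in> carrier G; x \<in> carrier G\<rbrakk> \<Longrightarrow> g \<bullet> inv x = inv (g \<bullet> x)"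
  by (simp add: conjugate_def m_assoc inv_mult_group)

lemma conj_conj: "\<lbrakk>g \<in> carrier G; h \<in> carrier G; x \<in> carrier G\<rbrakk> \<Longrightarrow> g \<bullet> h \<bullet> x = (g \<otimes> h) \<bullet> x"
  by (simp add: conjugate_def m_assoc inv_mult_group)

lemma conj_pow: "\<lbrakk>g \<in> carrier G; x \<in> carrier G\<rbrakk> \<Longrightarrow> g \<bullet> (x [^] (n::nat)) = (g \<bullet> x) [^] n"
  by (induction n) (simp_all add: conj_mult)

lemma conj_inv_cancel [simp]:
  "\<lbrakk>g \<in> carrier G; x \<in> carrier G\<rbrakk> \<Longrightarrow> inv g \<bullet> g \<bullet> x = x"
  "\<lbrakk>g \<in> carrier G; x \<in> carrier G\<rbrakk> \<Longrightarrow> g \<bullet> inv g \<bullet> x = x"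
  by (simp_all add: conj_conj)

lemma conj_inj: "\<lbrakk>g \<in> carrier G; x \<in> carrier G; y \<in> carrier G; g \<bullet> x = g \<bullet> y\<rbrakk> \<Longrightarrow> x = y"
  by (metis conj_inv_cancel(1))

lemma conj_eq_iff_commute: "\<lbrakk>g \<in> carrier G; x \<in> carrier G\<rbrakk> \<Longrightarrow> g \<bullet> x = x \<longleftrightarrow> g \<otimes> x = x \<otimes> g"
  by (simp add: conjugate_def inv_solve_right')

lemma conj_eq_sym: "\<lbrakk>g \<in> carrier G; x \<in> carrier G; g \<bullet> x = x\<rbrakk> \<Longrightarrow> x \<bullet> g = g"
  by (metis conj_eq_iff_commute)

lemma conj_subgroup: "subgroup H G \<Longrightarrow> g \<in> H \<Longrightarrow> x \<in> H \<Longrightarrow> g \<bullet>\<^bsub>G\<lparr>carrier := H\<rparr>\<^esub> x = g \<bullet> x"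
  by (simp add: conjugate_def)

lemma conj_mem_subgroup: "subgroup H G \<Longrightarrow> g \<in> H \<Longrightarrow> x \<in> H \<Longrightarrow> g \<bullet> x \<in> H"
  by (simp add: conjugate_def subgroup.m_closed subgroup.m_inv_closed)

lemma normal_iff_conj: "N \<lhd> G \<longleftrightarrow> subgroup N G \<and> (\<forall>g\<in>carrier G. \<forall>x\<in>N. g \<bullet> x \<in> N)"
  by (simp add: normal_inv_iff conjugate_def)

lemma normal_conj_mem: "N \<lhd> G \<Longrightarrow> g \<in> carrier G \<Longrightarrow> x \<in> N \<Longrightarrow> g \<bullet> x \<in> N"
  by (simp add: normal_iff_conj)

lemma subgroup_pow_mem: "subgroup H G \<Longrightarrow> x \<in> H \<Longrightarrow> x [^] (n::nat) \<in> H"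
  by (induction n) (auto simp: subgroup.one_closed subgroup.m_closed)

lemma pow_subgroup: "x [^]\<^bsub>G\<lparr>carrier := H\<rparr>\<^esub> (n::nat) = x [^] n"
  by (simp add: nat_pow_def)

lemma commute_pow:
  assumes "x \<in> carrier G" "y \<in> carrier G" "x \<bullet> y = y" shows "x [^] (n::nat) \<bullet> y = y"
  using assms by (induction n) (simp_all flip: conj_conj)

lemma mem_of_coprime_pow:
  fixes a b :: nat
  assumes K: "subgroup K G" and x: "x \<in> carrier G" and ab: "x [^] a \<in> K" "x [^] b \<in> K" "coprime a b"
  shows "x \<in> K"
proof (cases "a = 0")
  case True
  with ab show ?thesis using x by simp
next
  case False
  then obtain u v where uv: "a * u = b * v + 1"
    using bezout_nat[of a b] ab(3) by auto
  have 1: "x [^] (b * v + 1) \<in> K" "x [^] (b * v) \<in> K"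
    using ab x K uv by (metis nat_pow_pow subgroup_pow_mem)+
  have "x = inv (x [^] (b * v)) \<otimes> x [^] (b * v + 1)"
    using x by (simp flip: nat_pow_mult)
  with 1 K show ?thesis by (metis subgroup.m_closed subgroup.m_inv_closed)
qed

lemma coprime_decomposition:
  fixes a b :: nat
  assumes x: "x \<in> carrier G" and ab: "x [^] (a * b) = \<one>" "coprime a b" "a > 0" "b > 0"
  obtains i j :: nat where "x = x [^] i \<otimes> x [^] j" "(x [^] i) [^] a = \<one>" "(x [^] j) [^] b = \<one>"
proof -
  obtain u w where uv: "a * u = b * w + 1"
    using bezout_nat[of a b] ab by auto
  define i where "i = b * (w * (a * b - 1))"
  have ij: "i + a * u = 1 + (a * b) * (b * w)"
  proof -
    obtain m where m: "a * b = Suc m" using ab by (cases "a * b") auto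
    show ?thesis unfolding i_def uv m by (simp add: algebra_simps)
  qed
  have ab1: "x [^] (a * b * n) = \<one>" for n
    using x ab nat_pow_pow[of x "a * b" n] by simp
  have "x [^] i \<otimes> x [^] (a * u) = x [^] (1 + (a * b) * (b * w))"
    using x ij by (simp add: nat_pow_mult)
  also have "\<dots> = x"
    using x ab1[of "b * w"] nat_pow_mult[of x 1 "(a * b) * (b * w)"] by simp
  finally have "x = x [^] i \<otimes> x [^] (a * u)" ..
  moreover have e: "i * a = (a * b) * (w * (a * b - 1))" "a * u * b = (a * b) * u"
    unfolding i_def by (simp_all only: ac_simps)
  have "(x [^] i) [^] a = \<one>" "(x [^] (a * u)) [^] b = \<one>"
    using x by (simp_all only: nat_pow_pow e ab1)
  ultimately show thesis using that by blast
qed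

lemma tau_elements_closed [dest]: "x \<in> tau_elements \<tau> G \<Longrightarrow> x \<in> carrier G"
  by (simp add: tau_elements_def)

lemma tau_elements_pow: "x \<in> tau_elements \<tau> G \<Longrightarrow> x [^] (n::nat) \<in> tau_elements \<tau> G"
  unfolding tau_elements_def
  by (smt (verit, ccfv_threshold) mem_Collect_eq mult.commute nat_pow_closed nat_pow_one nat_pow_pow)

lemma tau_elements_conj: "x \<in> tau_elements \<tau> G \<Longrightarrow> g \<in> carrier G \<Longrightarrow> g \<bullet> x \<in> tau_elements \<tau> G"
  by (auto simp: tau_elements_def simp flip: conj_pow)

lemma tau_elements_mono: "x \<in> tau_elements \<tau> G \<Longrightarrow> \<tau> \<subseteq> \<tau>' \<Longrightarrow> x \<in> tau_elements \<tau>' G"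
  by (auto simp: tau_elements_def intro: tau_number_mono)

lemma one_tau_element [simp]: "\<one> \<in> tau_elements \<tau> G"
  by (auto simp: tau_elements_def intro: exI[of _ 1])

lemma tau_elements_inv: "x \<in> tau_elements \<tau> G \<Longrightarrow> inv x \<in> tau_elements \<tau> G"
  by (auto simp: tau_elements_def nat_pow_inv)

lemma tau_elements_commuting_mult:
  assumes "x \<in> tau_elements \<tau> G" "y \<in> tau_elements \<tau> G" "x \<otimes> y = y \<otimes> x"
  shows "x \<otimes> y \<in> tau_elements \<tau> G"
proof -
  obtain m n where mn: "tau_number \<tau> m" "x [^] m = \<one>" "tau_number \<tau> n" "y [^] n = \<one>"
    and [simp]: "x \<in> carrier G" "y \<in> carrier G"
    using assms by (auto simp: tau_elements_def)
  have "(x \<otimes> y) [^] (m * n) = x [^] (m * n) \<otimes> y [^] (n * m)"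
    using assms(3) pow_mult_distrib[of x y "m * n"] by (simp add: mult.commute)
  also have "\<dots> = \<one>" using mn by (simp flip: nat_pow_pow)
  finally show ?thesis using mn by (auto simp: tau_elements_def intro!: exI[of _ "m * n"])
qed

lemma tau_elements_disjoint:
  assumes "x \<in> tau_elements \<tau> G" "x \<in> tau_elements \<tau>' G" "\<tau> \<inter> \<tau>' = {}" shows "x = \<one>"
proof -
  obtain m n where "tau_number \<tau> m" "x [^] m = \<one>" "tau_number \<tau>' n" "x [^] n = \<one>" "x \<in> carrier G"
    using assms by (auto simp: tau_elements_def)
  then show ?thesis
    using mem_of_coprime_pow[OF triv_subgroup, of x m n] tau_number_coprime[OF _ _ assms(3)] by auto
qed

lemma tau_elements_subgroup:
  "subgroup H G \<Longrightarrow> tau_elements \<tau> (G\<lparr>carrier := H\<rparr>) = tau_elements \<tau> G \<inter> H"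
  by (auto simp: tau_elements_def pow_subgroup dest: subgroup.mem_carrier)

end


section \<open>Finite groups, their subgroups and elements of prime power order\<close>

locale finite_group = group +
  assumes fin [simp, intro]: "finite (carrier G)"

lemma (in group) tau_group_iff:
  assumes "subgroup H G" "finite (carrier G)"
  shows "tau_group \<tau> (G\<lparr>carrier := H\<rparr>) \<longleftrightarrow> tau_number \<tau> (card H)"
  using assms subgroup.finite_imp_card_positive[of H G] subgroup.subgroup_is_group[of H G]
  by (auto simp: tau_group_def tau_number_def order_def is_group)

context finite_group
begin

lemma finite_subgroup [simp]: "subgroup H G \<Longrightarrow> finite H"
  using finite_subset[OF subgroup.subset] by blast

lemma card_subgroup_pos: "subgroup H G \<Longrightarrow> card H > 0"
  using subgroup.finite_imp_card_positive by blast

lemma order_pos: "order G > 0"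
  by (simp add: order_gt_0_iff_finite)

lemma finite_group_subgroup: "subgroup H G \<Longrightarrow> finite_group (G\<lparr>carrier := H\<rparr>)"
  unfolding finite_group_def finite_group_axioms_def
  using subgroup_imp_group finite_subgroup by auto

lemma subgroup_of_subgroup: "subgroup H G \<Longrightarrow> subgroup K (G\<lparr>carrier := H\<rparr>) \<longleftrightarrow> subgroup K G \<and> K \<subseteq> H"
  using incl_subgroup[of H K] subgroup_incl[of K H] subgroup.subset[of K "G\<lparr>carrier := H\<rparr>"] by auto

lemma card_rcosets_subgroup:
  assumes "subgroup K G" "subgroup H G" "K \<subseteq> H"
  shows "card (rcosets\<^bsub>G\<lparr>carrier := H\<rparr>\<^esub> K) * card K = card H"
  using group.lagrange[OF subgroup_imp_group[OF assms(2)], of K] subgroup_incl[OF assms]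
  by (simp add: order_def)

lemma card_subgroup_dvd: "subgroup K G \<Longrightarrow> subgroup H G \<Longrightarrow> K \<subseteq> H \<Longrightarrow> card K dvd card H"
  using card_rcosets_subgroup by (metis dvd_triv_right)

lemma card_index:
  assumes "subgroup K G" "subgroup H G" "K \<subseteq> H"
  shows "card H div card K * card K = card H" "card H div card K > 0"
  using card_subgroup_dvd[OF assms] card_subgroup_pos[OF assms(1)] card_subgroup_pos[OF assms(2)]
  by (auto simp: div_greater_zero_iff dvd_imp_le)

lemma card_rcosets_div:
  assumes "subgroup K G" "subgroup H G" "K \<subseteq> H"
  shows "card (rcosets\<^bsub>G\<lparr>carrier := H\<rparr>\<^esub> K) = card H div card K"
  using card_rcosets_subgroup[OF assms] card_subgroup_pos[OF assms(1)]
  by (metis nonzero_mult_div_cancel_right not_gr_zero)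

lemma card_rcosets_div_order: "subgroup K G \<Longrightarrow> card (rcosets K) = order G div card K"
  using lagrange[of K] card_subgroup_pos[of K]
  by (metis nonzero_mult_div_cancel_right not_gr_zero)

lemma order_mod: 
  assumes "subgroup H G" "K \<lhd> G" "K \<subseteq> H"
  shows "order (G\<lparr>carrier := H\<rparr> Mod K) = card H div card K"
  using card_rcosets_div[OF normal_imp_subgroup[OF assms(2)] assms(1,3)] by (simp add: order_def FactGroup_def)

lemma tau_group_mod_iff:
  assumes "subgroup H G" "K \<lhd> G" "K \<subseteq> H"
  shows "tau_group \<tau> (G\<lparr>carrier := H\<rparr> Mod K) \<longleftrightarrow> tau_number \<tau> (card H div card K)"
proof -
  have "card H div card K > 0"
    using assms card_index(2)[of K H] normal_imp_subgroup by blast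
  then show ?thesis
    using normal.factorgroup_is_group[OF normal_restrict_supergroup[OF assms]]
    by (simp add: tau_group_def tau_number_def order_mod[OF assms])
qed

lemma pow_index_mem:
  assumes H: "subgroup H G" and N: "N \<lhd> G" "N \<subseteq> H" and x: "x \<in> H"
  shows "x [^] (card H div card N) \<in> N"
proof -
  let ?Q = "G\<lparr>carrier := H\<rparr> Mod N"
  interpret H: group "G\<lparr>carrier := H\<rparr>" using H by (rule subgroup_imp_group)
  interpret N: normal N "G\<lparr>carrier := H\<rparr>" by (rule normal_restrict_supergroup[OF H N])
  interpret Q: group ?Q by (rule N.factorgroup_is_group)
  have "(N #>\<^bsub>G\<lparr>carrier := H\<rparr>\<^esub> x) [^]\<^bsub>?Q\<^esub> order ?Q = N"
    using Q.pow_order_eq_1[of "N #>\<^bsub>G\<lparr>carrier := H\<rparr>\<^esub> x"] x by (auto simp: carrier_FactGroup)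
  then have "N #>\<^bsub>G\<lparr>carrier := H\<rparr>\<^esub> (x [^] (card H div card N)) = N"
    using x by (subst (asm) N.FactGroup_pow) (simp_all add: order_mod[OF H N] pow_subgroup)
  then have "x [^] (card H div card N) \<in> N"
    using x H.rcos_self[of "x [^] (card H div card N)" N] N.is_subgroup subgroup_pow_mem[OF H x] by auto
  then show ?thesis .
qed

lemma tau_element_mem:
  assumes "x \<in> tau_elements \<tau> G" and K: "subgroup K G" and n: "tau_number \<tau>' n" "x [^] n \<in> K" "\<tau> \<inter> \<tau>' = {}"
  shows "x \<in> K"
proof -
  obtain m where m: "tau_number \<tau> m" "x [^] m = \<one>" "x \<in> carrier G"
    using assms(1) by (auto simp: tau_elements_def)
  then show ?thesis
    using mem_of_coprime_pow[OF K, of x m n] n tau_number_coprime[of \<tau> m \<tau>' n] subgroup.one_closed[OF K] by simp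
qed

lemma tau_element_mem_normal:
  assumes "x \<in> tau_elements \<tau> G" "subgroup H G" "N \<lhd> G" "N \<subseteq> H" "x \<in> H"
    and "tau_number \<tau>' (card H div card N)" "\<tau> \<inter> \<tau>' = {}"
  shows "x \<in> N"
  using tau_element_mem[of x \<tau> N \<tau>'] pow_index_mem[of H N x] assms normal_imp_subgroup by blast

lemma tau_elements_of_tau_subgroup:
  assumes "subgroup H G" "tau_number \<tau> (card H)" "x \<in> H" shows "x \<in> tau_elements \<tau> G"
proof -
  have "x [^] card H = \<one>"
    using pow_index_mem[OF assms(1) one_is_normal _ assms(3)] subgroup.one_closed[OF assms(1)] by simp
  then show ?thesis
    using assms(2) subgroup.mem_carrier[OF assms(1,3)] by (auto simp: tau_elements_def)
qed

lemma prime_dvd_card_subgroup: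
  assumes q: "prime q" and H: "subgroup H G" and e: "e \<in> H" "e \<in> tau_elements {q} G" "e \<noteq> \<one>"
  shows "q dvd card H"
proof (rule ccontr)
  assume "\<not> q dvd card H"
  then have "tau_number (prime_compl {q}) (card H)" by (rule tau_number_prime_compl[OF card_subgroup_pos[OF H]])
  then have "e \<in> tau_elements (prime_compl {q}) G" using tau_elements_of_tau_subgroup[OF H _ e(1)] by blast
  with e(2) have "e = \<one>" by (rule tau_elements_disjoint) simp
  with e(3) show False ..
qed

lemma sylow_subgroup:
  assumes p: "prime p"
  obtains P where "subgroup P G" "tau_number {p} (card P)" "\<not> p dvd order G div card P"
proof -
  obtain a m where m: "order G = p ^ a * m" "\<not> p dvd m"
    using multiplicity_decompose'[of "order G" p] order_pos p
    by (metis not_gr_zero not_prime_unit mult.commute)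
  then obtain P where "subgroup P G" "card P = p ^ a"
    using sylow_thm[OF p is_group m(1)] by auto
  moreover have "order G div p ^ a = m" using m(1) prime_gt_0_nat[OF p] by simp
  ultimately show thesis
    using that[of P] m(2) tau_number_prime_power[OF p] by simp
qed

text \<open>A Sylow \<open>p\<close>-subgroup of \<open>H\<close> inside \<open>K\<close> would make the index of \<open>K\<close> prime to \<open>p\<close>.\<close>

lemma exists_p_element_notin:
  assumes p: "prime p" "p dvd card H div card K" and K: "subgroup K G" "K \<subseteq> H" and H: "subgroup H G"
  shows "\<exists>x\<in>H - K. x \<in> tau_elements {p} G"
proof (rule ccontr)
  assume *: "\<not> ?thesis"
  interpret H: finite_group "G\<lparr>carrier := H\<rparr>" by (rule finite_group_subgroup[OF H])
  obtain P where P': "subgroup P (G\<lparr>carrier := H\<rparr>)" "tau_number {p} (card P)" "\<not> p dvd card H div card P"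
    using H.sylow_subgroup[OF p(1)] by (auto simp: order_def)
  then have P: "subgroup P G" "P \<subseteq> H" using subgroup_of_subgroup H by auto
  have "P \<subseteq> K"
    using * tau_elements_of_tau_subgroup[OF P(1) P'(2)] P(2) by blast
  then have "card P dvd card K" by (rule card_subgroup_dvd[OF P(1) K(1)])
  moreover have "card K dvd card H" by (rule card_subgroup_dvd[OF K(1) H K(2)])
  ultimately have "card H div card K dvd card H div card P"
    using card_subgroup_pos[OF K(1)] card_subgroup_pos[OF P(1)]
    by (elim dvdE) simp
  with p P' show False using dvd_trans by blast
qed

lemma tau_number_card_div:
  assumes K: "subgroup K G" "K \<subseteq> H" and H: "subgroup H G"
    and el: "\<And>p x. prime p \<Longrightarrow> p \<notin> \<tau> \<Longrightarrow> x \<in> H \<Longrightarrow> x \<in> tau_elements {p} G \<Longrightarrow> x \<in> K"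
  shows "tau_number \<tau> (card H div card K)"
proof -
  have "card H div card K > 0"
    by (rule card_index(2)[OF K(1) H K(2)])
  then show ?thesis
    unfolding tau_number_def using exists_p_element_notin[OF _ _ K H] el by blast
qed

lemma tau_number_card:
  assumes H: "subgroup H G" and el: "H \<subseteq> tau_elements \<tau> G"
  shows "tau_number \<tau> (card H)"
proof -
  have "x \<in> {\<one>}" if "p \<notin> \<tau>" "x \<in> H" "x \<in> tau_elements {p} G" for p x
    using el that tau_elements_disjoint[of x "{p}" \<tau>] by auto
  then have "tau_number \<tau> (card H div card {\<one>})"
    using subgroup.one_closed[OF H] by (intro tau_number_card_div[OF triv_subgroup _ H]) blast+
  then show ?thesis by simp
qed

text \<open>Every element is a product of powers of itself that have prime power order.\<close>

lemma prime_power_closure: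
  assumes x: "x \<in> carrier G"
    and pp: "\<And>q i. prime q \<Longrightarrow> x [^] (i::nat) \<in> tau_elements {q} G \<Longrightarrow> P (x [^] i)"
    and mult: "\<And>i j. P (x [^] (i::nat)) \<Longrightarrow> P (x [^] (j::nat)) \<Longrightarrow> P (x [^] i \<otimes> x [^] j)"
  shows "P x"
proof -
  have "P (x [^] i)" if "n > 0" "(x [^] i) [^] n = \<one>" for n i :: nat
    using that
  proof (induction n arbitrary: i rule: less_induct)
    case (less n)
    show ?case
    proof (cases "n = 1")
      case True
      then have "x [^] i \<in> tau_elements {2} G" using less x by simp
      then show ?thesis using pp two_is_prime_nat by blast
    next
      case False
      then obtain q where q: "prime q" "q dvd n" using prime_factor_nat by blast
      obtain a m where m: "n = q ^ a * m" "\<not> q dvd m"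
        using multiplicity_decompose'[of n q] less.prems(1) q(1)
        by (metis not_gr_zero not_prime_unit mult.commute)
      have "a \<noteq> 0" using q m by (auto intro: gr0I)
      then have "q ^ a > 1" using prime_gt_1_nat[OF q(1)] by (metis one_less_power gr0I)
      show ?thesis
      proof (cases "m = 1")
        case True
        then have "x [^] i \<in> tau_elements {q} G"
          using x less.prems m q by (auto simp: tau_elements_def intro!: exI[of _ "q ^ a"] tau_number_prime_power)
        then show ?thesis using pp q by blast
      next
        case False
        have "m > 0" using less.prems m by (auto intro: gr0I)
        with False have "m > 1" by simp
        have cop: "coprime (q ^ a) m" using m q prime_imp_coprime by auto
        have y: "x [^] i \<in> carrier G" "(x [^] i) [^] (q ^ a * m) = \<one>" and "q ^ a > 0"
          using x less.prems(2) m(1) \<open>q ^ a > 1\<close> by (simp, simp, linarith)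
        obtain u v :: nat where uv: "x [^] i = (x [^] i) [^] u \<otimes> (x [^] i) [^] v" "((x [^] i) [^] u) [^] (q ^ a) = \<one>" "((x [^] i) [^] v) [^] m = \<one>"
          by (rule coprime_decomposition[OF y cop \<open>q ^ a > 0\<close> \<open>m > 0\<close>]) blast
        have "q ^ a < n" "m < n"
          unfolding m(1) using \<open>m > 1\<close> \<open>q ^ a > 1\<close> n_less_n_mult_m[of "q ^ a" m] n_less_m_mult_n[of m "q ^ a"]
          by linarith+
        moreover have "(x [^] (i * u)) [^] (q ^ a) = \<one>" "(x [^] (i * v)) [^] m = \<one>"
          using uv(2,3) nat_pow_pow[OF x] by simp_all
        ultimately have "P (x [^] (i * u))" "P (x [^] (i * v))"
          using less.IH[of "q ^ a" "i * u"] less.IH[of m "i * v"] \<open>q ^ a > 0\<close> \<open>m > 0\<close> by blast+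
        then have "P (x [^] (i * u) \<otimes> x [^] (i * v))" by (rule mult)
        then show ?thesis using uv(1) x by (simp add: nat_pow_pow)
      qed
    qed
  qed
  from this[of "order G" 1] show ?thesis using x order_pos pow_order_eq_1 by simp
qed

lemma tau_decomposition:
  assumes x: "x \<in> carrier G"
  obtains i j :: nat where "x = x [^] i \<otimes> x [^] j"
    "x [^] i \<in> tau_elements \<tau> G" "x [^] j \<in> tau_elements (prime_compl \<tau>) G"
proof -
  have "\<exists>i j. x = x [^] (i::nat) \<otimes> x [^] (j::nat) \<and> x [^] i \<in> tau_elements \<tau> G \<and> x [^] j \<in> tau_elements (prime_compl \<tau>) G"
  proof (rule prime_power_closure[OF x, where P = "\<lambda>y. \<exists>i j. y = x [^] (i::nat) \<otimes> x [^] (j::nat) \<and>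
      x [^] i \<in> tau_elements \<tau> G \<and> x [^] j \<in> tau_elements (prime_compl \<tau>) G"])
    fix q and i :: nat assume q: "prime q" "x [^] i \<in> tau_elements {q} G"
    show "\<exists>k l. x [^] i = x [^] (k::nat) \<otimes> x [^] (l::nat) \<and>
      x [^] k \<in> tau_elements \<tau> G \<and> x [^] l \<in> tau_elements (prime_compl \<tau>) G"
    proof (cases "q \<in> \<tau>")
      case True
      then show ?thesis using q x tau_elements_mono[OF q(2)] by (intro exI[of _ i] exI[of _ 0]) auto
    next
      case False
      then have "q \<in> prime_compl \<tau>" using q by (simp add: prime_compl_def all_primes_def)
      then show ?thesis using q x tau_elements_mono[OF q(2)] by (intro exI[of _ 0] exI[of _ i]) auto
    qed
  next
    fix i j :: nat
    assume "\<exists>k l. x [^] i = x [^] (k::nat) \<otimes> x [^] (l::nat) \<and>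
      x [^] k \<in> tau_elements \<tau> G \<and> x [^] l \<in> tau_elements (prime_compl \<tau>) G"
     "\<exists>k l. x [^] j = x [^] (k::nat) \<otimes> x [^] (l::nat) \<and>
      x [^] k \<in> tau_elements \<tau> G \<and> x [^] l \<in> tau_elements (prime_compl \<tau>) G"
    then obtain k l k' l' :: nat where
      a: "x [^] i = x [^] k \<otimes> x [^] l" "x [^] k \<in> tau_elements \<tau> G" "x [^] l \<in> tau_elements (prime_compl \<tau>) G"
      and b: "x [^] j = x [^] k' \<otimes> x [^] l'" "x [^] k' \<in> tau_elements \<tau> G" "x [^] l' \<in> tau_elements (prime_compl \<tau>) G"
      by blast
    have "x [^] i \<otimes> x [^] j = x [^] (k + k') \<otimes> x [^] (l + l')"
      using x unfolding a(1) b(1) by (simp add: nat_pow_mult ac_simps)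
    moreover have "x [^] (k + k') \<in> tau_elements \<tau> G"
      using tau_elements_commuting_mult[OF a(2) b(2)] x by (simp add: nat_pow_mult add.commute)
    moreover have "x [^] (l + l') \<in> tau_elements (prime_compl \<tau>) G"
      using tau_elements_commuting_mult[OF a(3) b(3)] x by (simp add: nat_pow_mult add.commute)
    ultimately show "\<exists>k l. x [^] i \<otimes> x [^] j = x [^] (k::nat) \<otimes> x [^] (l::nat) \<and>
      x [^] k \<in> tau_elements \<tau> G \<and> x [^] l \<in> tau_elements (prime_compl \<tau>) G" by blast
  qed
  then show thesis using that by blast
qed

text \<open>The powers of \<open>x\<close> that are \<open>r\<close>-elements are the powers of the \<open>r\<close>-part of \<open>x\<close>.\<close>

lemma mem_of_prime_parts:
  assumes x: "x \<in> carrier G" and K: "subgroup K G"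
    and part: "\<And>r i j. prime r \<Longrightarrow> x = x [^] (i::nat) \<otimes> x [^] (j::nat) \<Longrightarrow> x [^] i \<in> tau_elements {r} G \<Longrightarrow>
       x [^] j \<in> tau_elements (prime_compl {r}) G \<Longrightarrow> x [^] i \<in> K"
  shows "x \<in> K"
proof (rule prime_power_closure[OF x])
  fix q and l :: nat assume q: "prime q" "x [^] l \<in> tau_elements {q} G"
  obtain i j :: nat where ij: "x = x [^] i \<otimes> x [^] j" "x [^] i \<in> tau_elements {q} G" "x [^] j \<in> tau_elements (prime_compl {q}) G"
    using tau_decomposition[OF x] by blast
  have xi: "x [^] i \<in> K" using part[OF q(1) ij] .
  have comm: "x [^] i \<otimes> x [^] j = x [^] j \<otimes> x [^] i" using x by (simp add: nat_pow_mult add.commute)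
  have l: "x [^] l = (x [^] i) [^] l \<otimes> (x [^] j) [^] l"
    using pow_mult_distrib[OF comm, of l] ij(1) x by simp
  then have "(x [^] j) [^] l = inv ((x [^] i) [^] l) \<otimes> x [^] l"
    using x by simp
  also have "\<dots> \<in> tau_elements {q} G"
  proof (rule tau_elements_commuting_mult)
    show "inv ((x [^] i) [^] l) \<in> tau_elements {q} G" using ij(2) by (rule tau_elements_inv[OF tau_elements_pow])
    have "(x [^] i) [^] l \<otimes> x [^] l = x [^] l \<otimes> (x [^] i) [^] l" using x by (simp add: nat_pow_pow nat_pow_mult add.commute)
    then show "inv ((x [^] i) [^] l) \<otimes> x [^] l = x [^] l \<otimes> inv ((x [^] i) [^] l)"
      using x by (metis inv_mult_cancel(1) inv_solve_right m_assoc nat_pow_closed inv_closed m_closed)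
  qed (rule q(2))
  finally have "(x [^] j) [^] l = \<one>"
    using tau_elements_pow[OF ij(3), of l] by (intro tau_elements_disjoint[of _ "{q}" "prime_compl {q}"]) auto
  then show "x [^] l \<in> K" using l xi x K by (simp add: subgroup_pow_mem)
qed (rule subgroup.m_closed[OF K])

lemma card_set_mult:
  assumes A: "subgroup A G" and B: "subgroup B G"
  shows "card (A <#> B) * card (A \<inter> B) = card A * card B"
proof -
  define F where "F z = {(a, b). a \<in> A \<and> b \<in> B \<and> a \<otimes> b = z}" for z
  note [simp] = subgroup.mem_carrier[OF A] subgroup.mem_carrier[OF B]
  have AB: "A \<times> B = (\<Union>z\<in>A <#> B. F z)"
    by (auto simp: F_def set_mult_def)
  have "card (F z) = card (A \<inter> B)" if z: "z \<in> A <#> B" for z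
  proof -
    obtain a b where ab: "a \<in> A" "b \<in> B" "z = a \<otimes> b" using z by (auto simp: set_mult_def)
    have "bij_betw (\<lambda>c. (a \<otimes> c, inv c \<otimes> b)) (A \<inter> B) (F z)"
    proof (intro bij_betw_imageI inj_onI equalityI subsetI)
      fix w assume "w \<in> (\<lambda>c. (a \<otimes> c, inv c \<otimes> b)) ` (A \<inter> B)"
      then show "w \<in> F z" using ab A B
        by (auto simp: F_def m_assoc subgroup.m_closed subgroup.m_inv_closed)
    next
      fix w assume "w \<in> F z"
      then obtain a' b' where w: "w = (a', b')" "a' \<in> A" "b' \<in> B" "a' \<otimes> b' = a \<otimes> b"
        using ab by (auto simp: F_def)
      have e: "inv a \<otimes> a' = b \<otimes> inv b'"
      proof -
        have "inv a \<otimes> a' = inv a \<otimes> (a' \<otimes> b') \<otimes> inv b'" using w(2,3) ab(1,2) by (simp add: m_assoc)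
        also have "\<dots> = b \<otimes> inv b'" unfolding w(4) using w ab by (simp add: m_assoc)
        finally show ?thesis .
      qed
      have "inv a \<otimes> a' \<in> A" "b \<otimes> inv b' \<in> B"
        using w ab A B by (simp_all add: subgroup.m_closed subgroup.m_inv_closed)
      then have "inv a \<otimes> a' \<in> A \<inter> B" using e by simp
      moreover have "w = (a \<otimes> (inv a \<otimes> a'), inv (inv a \<otimes> a') \<otimes> b)"
        using w ab by (subst (2) e) (simp add: inv_mult_group m_assoc)
      ultimately show "w \<in> (\<lambda>c. (a \<otimes> c, inv c \<otimes> b)) ` (A \<inter> B)" by blast
    qed (use ab in simp)
    then show ?thesis by (metis bij_betw_same_card)
  qed
  moreover have "card (A \<times> B) = (\<Sum>z\<in>A <#> B. card (F z))"
    unfolding AB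
  proof (rule card_UN_disjoint)
    show "finite (A <#> B)" using A B by (simp add: set_mult_def)
    show "\<forall>z\<in>A <#> B. finite (F z)"
      using A B finite_subset[of "F _" "A \<times> B"] by (auto simp: F_def)
  qed (auto simp: F_def)
  ultimately show ?thesis by (simp add: card_cartesian_product)
qed

lemma card_set_mult_dvd:
  assumes "subgroup A G" "subgroup B G" shows "card (A <#> B) dvd card A * card B"
  using card_set_mult[OF assms] by (metis dvd_triv_left)

lemma subgroup_set_mult_of_commute:
  assumes A: "subgroup A G" and B: "subgroup B G" and AB: "A <#> B = B <#> A"
  shows "subgroup (A <#> B) G"
proof (rule subgroupI)
  note [simp] = subgroup.mem_carrier[OF A] subgroup.mem_carrier[OF B]
  show "A <#> B \<subseteq> carrier G" by (auto simp: set_mult_def)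
  show "A <#> B \<noteq> {}" using subgroup.one_closed[OF A] subgroup.one_closed[OF B] by (auto simp: set_mult_def)
  fix x assume "x \<in> A <#> B"
  then obtain a b where x: "a \<in> A" "b \<in> B" "x = a \<otimes> b" by (auto simp: set_mult_def)
  then have "inv x = inv b \<otimes> inv a" by (simp add: inv_mult_group)
  also have "\<dots> \<in> B <#> A" using subgroup.m_inv_closed[OF A x(1)] subgroup.m_inv_closed[OF B x(2)]
    by (auto simp: set_mult_def)
  finally show "inv x \<in> A <#> B" using AB by simp
  fix y assume "y \<in> A <#> B"
  then obtain c d where y: "c \<in> A" "d \<in> B" "y = c \<otimes> d" by (auto simp: set_mult_def)
  have "b \<otimes> c \<in> A <#> B" using x y AB by (auto simp: set_mult_def)
  then obtain c' b' where "c' \<in> A" "b' \<in> B" "b \<otimes> c = c' \<otimes> b'" by (auto simp: set_mult_def)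
  have "x \<otimes> y = a \<otimes> (b \<otimes> c) \<otimes> d"
    using x y by (simp add: m_assoc)
  also have "\<dots> = (a \<otimes> c') \<otimes> (b' \<otimes> d)"
    unfolding \<open>b \<otimes> c = c' \<otimes> b'\<close> using x(1,2) y(1,2) \<open>c' \<in> A\<close> \<open>b' \<in> B\<close> by (simp add: m_assoc)
  finally have "x \<otimes> y = (a \<otimes> c') \<otimes> (b' \<otimes> d)" .
  then show "x \<otimes> y \<in> A <#> B"
    using subgroup.m_closed[OF A x(1) \<open>c' \<in> A\<close>] subgroup.m_closed[OF B \<open>b' \<in> B\<close> y(2)]
    by (auto simp: set_mult_def)
qed

lemma normal_set_mult:
  assumes N: "N \<lhd> G" and B: "subgroup B G"
  shows "N <#> B = B <#> N" "subgroup (N <#> B) G" "N \<subseteq> N <#> B" "B \<subseteq> N <#> B"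
proof -
  show "N <#> B = B <#> N" using commut_normal[OF B N] by simp
  then show "subgroup (N <#> B) G"
    using subgroup_set_mult_of_commute normal_imp_subgroup[OF N] B by blast
  show "N \<subseteq> N <#> B" "B \<subseteq> N <#> B"
    using subgroup.one_closed[OF B] subgroup.one_closed[OF normal_imp_subgroup[OF N]]
      subgroup.mem_carrier[OF B] subgroup.mem_carrier[OF normal_imp_subgroup[OF N]]
    unfolding set_mult_def by (force intro: bexI[of _ \<one>])+
qed

lemma card_set_mult_div:
  assumes A: "subgroup A G" and B: "subgroup B G" and AB: "subgroup (A <#> B) G"
  shows "B \<subseteq> A <#> B" "card (A <#> B) div card B * card (A \<inter> B) = card A"
    and "tau_number \<tau> (card A) \<Longrightarrow> tau_number \<tau> (card (A <#> B) div card B)"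
proof -
  show sub: "B \<subseteq> A <#> B"
    using subgroup.one_closed[OF A] l_one[OF subgroup.mem_carrier[OF B]] unfolding set_mult_def by force
  have "card (A <#> B) div card B * card (A \<inter> B) * card B = card A * card B"
    using card_index(1)[OF B AB sub] card_set_mult[OF A B] by (metis mult.assoc mult.commute)
  then show *: "card (A <#> B) div card B * card (A \<inter> B) = card A"
    using card_subgroup_pos[OF B] by simp
  show "tau_number \<tau> (card (A <#> B) div card B)" if "tau_number \<tau> (card A)"
    using that * by (metis dvd_triv_left tau_number_dvd)
qed

lemma finite_subgroupI:
  assumes "A \<subseteq> carrier G" "A \<noteq> {}" "\<And>a b. a \<in> A \<Longrightarrow> b \<in> A \<Longrightarrow> a \<otimes> b \<in> A"
  shows "subgroup A G"
proof (rule subgroupI)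
  fix a assume a: "a \<in> A"
  then have aG: "a \<in> carrier G" using assms by auto
  have pw: "a [^] Suc n \<in> A" for n by (induction n) (use a aG assms(3) in auto)
  obtain n where n: "order G = Suc n" using order_pos gr0_implies_Suc by blast
  have "a [^] n \<otimes> a = \<one>" using pow_order_eq_1[OF aG] n by simp
  then have "inv a = a [^] n" using aG by (simp add: inv_equality)
  then have "inv a = a [^] (n * Suc n + n)"
    using aG pow_order_eq_1[OF aG] nat_pow_pow[OF aG, of "Suc n" n] n
    by (simp add: mult.commute flip: nat_pow_mult)
  also have "\<dots> \<in> A"
  proof (cases n)
    case 0
    then have "a = \<one>" using n pow_order_eq_1[OF aG] aG by simp
    then show ?thesis using a by simp
  next
    case (Suc m)
    then show ?thesis using pw[of "n * Suc n + m"] by simp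
  qed
  finally show "inv a \<in> A" .
qed (use assms in auto)

lemma cyclic_mem_iff: "x \<in> carrier G \<Longrightarrow> y \<in> generate G {x} \<longleftrightarrow> (\<exists>i::nat. y = x [^] i)"
  using generate_pow_on_finite_carrier[OF fin, of x] by auto

lemma cyclic_subgroup: "x \<in> carrier G \<Longrightarrow> subgroup (generate G {x}) G"
  by (rule generate_is_subgroup) simp

lemma cyclic_self: "x \<in> generate G {x}"
  by (rule generate.incl) simp

lemma cyclic_subset: "subgroup H G \<Longrightarrow> x \<in> H \<Longrightarrow> generate G {x} \<subseteq> H"
  by (rule generate_subgroup_incl) simp_all

end


section \<open>Quotients and complements\<close>

lemma hall_tau_subgroup_iff:
  assumes "finite_group G"
  shows "hall_tau_subgroup \<tau> G H \<longleftrightarrow> subgroup H G \<and> tau_number \<tau> (card H) \<and> tau_number (prime_compl \<tau>) (order G div card H)"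
proof -
  interpret finite_group G by fact
  show ?thesis
  proof (cases "subgroup H G")
    case True
    have "card (rcosets\<^bsub>G\<^esub> H) = order G div card H" by (rule card_rcosets_div_order[OF True])
    moreover have "order G div card H > 0"
      using card_index(2)[OF True subgroup_self subgroup.subset[OF True]] by (simp add: order_def)
    moreover have "tau_group \<tau> (G\<lparr>carrier := H\<rparr>) \<longleftrightarrow> tau_number \<tau> (card H)" using tau_group_iff[OF True] by simp
    ultimately show ?thesis
      using True by (auto simp: hall_tau_subgroup_def tau_number_def prime_compl_def all_primes_def)
  qed (auto simp: hall_tau_subgroup_def)
qed

context finite_group
begin

lemma finite_group_mod: "N \<lhd> G \<Longrightarrow> finite_group (G Mod N)"
  unfolding finite_group_def finite_group_axioms_def
  using normal.factorgroup_is_group by (auto simp: carrier_FactGroup)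

lemma mod_hom: "N \<lhd> G \<Longrightarrow> group_hom G (G Mod N) (\<lambda>x. N #> x)"
  unfolding group_hom_def group_hom_axioms_def
  using normal.factorgroup_is_group normal.r_coset_hom_Mod is_group by blast

lemma coset_eq_iff:
  assumes "N \<lhd> G" "x \<in> carrier G" "y \<in> carrier G"
  shows "N #> x = N #> y \<longleftrightarrow> x \<otimes> inv y \<in> N"
proof -
  have N: "subgroup N G" by (rule normal_imp_subgroup[OF assms(1)])
  show ?thesis
    using subgroup.rcos_module[OF N is_group assms(3,2)] repr_independence[of x N y] rcos_self[of x N] N assms(2,3) by metis
qed

lemma coset_eq_self_iff:
  assumes "N \<lhd> G" "x \<in> carrier G" shows "N #> x = N \<longleftrightarrow> x \<in> N"
  using coset_eq_iff[OF assms(1,2) one_closed] assms normal_imp_subgroup[OF assms(1)]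
  by (simp add: coset_mult_one subgroup.subset)

lemma conj_mod:
  assumes "N \<lhd> G" "g \<in> carrier G" "x \<in> carrier G"
  shows "(N #> g) \<bullet>\<^bsub>G Mod N\<^esub> (N #> x) = N #> (g \<bullet> x)"
proof -
  interpret h: group_hom G "G Mod N" "\<lambda>x. N #> x" by (rule mod_hom[OF assms(1)])
  show ?thesis using assms by (simp add: conjugate_def del: mult_FactGroup)
qed

lemma mod_image_eq_rcosets: "(\<lambda>x. N #> x) ` H = rcosets\<^bsub>G\<lparr>carrier := H\<rparr>\<^esub> N"
  by (auto simp: RCOSETS_def)

lemma mod_image_subgroup:
  assumes "N \<lhd> G" "subgroup H G" shows "subgroup ((\<lambda>x. N #> x) ` H) (G Mod N)"
  using group_hom.subgroup_img_is_subgroup[OF mod_hom[OF assms(1)] assms(2)] .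

lemma card_mod_image:
  assumes "N \<lhd> G" "subgroup H G" "N \<subseteq> H" shows "card ((\<lambda>x. N #> x) ` H) = card H div card N"
  unfolding mod_image_eq_rcosets
  by (rule card_rcosets_div[OF normal_imp_subgroup[OF assms(1)] assms(2,3)])

lemma mod_image_normal:
  assumes "N \<lhd> G" "H \<lhd> G" shows "(\<lambda>x. N #> x) ` H \<lhd> G Mod N"
proof -
  interpret Q: finite_group "G Mod N" by (rule finite_group_mod[OF assms(1)])
  show ?thesis
    unfolding Q.normal_iff_conj
    using mod_image_subgroup[OF assms(1) normal_imp_subgroup[OF assms(2)]] conj_mod[OF assms(1)]
      normal_conj_mem[OF assms(2)] subgroup.mem_carrier[OF normal_imp_subgroup[OF assms(2)]]
    by (auto simp: carrier_FactGroup)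
qed

lemma mod_preimage_subgroup:
  assumes N: "N \<lhd> G" and K: "subgroup K (G Mod N)"
  defines "Y \<equiv> {x \<in> carrier G. N #> x \<in> K}"
  shows "subgroup Y G" "N \<subseteq> Y" "card Y = card K * card N"
proof -
  interpret h: group_hom G "G Mod N" "\<lambda>x. N #> x" by (rule mod_hom[OF N])
  note NG = normal_imp_subgroup[OF N]
  show Y: "subgroup Y G"
  proof (rule subgroupI)
    show "Y \<noteq> {}" using subgroup.one_closed[OF K] NG
      by (auto simp: Y_def coset_mult_one subgroup.subset intro!: exI[of _ \<one>])
  qed (use subgroup.m_closed[OF K] subgroup.m_inv_closed[OF K] in \<open>auto simp: Y_def simp del: mult_FactGroup\<close>)
  show NY: "N \<subseteq> Y"
  proof
    fix x assume "x \<in> N"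
    then have "x \<in> carrier G" "N #> x = N" using coset_eq_self_iff[OF N] subgroup.mem_carrier[OF NG] by blast+
    then show "x \<in> Y" using subgroup.one_closed[OF K] by (simp add: Y_def)
  qed
  have "(\<lambda>x. N #> x) ` Y = K"
    using subgroup.subset[OF K] by (auto simp: Y_def carrier_FactGroup)
  then have "card K = card Y div card N" using card_mod_image[OF N Y NY] by simp
  then show "card Y = card K * card N"
    using card_index(1)[OF NG Y NY] by simp
qed

text \<open>The Schur-Zassenhaus theorem for an abelian kernel. Choosing coset representatives \<open>\<rho>\<close>, the map
  \<open>\<delta>(g) = \<Prod>\<^sub>C g \<rho>(C) \<rho>(gC)\<^sup>-\<^sup>1\<close> is a crossed homomorphism into \<open>D\<close> which on \<open>D\<close> is the
  power \<open>d \<mapsto> d\<^sup>|\<^sup>G\<^sup>:\<^sup>D\<^sup>|\<close>, hence a bijection there; its kernel is the complement.\<close>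

lemma abelian_normal_complement:
  assumes D: "D \<lhd> G" and comm: "comm_group (G\<lparr>carrier := D\<rparr>)"
    and cop: "coprime (card D) (order G div card D)"
  obtains M where "subgroup M G" "D \<inter> M = {\<one>}" "D <#> M = carrier G"
proof -
  interpret D: comm_group "G\<lparr>carrier := D\<rparr>" by (rule comm)
  note DG = normal_imp_subgroup[OF D]
  note [simp] = subgroup.mem_carrier[OF DG] 
  let ?R = "rcosets D"
  let ?P = "finprod (G\<lparr>carrier := D\<rparr>)"
  define m where "m = order G div card D"
  have card_R: "card ?R = m" unfolding m_def by (rule card_rcosets_div_order[OF DG])
  have fin_R: "finite ?R" by (simp add: RCOSETS_def)
  define \<rho> where "\<rho> C = (SOME x. x \<in> C)" for C :: "'a set"
  have \<rho>: "\<rho> C \<in> carrier G" "D #> \<rho> C = C" if C: "C \<in> ?R" for C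
  proof -
    obtain x where x: "x \<in> carrier G" "C = D #> x" using C by (auto simp: RCOSETS_def)
    then have "x \<in> C" using rcos_self[OF x(1) DG] by simp
    then have "\<rho> C \<in> C" unfolding \<rho>_def by (rule someI)
    then show "\<rho> C \<in> carrier G" "D #> \<rho> C = C"
      using x repr_independence[OF _ x(1) DG] r_coset_subset_G[OF subgroup.subset[OF DG] x(1)] by auto
  qed
  define act where "act g C = D #> (g \<otimes> \<rho> C)" for g C
  have act_coset: "act g (D #> x) = D #> (g \<otimes> x)" if "g \<in> carrier G" "x \<in> carrier G" for g x
  proof -
    have R: "D #> x \<in> ?R" using that by (auto simp: RCOSETS_def)
    have "\<rho> (D #> x) \<otimes> inv x \<in> D" using \<rho>[OF R] that coset_eq_iff[OF D] by simp
    then have "g \<bullet> (\<rho> (D #> x) \<otimes> inv x) \<in> D" by (rule normal_conj_mem[OF D that(1)])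
    then show ?thesis
      unfolding act_def using that \<rho>(1)[OF R]
      by (simp add: coset_eq_iff[OF D] conjugate_def m_assoc inv_mult_group)
  qed
  have act_R [simp]: "act g C \<in> ?R" if "g \<in> carrier G" "C \<in> ?R" for g C
    using that \<rho>(1)[OF that(2)] by (auto simp: act_def RCOSETS_def)
  have act_act: "act g (act h C) = act (g \<otimes> h) C" if "g \<in> carrier G" "h \<in> carrier G" "C \<in> ?R" for g h C
    using that \<rho>(1)[OF that(3)] unfolding act_def[of h] act_def[of "g \<otimes> h"] by (simp add: act_coset m_assoc)
  have act_one: "act \<one> C = C" if "C \<in> ?R" for C
    using \<rho>[OF that] by (simp add: act_def)
  have act_inj: "inj_on (act g) ?R" and act_surj: "act g ` ?R = ?R" if g: "g \<in> carrier G" for g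
  proof -
    show inj: "inj_on (act g) ?R"
      by (rule inj_on_inverseI[of _ "act (inv g)"]) (use g in \<open>simp add: act_act act_one\<close>)
    show "act g ` ?R = ?R"
      by (rule card_subset_eq[OF fin_R]) (use g inj in \<open>auto simp: card_image\<close>)
  qed
  define f where "f g C = g \<otimes> \<rho> C \<otimes> inv (\<rho> (act g C))" for g C
  have f_mem: "f g C \<in> D" if "g \<in> carrier G" "C \<in> ?R" for g C
    using \<rho>[OF that(2)] \<rho>[OF act_R[OF that]] that
    by (simp add: f_def act_def flip: coset_eq_iff[OF D])
  have f_mult: "f (g \<otimes> h) C = (g \<bullet> f h C) \<otimes> f g (act h C)"
    if "g \<in> carrier G" "h \<in> carrier G" "C \<in> ?R" for g h C
    using that \<rho>(1)[OF that(3)] \<rho>(1)[OF act_R[OF that(2,3)]] \<rho>(1)[OF act_R[OF _ that(3), of "g \<otimes> h"]]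
    by (simp add: f_def act_act conjugate_def m_assoc inv_mult_group)
  define \<delta> where "\<delta> g = ?P (f g) ?R" for g
  have \<delta>_mem: "\<delta> g \<in> D" if "g \<in> carrier G" for g
    unfolding \<delta>_def using D.finprod_closed[of "f g" ?R] f_mem[OF that] by auto
  have conj_prod: "?P (\<lambda>C. g \<bullet> u C) A = g \<bullet> ?P u A" if g: "g \<in> carrier G" and u: "u \<in> A \<rightarrow> D" for g u and A :: "'a set set"
    using u
  proof (induction A rule: infinite_finite_induct)
    case (insert C A)
    then have uC: "u C \<in> D" "u \<in> A \<rightarrow> D" by auto
    then have gu: "g \<bullet> u C \<in> D" "(\<lambda>C. g \<bullet> u C) \<in> A \<rightarrow> D"
      using normal_conj_mem[OF D g] by auto
    have "?P u A \<in> D" using D.finprod_closed[of u A] uC by simp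
    then show ?case using insert uC gu g by (simp add: conj_mult)
  qed (use g in auto)
  have \<delta>_mult: "\<delta> (g \<otimes> h) = (g \<bullet> \<delta> h) \<otimes> \<delta> g" if g: "g \<in> carrier G" and h: "h \<in> carrier G" for g h
  proof -
    have "\<delta> (g \<otimes> h) = ?P (\<lambda>C. (g \<bullet> f h C) \<otimes> f g (act h C)) ?R"
      unfolding \<delta>_def by (rule D.finprod_cong') (use g h f_mult f_mem normal_conj_mem[OF D] subgroup.m_closed[OF DG] in auto)
    also have "\<dots> = ?P (\<lambda>C. g \<bullet> f h C) ?R \<otimes> ?P (\<lambda>C. f g (act h C)) ?R"
      using D.finprod_multf[of "\<lambda>C. g \<bullet> f h C" ?R "\<lambda>C. f g (act h C)"] g h f_mem normal_conj_mem[OF D] by auto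
    also have "?P (\<lambda>C. g \<bullet> f h C) ?R = g \<bullet> \<delta> h"
      unfolding \<delta>_def using g h f_mem by (intro conj_prod) auto
    also have "?P (\<lambda>C. f g (act h C)) ?R = ?P (f g) (act h ` ?R)"
      using D.finprod_reindex[of "f g" "act h" ?R] act_inj[OF h] act_surj[OF h] f_mem[OF g] by auto
    also have "\<dots> = \<delta> g" using act_surj[OF h] by (simp add: \<delta>_def)
    finally show ?thesis .
  qed
  have \<delta>_D: "\<delta> d = d [^] m" if d: "d \<in> D" for d
  proof -
    have "f d C = d" if C: "C \<in> ?R" for C
    proof -
      have "act d C = C"
        unfolding act_def using \<rho>[OF C] d coset_mult_assoc[OF subgroup.subset[OF DG], of d "\<rho> C"] coset_join2[OF _ DG d] by simp
      then show ?thesis using d \<rho>(1)[OF C] by (simp add: f_def m_assoc)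
    qed
    then have "\<delta> d = ?P (\<lambda>_. d) ?R"
      unfolding \<delta>_def by (intro D.finprod_cong') (use d in auto)
    also have "\<dots> = d [^] m" using D.finprod_const[of d ?R] d card_R by (simp add: pow_subgroup)
    finally show ?thesis .
  qed
  have dm: "d = \<one>" if "d \<in> D" "d [^] m = \<one>" for d
  proof -
    have "d [^] card D = \<one>" using D.pow_order_eq_1[of d] that(1) by (simp add: order_def pow_subgroup)
    then show ?thesis
      using mem_of_coprime_pow[OF triv_subgroup, of d "card D" m] that cop by (simp add: m_def)
  qed
  define M where "M = {g \<in> carrier G. \<delta> g = \<one>}"
  have M: "subgroup M G"
  proof (rule subgroupI)
    have "\<one> \<in> D" by (rule subgroup.one_closed[OF DG])
    then show "M \<noteq> {}" using \<delta>_D[of \<one>] by (auto simp: M_def)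
    show "g \<otimes> h \<in> M" if "g \<in> M" "h \<in> M" for g h
      using that \<delta>_mult[of g h] by (simp add: M_def)
    show "inv g \<in> M" if g: "g \<in> M" for g
    proof -
      have gG: "g \<in> carrier G" "\<delta> g = \<one>" using g by (auto simp: M_def)
      have "\<delta> \<one> = \<one>" using \<delta>_D[OF \<open>\<one> \<in> D\<close>] by simp
      then have "\<delta> (inv g) = \<one>" using \<delta>_mult[of "inv g" g] gG \<delta>_mem[of "inv g"] by simp
      then show ?thesis using gG by (simp add: M_def)
    qed
  qed (auto simp: M_def)
  moreover have "D \<inter> M = {\<one>}"
    using dm \<delta>_D subgroup.one_closed[OF DG] subgroup.one_closed[OF M] by (auto simp: M_def)
  moreover have "D <#> M = carrier G"
  proof
    show "D <#> M \<subseteq> carrier G" using subgroup.subset[OF DG] subgroup.subset[OF M] by (rule setmult_subset_G)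
    show "carrier G \<subseteq> D <#> M"
    proof
      fix g assume g: "g \<in> carrier G"
      have "inj_on (\<lambda>d. d [^] m) D"
      proof (rule inj_onI)
        fix x y assume xy: "x \<in> D" "y \<in> D" "x [^] m = y [^] m"
        then have "(x \<otimes> inv y) [^] m = \<one>"
          using D.nat_pow_distrib[of x "inv y" m] DG by (simp add: pow_subgroup subgroup.m_inv_closed nat_pow_inv)
        then have "x \<otimes> inv y = \<one>" using dm xy DG by (simp add: subgroup.m_closed subgroup.m_inv_closed)
        then show "x = y" using xy by (metis inv_equality inv_inv inv_closed subgroup.mem_carrier[OF DG])
      qed
      moreover have "(\<lambda>d. d [^] m) ` D \<subseteq> D" using subgroup_pow_mem[OF DG] by auto
      ultimately have "(\<lambda>d. d [^] m) ` D = D" by (metis DG finite_subgroup endo_inj_surj)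
      moreover have "inv (\<delta> g) \<in> D" using \<delta>_mem[OF g] DG by (simp add: subgroup.m_inv_closed)
      ultimately have "inv (\<delta> g) \<in> (\<lambda>d. d [^] m) ` D" by simp
      then obtain d where d: "d \<in> D" "d [^] m = inv (\<delta> g)" by force
      have "\<delta> (d \<otimes> g) = (d \<bullet> \<delta> g) \<otimes> inv (\<delta> g)" using \<delta>_mult[of d g] \<delta>_D[OF d(1)] d g by simp
      also have "d \<bullet> \<delta> g = \<delta> g"
        using D.m_comm[of d "\<delta> g"] d(1) \<delta>_mem[OF g] by (simp add: conj_eq_iff_commute)
      finally have "d \<otimes> g \<in> M" using g d(1) \<delta>_mem[OF g] by (simp add: M_def)
      moreover have "g = inv d \<otimes> (d \<otimes> g)" using g d(1) by simp
      moreover have "inv d \<in> D" by (rule subgroup.m_inv_closed[OF DG d(1)])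
      ultimately show "g \<in> D <#> M" unfolding set_mult_def by blast
    qed
  qed
  ultimately show thesis by (rule that)
qed

text \<open>Otherwise every conjugacy class but \<open>{\<one>}\<close> has size divisible by \<open>p\<close>, and \<open>p\<close> divides \<open>|G| - 1\<close>.\<close>

lemma p_group_center_nontrivial:
  assumes p: "prime p" "tau_number {p} (order G)" and nt: "order G \<noteq> 1"
  obtains z where "z \<in> carrier G" "z \<noteq> \<one>" "\<And>g. g \<in> carrier G \<Longrightarrow> g \<bullet> z = z"
proof (rule ccontr)
  assume *: "\<not> thesis"
  note central = that
  let ?\<phi> = "\<lambda>g. \<lambda>h\<in>carrier G. g \<otimes> h \<otimes> inv g"
  interpret A: group_action G "carrier G" ?\<phi> by (rule action_by_conjugation)
  let ?O = "orbits G (carrier G) ?\<phi>"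
  have orb: "orbit G ?\<phi> x = {g \<bullet> x |g. g \<in> carrier G}" if "x \<in> carrier G" for x
    using that by (auto simp: orbit_def conjugate_def)
  have fO: "finite ?O" by (auto simp: orbits_def)
  have sum: "(\<Sum>C\<in>?O. card C) = order G"
    using A.disjoint_sum[of "\<lambda>_. 1::nat"] by (simp add: order_def)
  have "{g \<bullet> \<one> |g. g \<in> carrier G} = {\<one>}" by (auto intro!: exI[of _ \<one>])
  then have o1: "orbit G ?\<phi> \<one> = {\<one>}" using orb[OF one_closed] by simp
  then have one: "{\<one>} \<in> ?O"
    unfolding orbits_def using one_closed by (metis (mono_tags, lifting) mem_Collect_eq)
  have "p dvd card C" if C: "C \<in> ?O - {{\<one>}}" for C
  proof -
    obtain x where x: "x \<in> carrier G" "C = orbit G ?\<phi> x" using C by (auto simp: orbits_def)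
    have "x \<noteq> \<one>" using C x o1 by blast
    have "card C dvd order G"
      unfolding x(2) by (rule dvdI[OF A.orbit_stabilizer_theorem[OF x(1), symmetric]])
    moreover have "card C \<noteq> 1"
    proof
      assume "card C = 1"
      then obtain c where "C = {c}" by (rule card_1_singletonE)
      then have "g \<bullet> x = c" if "g \<in> carrier G" for g
        using that orb[OF x(1)] x(2) by blast
      note gx = this
      have "x = c" using gx[OF one_closed] x(1) by simp
      then have gxx: "g \<bullet> x = x" if "g \<in> carrier G" for g
        using gx[OF that] by simp
      have thesis by (rule central[OF x(1) \<open>x \<noteq> \<one>\<close> gxx])
      with * show False ..
    qed
    then obtain q where q: "prime q" "q dvd card C" using prime_factor_nat by blast
    ultimately have "q dvd order G" by (metis dvd_trans)
    with p q show ?thesis by (auto simp: tau_number_def)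
  qed
  then have "p dvd (\<Sum>C\<in>?O - {{\<one>}}. card C)" by (rule dvd_sum)
  moreover have "(\<Sum>C\<in>?O. card C) = 1 + (\<Sum>C\<in>?O - {{\<one>}}. card C)"
    using sum.remove[OF fO one, of card] by simp
  ultimately have "p dvd order G - 1" using sum by simp
  moreover have "p dvd order G"
    using prime_factor_nat[OF nt] p(2) by (auto simp: tau_number_def)
  ultimately have "p dvd 1"
    using order_pos by (metis One_nat_def Suc_leI dvd_diffD1)
  with p show False by auto
qed

lemma chief_factor_index:
  assumes "chief_factor G H K" shows "card H div card K \<noteq> 1"
proof
  assume 1: "card H div card K = 1"
  have H: "subgroup H G" and K: "subgroup K G" "K \<subset> H"
    using assms normal_imp_subgroup by (auto simp: chief_factor_def)
  have "card H = card K" using card_index(1)[OF K(1) H] K(2) 1 by auto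
  then show False using card_subset_eq[OF finite_subgroup[OF H]] K(2) by (metis psubset_eq)
qed

text \<open>The preimage of the centre of a chief factor is normal, so it is everything once it is nontrivial.\<close>

lemma p_chief_factor_abelian:
  assumes ch: "chief_factor G H K" and p: "prime p" "tau_number {p} (card H div card K)"
    and xy: "x \<in> H" "y \<in> H"
  shows "(x \<bullet> y) \<otimes> inv y \<in> K"
proof -
  have H: "H \<lhd> G" and K: "K \<lhd> G" "K \<subset> H" and min: "\<And>L. L \<lhd> G \<Longrightarrow> K \<subset> L \<Longrightarrow> L \<subseteq> H \<Longrightarrow> L = H"
    using ch by (auto simp: chief_factor_def)
  note HG = normal_imp_subgroup[OF H] and KG = normal_imp_subgroup[OF K(1)]
  note [simp] = subgroup.mem_carrier[OF HG] subgroup.mem_carrier[OF KG]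
  interpret H: finite_group "G\<lparr>carrier := H\<rparr>" by (rule finite_group_subgroup[OF HG])
  have KH: "K \<lhd> G\<lparr>carrier := H\<rparr>" using normal_restrict_supergroup[OF HG K(1)] K(2) by auto
  interpret Q: finite_group "G\<lparr>carrier := H\<rparr> Mod K" by (rule H.finite_group_mod[OF KH])
  have oQ: "order (G\<lparr>carrier := H\<rparr> Mod K) = card H div card K"
    using order_mod[OF HG K(1)] K(2) by auto
  obtain z' where z': "z' \<in> carrier (G\<lparr>carrier := H\<rparr> Mod K)" "z' \<noteq> \<one>\<^bsub>G\<lparr>carrier := H\<rparr> Mod K\<^esub>"
    "\<And>g. g \<in> carrier (G\<lparr>carrier := H\<rparr> Mod K) \<Longrightarrow> g \<bullet>\<^bsub>G\<lparr>carrier := H\<rparr> Mod K\<^esub> z' = z'"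
    using Q.p_group_center_nontrivial[OF p(1)] p(2) oQ chief_factor_index[OF ch] by metis
  obtain z where z: "z \<in> H" "z' = K #>\<^bsub>G\<lparr>carrier := H\<rparr>\<^esub> z"
    using z'(1) unfolding carrier_FactGroup by auto
  define Z where "Z = {z \<in> H. \<forall>h\<in>H. (h \<bullet> z) \<otimes> inv z \<in> K}"
  have "z \<notin> K" using z'(2) H.coset_eq_self_iff[OF KH, of z] z by auto
  moreover have "z \<in> Z"
  proof -
    have "(h \<bullet> z) \<otimes> inv z \<in> K" if h: "h \<in> H" for h
    proof -
      have "(K #>\<^bsub>G\<lparr>carrier := H\<rparr>\<^esub> h) \<bullet>\<^bsub>G\<lparr>carrier := H\<rparr> Mod K\<^esub> (K #>\<^bsub>G\<lparr>carrier := H\<rparr>\<^esub> z) = K #>\<^bsub>G\<lparr>carrier := H\<rparr>\<^esub> z"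
        using z'(3)[of "K #>\<^bsub>G\<lparr>carrier := H\<rparr>\<^esub> h"] h z(2) by (auto simp: carrier_FactGroup)
      then have "K #>\<^bsub>G\<lparr>carrier := H\<rparr>\<^esub> (h \<bullet>\<^bsub>G\<lparr>carrier := H\<rparr>\<^esub> z) = K #>\<^bsub>G\<lparr>carrier := H\<rparr>\<^esub> z"
        using H.conj_mod[OF KH, of h z] h z by simp
      then show ?thesis
        using H.coset_eq_iff[OF KH, of "h \<bullet> z" z] h z HG conj_mem_subgroup[OF HG h z(1)] by (simp add: conj_subgroup)
    qed
    then show ?thesis using z by (simp add: Z_def)
  qed
  moreover have KZ: "K \<subseteq> Z"
  proof
    fix a assume "a \<in> K"
    then show "a \<in> Z"
      using K(2) subgroup.m_closed[OF KG normal_conj_mem[OF K(1)] subgroup.m_inv_closed[OF KG]] by (auto simp: Z_def)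
  qed
  moreover have "Z \<lhd> G"
    unfolding normal_iff_conj
  proof (intro conjI ballI)
    show "subgroup Z G"
    proof (rule subgroupI)
      fix a b assume "a \<in> Z" "b \<in> Z"
      then have ab: "a \<in> H" "b \<in> H" "\<And>h. h \<in> H \<Longrightarrow> (h \<bullet> a) \<otimes> inv a \<in> K" "\<And>h. h \<in> H \<Longrightarrow> (h \<bullet> b) \<otimes> inv b \<in> K"
        by (auto simp: Z_def)
      have "(h \<bullet> (a \<otimes> b)) \<otimes> inv (a \<otimes> b) \<in> K" if h: "h \<in> H" for h
      proof -
        have "(h \<bullet> (a \<otimes> b)) \<otimes> inv (a \<otimes> b) = ((h \<bullet> a) \<otimes> inv a) \<otimes> (a \<bullet> ((h \<bullet> b) \<otimes> inv b))"
          using ab(1,2) h by (simp add: conjugate_def m_assoc inv_mult_group)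
        then show ?thesis using ab h normal_conj_mem[OF K(1) _ ab(4)[OF h]] subgroup.m_closed[OF KG] by simp
      qed
      then show "a \<otimes> b \<in> Z" using ab subgroup.m_closed[OF HG] by (simp add: Z_def)
      have "(h \<bullet> inv a) \<otimes> inv (inv a) \<in> K" if h: "h \<in> H" for h
      proof -
        have "(h \<bullet> inv a) \<otimes> inv (inv a) = inv ((inv a) \<bullet> ((h \<bullet> a) \<otimes> inv a))" if "a \<in> carrier G" "h \<in> carrier G"
          using that by (simp add: conjugate_def m_assoc inv_mult_group)
        then show ?thesis using ab h normal_conj_mem[OF K(1) _ ab(3)[OF h], of "inv a"] subgroup.m_inv_closed[OF KG] by simp
      qed
      then show "inv a \<in> Z" using ab subgroup.m_inv_closed[OF HG] by (simp add: Z_def)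
    next
      show "Z \<subseteq> carrier G" using subgroup.subset[OF HG] unfolding Z_def by blast
      show "Z \<noteq> {}" using KZ subgroup.one_closed[OF KG] by blast
    qed
    fix g a assume g: "g \<in> carrier G" and "a \<in> Z"
    then have a: "a \<in> H" "\<And>h. h \<in> H \<Longrightarrow> (h \<bullet> a) \<otimes> inv a \<in> K" by (auto simp: Z_def)
    have "(h \<bullet> (g \<bullet> a)) \<otimes> inv (g \<bullet> a) \<in> K" if h: "h \<in> H" for h
    proof -
      have "(h \<bullet> (g \<bullet> a)) \<otimes> inv (g \<bullet> a) = g \<bullet> (((inv g \<bullet> h) \<bullet> a) \<otimes> inv a)"
        using a(1) h g by (simp add: conjugate_def m_assoc inv_mult_group)
      then show ?thesis using a(2)[of "inv g \<bullet> h"] normal_conj_mem[OF H _ h] normal_conj_mem[OF K(1) g] g by simp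
    qed
    then show "g \<bullet> a \<in> Z" using normal_conj_mem[OF H g a(1)] by (simp add: Z_def)
  qed
  ultimately have "Z = H" using min[of Z] by (auto simp: Z_def)
  then show ?thesis using xy by (auto simp: Z_def)
qed

lemma exists_chief_factor_above:
  assumes N: "N \<lhd> G" and L: "L \<lhd> G" "N \<subset> L"
  obtains H where "chief_factor G H N" "H \<subseteq> L"
proof -
  let ?S = "{H. H \<lhd> G \<and> N \<subset> H \<and> H \<subseteq> L}"
  obtain H where H: "H \<in> ?S" "\<And>K. K \<in> ?S \<Longrightarrow> card H \<le> card K"
    using ex_has_least_nat[of "\<lambda>H. H \<in> ?S" L card] L by blast
  have "\<not> K \<subset> H" if K: "K \<lhd> G" "N \<subset> K" for K
  proof
    assume KH: "K \<subset> H"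
    then have "card K < card H"
      using H(1) normal_imp_subgroup finite_subgroup by (intro psubset_card_mono) blast+
    moreover have "K \<in> ?S" using K KH H(1) by auto
    ultimately show False using H(2) by fastforce
  qed
  then have "chief_factor G H N" using H(1) N by (auto simp: chief_factor_def)
  with H(1) that show thesis by blast
qed

text \<open>Descending along chief factors of \<open>G\<close> one keeps a subgroup \<open>X\<close> above the current normal
  subgroup \<open>N\<close> such that \<open>X/N\<close> is a Hall \<open>\<tau>\<close>-subgroup of \<open>G/N\<close>: crossing a \<open>\<tau>\<close>-factor needs no
  change of \<open>X\<close>, and crossing a \<open>p\<close>-factor with \<open>p \<notin> \<tau>\<close> one passes to a complement of it in \<open>X\<close>.\<close>

theorem hall_subgroup_exists:
  assumes chief: "\<And>H K. chief_factor G H K \<Longrightarrow> tau_number \<tau> (card H div card K) \<or>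
     (\<exists>p. prime p \<and> p \<notin> \<tau> \<and> tau_number {p} (card H div card K))"
  obtains E where "hall_tau_subgroup \<tau> G E"
proof -
  have "\<exists>X. subgroup X G \<and> N \<subseteq> X \<and> tau_number \<tau> (card X div card N) \<and> tau_number (prime_compl \<tau>) (order G div card X)"
    if "N \<lhd> G" for N
    using that
  proof (induction "order G - card N" arbitrary: N rule: less_induct)
    case less
    note NG = normal_imp_subgroup[OF less.prems]
    show ?case
    proof (cases "N = carrier G")
      case True
      then have "card N = order G" by (simp add: order_def)
      then show ?thesis using True NG order_pos by (intro exI[of _ N]) simp
    next
      case False
      then have "N \<subset> carrier G" using subgroup.subset[OF NG] by auto
      then obtain H where ch: "chief_factor G H N" 
        using exists_chief_factor_above[OF less.prems normal_self] by blast
      then have H: "H \<lhd> G" "N \<subset> H" by (auto simp: chief_factor_def)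
      note HG = normal_imp_subgroup[OF H(1)]
      have "card N < card H" using H(2) finite_subgroup[OF HG] by (rule psubset_card_mono[rotated])
      moreover have "card H \<le> order G" 
        using card_mono[OF fin subgroup.subset[OF HG]] by (simp add: order_def)
      ultimately have "order G - card H < order G - card N" by linarith
      then obtain X where X: "subgroup X G" "H \<subseteq> X" "tau_number \<tau> (card X div card H)"
          "tau_number (prime_compl \<tau>) (order G div card X)"
        using less.hyps H(1) by blast
      have NX: "N \<subseteq> X" using H X by auto
      have e: "card H div card N * card N = card H" "card X div card H * card H = card X"
        using card_index(1)[OF NG HG] card_index(1)[OF HG X(1,2)] H(2) by blast+
      have XN: "card X div card N = (card X div card H) * (card H div card N)"
      proof -
        have "(card X div card H) * (card H div card N) * card N = card X"
          unfolding mult.assoc e ..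
        then show ?thesis using card_subgroup_pos[OF NG] by (metis nonzero_mult_div_cancel_right not_gr_zero)
      qed
      consider "tau_number \<tau> (card H div card N)"
        | p where "prime p" "p \<notin> \<tau>" "tau_number {p} (card H div card N)"
        using chief[OF ch] by blast
      then show ?thesis
      proof cases
        case 1
        then show ?thesis using X NX XN by (intro exI[of _ X]) simp
      next
        case p: 2
        interpret X: finite_group "G\<lparr>carrier := X\<rparr>" by (rule finite_group_subgroup[OF X(1)])
        have NX': "N \<lhd> G\<lparr>carrier := X\<rparr>" and HX': "H \<lhd> G\<lparr>carrier := X\<rparr>"
          using normal_restrict_supergroup[OF X(1)] less.prems H(1) NX X(2) by auto
        let ?Q = "G\<lparr>carrier := X\<rparr> Mod N"
        interpret Q: finite_group ?Q by (rule X.finite_group_mod[OF NX'])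
        let ?D = "(\<lambda>x. N #>\<^bsub>G\<lparr>carrier := X\<rparr>\<^esub> x) ` H"
        have D: "?D \<lhd> ?Q" by (rule X.mod_image_normal[OF NX' HX'])
        have cD: "card ?D = card H div card N"
          using X.card_mod_image[OF NX' normal_imp_subgroup[OF HX']] H(2) by auto
        have oQ: "order ?Q = card X div card N" by (rule order_mod[OF X(1) less.prems NX])
        have posHN: "card H div card N > 0" using card_index(2)[OF NG HG] H(2) by auto
        have cop: "coprime (card ?D) (order ?Q div card ?D)"
          unfolding cD oQ XN using posHN tau_number_coprime[OF p(3) X(3)] p(2) by simp
        have comm: "comm_group (?Q\<lparr>carrier := ?D\<rparr>)"
        proof (rule group.group_comm_groupI)
          show "group (?Q\<lparr>carrier := ?D\<rparr>)" using Q.subgroup_imp_group[OF normal_imp_subgroup[OF D]] .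
          fix u v assume "u \<in> carrier (?Q\<lparr>carrier := ?D\<rparr>)" "v \<in> carrier (?Q\<lparr>carrier := ?D\<rparr>)"
          then obtain x y where xy: "x \<in> H" "y \<in> H" "u = N #>\<^bsub>G\<lparr>carrier := X\<rparr>\<^esub> x" "v = N #>\<^bsub>G\<lparr>carrier := X\<rparr>\<^esub> y"
            by auto
          have xyX: "x \<in> X" "y \<in> X" using xy X(2) by auto
          then have [simp]: "x \<in> carrier G" "y \<in> carrier G" using subgroup.mem_carrier[OF X(1)] by auto
          have "(x \<bullet> y) \<otimes> inv y \<in> N" by (rule p_chief_factor_abelian[OF ch p(1,3) xy(1,2)])
          moreover have "(x \<bullet> y) \<otimes> inv y = (x \<otimes> y) \<otimes> inv (y \<otimes> x)"
            by (simp add: conjugate_def m_assoc inv_mult_group)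
          ultimately have "N #>\<^bsub>G\<lparr>carrier := X\<rparr>\<^esub> (x \<otimes> y) = N #>\<^bsub>G\<lparr>carrier := X\<rparr>\<^esub> (y \<otimes> x)"
            using X.coset_eq_iff[OF NX', of "x \<otimes> y" "y \<otimes> x"] xyX subgroup.m_closed[OF X(1)] X(1) by simp
          moreover have "u \<otimes>\<^bsub>?Q\<^esub> v = N #>\<^bsub>G\<lparr>carrier := X\<rparr>\<^esub> (x \<otimes> y)" "v \<otimes>\<^bsub>?Q\<^esub> u = N #>\<^bsub>G\<lparr>carrier := X\<rparr>\<^esub> (y \<otimes> x)"
            using normal.rcos_sum[OF NX'] xy xyX by simp_all
          ultimately show "u \<otimes>\<^bsub>?Q\<lparr>carrier := ?D\<rparr>\<^esub> v = v \<otimes>\<^bsub>?Q\<lparr>carrier := ?D\<rparr>\<^esub> u" by simp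
        qed
        obtain M where M: "subgroup M ?Q" "?D \<inter> M = {\<one>\<^bsub>?Q\<^esub>}" "?D <#>\<^bsub>?Q\<^esub> M = carrier ?Q"
          using Q.abelian_normal_complement[OF D comm cop] by blast
        have "card ?D * card M = order ?Q"
          using Q.card_set_mult[OF normal_imp_subgroup[OF D] M(1)] M(2,3) by (simp add: order_def)
        then have cM: "card M = card X div card H"
          unfolding cD oQ XN using posHN by (metis mult.commute nonzero_mult_div_cancel_left not_gr_zero)
        define Y where "Y = {x \<in> carrier (G\<lparr>carrier := X\<rparr>). N #>\<^bsub>G\<lparr>carrier := X\<rparr>\<^esub> x \<in> M}"
        have "subgroup Y (G\<lparr>carrier := X\<rparr>)" and Y: "N \<subseteq> Y" "card Y = card M * card N"
          using X.mod_preimage_subgroup[OF NX' M(1)] by (auto simp: Y_def)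
        then have YG: "subgroup Y G" "Y \<subseteq> X" using subgroup_of_subgroup[OF X(1)] by auto
        have "card Y div card N = card X div card H"
          using Y(2) cM card_subgroup_pos[OF NG] by simp
        moreover have "order G div card Y = (order G div card X) * (card H div card N)"
        proof -
          have "(order G div card X) * (card H div card N) * card Y
              = (order G div card X) * ((card X div card H) * ((card H div card N) * card N))"
            using Y(2) cM by simp
          also have "\<dots> = order G"
            unfolding e using card_index(1)[OF X(1) subgroup_self subgroup.subset[OF X(1)]]
            by (simp add: order_def)
          finally show ?thesis
            using card_subgroup_pos[OF YG(1)] by (metis nonzero_mult_div_cancel_right not_gr_zero)
        qed
        moreover have "tau_number (prime_compl \<tau>) (card H div card N)"
          using tau_number_mono[OF p(3)] p(1,2) by (auto simp: prime_compl_def all_primes_def)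
        ultimately show ?thesis
          using X YG Y by (intro exI[of _ Y]) simp
      qed
    qed
  qed
  from this[OF one_is_normal] obtain E where "subgroup E G" "tau_number \<tau> (card E div card {\<one>})"
    "tau_number (prime_compl \<tau>) (order G div card E)" by blast
  then have "hall_tau_subgroup \<tau> G E"
    by (simp add: hall_tau_subgroup_iff[OF finite_group_axioms])
  then show thesis by (rule that)
qed

end


section \<open>Coprime power automorphisms\<close>

context group
begin

lemma pow_eq_iff_cong: "x \<in> carrier G \<Longrightarrow> x [^] (i::nat) = x [^] (j::nat) \<longleftrightarrow> [i = j] (mod ord x)"
  using int_pow_eq[of x "int i" "int j"]
  by (simp add: int_pow_int cong_iff_dvd_diff dvd_diff_commute flip: cong_int_iff)

lemma div_eq_one_iff: "a \<in> carrier G \<Longrightarrow> b \<in> carrier G \<Longrightarrow> a \<otimes> inv b = \<one> \<longleftrightarrow> a = b"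
  using inv_equality[of a "inv b"] by auto

lemma conj_self: "g \<in> carrier G \<Longrightarrow> g \<bullet> g = g"
  by (simp add: conjugate_def m_assoc)

lemma centralizer_subgroup:
  assumes "h \<in> carrier G" shows "subgroup {u \<in> carrier G. u \<bullet> h = h} G"
proof (rule subgroupI)
  fix a assume a: "a \<in> {u \<in> carrier G. u \<bullet> h = h}"
  then show "inv a \<in> {u \<in> carrier G. u \<bullet> h = h}"
    using assms conj_inv_cancel(1)[of a h] by auto
  fix b assume "b \<in> {u \<in> carrier G. u \<bullet> h = h}"
  with a show "a \<otimes> b \<in> {u \<in> carrier G. u \<bullet> h = h}"
    using assms by (auto simp flip: conj_conj)
qed (use assms in auto)

end

context finite_group
begin

lemma ord_prime_power:
  assumes "prime q" "x \<in> tau_elements {q} G" obtains a where "ord x = q ^ a"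
proof -
  obtain n where "tau_number {q} n" "x [^] n = \<one>" "x \<in> carrier G"
    using assms by (auto simp: tau_elements_def)
  then have "\<exists>a. ord x = q ^ a"
    using assms(1) pow_eq_id tau_number_single_iff tau_number_dvd by metis
  with that show thesis by blast
qed

lemma ord_of_nontrivial_prime_element:
  assumes "prime q" "x \<in> tau_elements {q} G" "x \<noteq> \<one>" shows "q dvd ord x"
proof -
  obtain a where "ord x = q ^ a" using ord_prime_power assms by blast
  moreover have "ord x \<noteq> 1" using assms ord_eq_1 by blast
  ultimately show ?thesis by (cases a) auto
qed

lemma ord_eq_prime: "prime q \<Longrightarrow> x \<in> carrier G \<Longrightarrow> x \<noteq> \<one> \<Longrightarrow> x [^] q = \<one> \<Longrightarrow> ord x = q"
  using pow_eq_id ord_eq_1 prime_nat_iff by metis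

lemma prime_order_power:
  assumes "prime q" "x \<in> tau_elements {q} G" "x \<noteq> \<one>"
  obtains i :: nat where "x [^] i \<noteq> \<one>" "(x [^] i) [^] q = \<one>"
proof -
  have x: "x \<in> carrier G" using assms(2) by auto
  have q: "q dvd ord x" by (rule ord_of_nontrivial_prime_element[OF assms])
  have o: "ord x > 0" using x fin ord_ge_1[of x] by auto
  have "\<not> ord x dvd ord x div q"
  proof
    assume "ord x dvd ord x div q"
    moreover have "ord x div q > 0" using o q by (auto simp: div_greater_zero_iff dvd_imp_le)
    ultimately have "ord x \<le> ord x div q" by (rule dvd_imp_le)
    moreover have "ord x div q < ord x" using o prime_gt_1_nat[OF assms(1)] by simp
    ultimately show False by simp
  qed
  then have "x [^] (ord x div q) \<noteq> \<one>" using x pow_eq_id by blast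
  moreover have "(x [^] (ord x div q)) [^] q = \<one>" using q x by (simp add: nat_pow_pow)
  ultimately show thesis by (rule that)
qed

text \<open>Since \<open>q\<close> does not divide \<open>s - t\<close>, the element \<open>x\<^sup>s x\<^sup>-\<^sup>t\<close> generates the same subgroup as \<open>x\<close>.\<close>

lemma mem_of_power_quotient:
  assumes q: "prime q" and x: "x \<in> tau_elements {q} G" and U: "subgroup U G"
    and mem: "x [^] (s::nat) \<otimes> inv (x [^] (t::nat)) \<in> U" and st: "\<not> [s = t] (mod q)"
  shows "x \<in> U"
proof -
  have xG: "x \<in> carrier G" using x by auto
  obtain a where a: "ord x = q ^ a" using ord_prime_power q x by blast
  define e where "e = s + (q ^ a * t - t)"
  have le: "t \<le> q ^ a * t" using prime_gt_0_nat[OF q] by simp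
  have "x [^] s \<otimes> inv (x [^] t) = x [^] e"
  proof -
    have "x [^] (q ^ a * t - t) \<otimes> x [^] t = x [^] (q ^ a * t)"
      using le xG by (simp add: nat_pow_mult)
    also have "\<dots> = \<one>" using xG a pow_eq_id by auto
    finally have "inv (x [^] t) = x [^] (q ^ a * t - t)" using xG by (simp add: inv_equality)
    then show ?thesis using xG by (simp add: e_def nat_pow_mult)
  qed
  then have xe: "x [^] e \<in> U" using mem by simp
  show ?thesis
  proof (cases "a = 0")
    case True
    then have "x = \<one>" using a xG ord_eq_1 by simp
    then show ?thesis using subgroup.one_closed[OF U] by simp
  next
    case False
    have "\<not> q dvd e"
    proof
      assume "q dvd e"
      moreover have "e + t = s + q ^ a * t" unfolding e_def using le by (metis add.assoc le_add_diff_inverse2)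
      then have "e + t = s + q * (q ^ (a - 1) * t)"
        using False by (simp add: power_eq_if mult.assoc)
      then have "[e + t = s] (mod q)"
        by (simp add: cong_def)
      ultimately have "[t = s] (mod q)"
        by (metis cong_0_iff cong_add_rcancel_0_nat cong_sym cong_trans)
      with st show False by (simp add: cong_sym_eq)
    qed
    then have "coprime e (q ^ a)" using prime_imp_coprime[OF q] by (simp add: coprime_commute)
    moreover have "x [^] (q ^ a) \<in> U" using a xG subgroup.one_closed[OF U] pow_ord_eq_1[OF xG] by simp
    ultimately show ?thesis using mem_of_coprime_pow[OF U xG xe] by blast
  qed
qed

end

text \<open>Conjugation by \<open>y\<close> is then a power automorphism of \<open>X\<close> whose order divides \<open>d\<close> and so is prime to \<open>card X\<close>. It
  is given by an element of a group \<open>G\<close> around \<open>X\<close> because it is to be compared with the action of \<open>G\<close> on \<open>X\<close>.\<close>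

locale coprime_power_action = finite_group +
  fixes X y d
  assumes X: "X \<lhd> G" and y [simp]: "y \<in> carrier G" and y_pow: "y [^] (d::nat) = \<one>"
    and d_coprime: "coprime d (card X)" and powers: "\<And>x. x \<in> X \<Longrightarrow> \<exists>k::nat. y \<bullet> x = x [^] k"
begin

lemma X_subgroup: "subgroup X G" by (rule normal_imp_subgroup[OF X])

lemma X_carrier [simp]: "x \<in> X \<Longrightarrow> x \<in> carrier G"
  by (rule subgroup.mem_carrier[OF X_subgroup])

lemma X_pow [simp]: "x \<in> X \<Longrightarrow> x [^] (n::nat) \<in> X" by (rule subgroup_pow_mem[OF X_subgroup])

lemma iterate:
  fixes k n :: nat
  assumes "x \<in> X" "y \<bullet> x = x [^] k" shows "y [^] n \<bullet> x = x [^] (k ^ n)"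
proof (induction n)
  case (Suc n)
  have "y [^] Suc n \<bullet> x = y [^] n \<bullet> y \<bullet> x" using assms(1) by (simp add: conj_conj)
  also have "\<dots> = (y [^] n \<bullet> x) [^] k" unfolding assms(2) using assms(1) by (simp add: conj_pow)
  also have "\<dots> = x [^] (k ^ Suc n)" unfolding Suc using assms(1) by (simp add: nat_pow_pow mult.commute)
  finally show ?case .
qed (use assms(1) in \<open>simp add: nat_pow_eone\<close>)

lemma pow_exponent: "x \<in> X \<Longrightarrow> y \<bullet> x = x [^] k \<Longrightarrow> [k ^ d = 1] (mod ord x)"
  using iterate[of x k d] pow_eq_iff_cong[of x "k ^ d" 1] y_pow by simp

lemma d_coprime_prime:
  assumes "prime q" "x \<in> X" "x \<in> tau_elements {q} G" "x \<noteq> \<one>" shows "coprime d q"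
  using prime_dvd_card_subgroup[OF assms(1) X_subgroup assms(2-4)] d_coprime coprime_divisors dvd_refl by blast

lemma exponent_coprime:
  assumes "prime q" "x \<in> X" "x \<in> tau_elements {q} G" "x \<noteq> \<one>" "y \<bullet> x = x [^] k" shows "coprime k q"
proof -
  have "[k ^ d = 1] (mod q)"
    using pow_exponent[OF assms(2,5)] ord_of_nontrivial_prime_element[OF assms(1,3,4)] cong_dvd_modulus_nat by blast
  then have cd: "coprime (k ^ d) q" using cong_imp_coprime[OF cong_sym] by (metis coprime_1_left)
  have "d \<noteq> 0"
    using d_coprime_prime[OF assms(1-4)] assms(1) by (auto intro!: gr0I)
  then show ?thesis using cd by (simp add: coprime_power_left_iff)
qed

text \<open>An exponent that is right modulo \<open>q\<close> is right: the \<open>d\<close>-th powers agree and \<open>q\<close> does not divide \<open>d\<close>.\<close>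

lemma exponents_agree:
  assumes "prime q" "x \<in> X" "x \<in> tau_elements {q} G" "[k = m] (mod q)" "coprime m q"
    and "[k ^ d = 1] (mod ord x)" "[m ^ d = 1] (mod ord x)"
  shows "x [^] k = x [^] m"
proof (cases "x = \<one>")
  case False
  obtain a where a: "ord x = q ^ a" using ord_prime_power assms by blast
  have "[k = m] (mod q ^ a)"
    using d_coprime_prime[OF assms(1-3) False] assms a
    by (intro cong_of_power_cong[of q d m k a]) (auto intro: cong_trans cong_sym)
  then show ?thesis using pow_eq_iff_cong a assms by simp
qed simp

lemma moved_exponent:
  assumes "prime q" "x \<in> X" "x \<in> tau_elements {q} G" "y \<bullet> x = x [^] k" "y \<bullet> x \<noteq> x"
  shows "\<not> [k = 1] (mod q)"
  using exponents_agree[of q x k 1] pow_exponent[of x k] assms by auto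

lemma moved_mem:
  assumes "prime q" "x \<in> X" "x \<in> tau_elements {q} G" "y \<bullet> x \<noteq> x"
    and U: "subgroup U G" "(y \<bullet> x) \<otimes> inv x \<in> U"
  shows "x \<in> U"
proof -
  obtain k :: nat where k: "y \<bullet> x = x [^] k" using powers assms by blast
  show ?thesis
    using mem_of_power_quotient[OF assms(1,3) U(1), of k 1] moved_exponent[OF assms(1-3) k assms(4)] U(2) k assms(2) by simp
qed

text \<open>The elements mapping each element of \<open>X\<close> to one of its powers form a subgroup normalized by \<open>X\<close>. It contains
  \<open>y\<close>, hence also the commutator of \<open>y\<close> and \<open>x\<close>, and this generates the same subgroup as \<open>x\<close>.\<close>

lemma moved_normalizes:
  assumes "prime q" "x \<in> X" "x \<in> tau_elements {q} G" "y \<bullet> x \<noteq> x" "h \<in> X"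
  shows "\<exists>m::nat. x \<bullet> h = h [^] m"
proof -
  define N where "N = {u \<in> carrier G. \<forall>h\<in>X. \<exists>m::nat. u \<bullet> h = h [^] m}"
  have N: "subgroup N G"
  proof (rule finite_subgroupI)
    show "N \<noteq> {}" using y powers unfolding N_def by blast
    fix a b assume ab: "a \<in> N" "b \<in> N"
    have "\<exists>m::nat. (a \<otimes> b) \<bullet> h = h [^] m" if h: "h \<in> X" for h
    proof -
      obtain m n :: nat where "a \<bullet> h = h [^] m" "b \<bullet> h = h [^] n" using ab h unfolding N_def by blast
      then have "(a \<otimes> b) \<bullet> h = h [^] (m * n)" using ab h by (simp add: N_def conj_pow nat_pow_pow flip: conj_conj)
      then show ?thesis ..
    qed
    then show "a \<otimes> b \<in> N" using ab by (auto simp: N_def)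
  qed (auto simp: N_def)
  have yN: "y \<in> N" using powers by (auto simp: N_def)
  have "x \<bullet> inv y \<in> N"
  proof -
    have "\<exists>m::nat. (x \<bullet> inv y) \<bullet> h = h [^] m" if h: "h \<in> X" for h
    proof -
      have "inv x \<bullet> h \<in> X" using normal_conj_mem[OF X _ h] assms(2) by simp
      then obtain m :: nat where m: "inv y \<bullet> (inv x \<bullet> h) = (inv x \<bullet> h) [^] m"
        using subgroup.m_inv_closed[OF N yN] by (auto simp: N_def)
      have "(x \<bullet> inv y) \<bullet> h = x \<bullet> (inv y \<bullet> (inv x \<bullet> h))"
        using assms(2) h by (simp add: conjugate_def m_assoc inv_mult_group)
      also have "\<dots> = h [^] m" unfolding m using assms(2) h by (simp add: conj_pow)
      finally show ?thesis ..
    qed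
    then show ?thesis using assms(2) by (auto simp: N_def)
  qed
  then have "y \<otimes> (x \<bullet> inv y) \<in> N" by (rule subgroup.m_closed[OF N yN])
  also have "y \<otimes> (x \<bullet> inv y) = (y \<bullet> x) \<otimes> inv x" using assms(2) by (simp add: conjugate_def m_assoc)
  finally have "x \<in> N" by (rule moved_mem[OF assms(1-4) N])
  then show ?thesis using assms(5) by (simp add: N_def)
qed

text \<open>As \<open>x \<bullet> h\<close> is a power of \<open>h\<close>, it is fixed by \<open>y\<close>; so \<open>x\<close> and \<open>y \<bullet> x\<close> act alike on \<open>h\<close>.\<close>

lemma moved_commutes_fixed:
  assumes "prime q" "x \<in> X" "x \<in> tau_elements {q} G" "y \<bullet> x \<noteq> x" "h \<in> X" "y \<bullet> h = h"
  shows "x \<bullet> h = h"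
proof -
  obtain m :: nat where m: "x \<bullet> h = h [^] m" using moved_normalizes assms by blast
  obtain k :: nat where k: "y \<bullet> x = x [^] k" using powers assms by blast
  have yh: "inv y \<bullet> h = h" using conj_inv_cancel(1)[of y h] assms by simp
  have "(y \<bullet> x) \<bullet> h = y \<bullet> (x \<bullet> (inv y \<bullet> h))"
    using assms by (simp add: conjugate_def m_assoc inv_mult_group)
  also have "\<dots> = x \<bullet> h" using yh m assms by (simp add: conj_pow)
  finally have "(inv x \<otimes> (y \<bullet> x)) \<bullet> h = h" using assms by (simp flip: conj_conj)
  moreover have "inv x \<otimes> (y \<bullet> x) = (y \<bullet> x) \<otimes> inv x"
  proof -
    have "x \<otimes> x [^] k = x [^] k \<otimes> x" using assms(2) by (simp flip: nat_pow_Suc2)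
    then show ?thesis unfolding k using assms(2) inv_solve_left' inv_solve_right
      by (metis X_carrier X_pow inv_closed m_assoc inv_mult_cancel(1) m_closed)
  qed
  ultimately have "x \<in> {u \<in> carrier G. u \<bullet> h = h}"
    using assms by (intro moved_mem[OF assms(1-4)] centralizer_subgroup) simp_all
  then show ?thesis by simp
qed

text \<open>The commutator \<open>z\<close> of \<open>x\<close> and \<open>h\<close> is a power of \<open>x\<close> and of \<open>h\<close>. If \<open>y\<close> raises \<open>x\<close> to the power \<open>k\<close> and \<open>h\<close> to
  the power \<open>l\<close>, it raises \<open>z\<close> both to the power \<open>k l\<close> and to the power \<open>l\<close>, whereas \<open>l\<close> and \<open>k - 1\<close> are
  prime to \<open>q\<close>.\<close>

lemma moved_commutes_moved:
  assumes x: "prime q" "x \<in> X" "x \<in> tau_elements {q} G" "y \<bullet> x \<noteq> x"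
    and h: "prime r" "h \<in> X" "h \<in> tau_elements {r} G" "y \<bullet> h \<noteq> h"
  shows "x \<bullet> h = h"
proof -
  define z where "z = (x \<bullet> h) \<otimes> inv h"
  note C = cyclic_subgroup
  have [simp]: "x \<in> carrier G" "h \<in> carrier G" using x h by simp_all
  obtain m n :: nat where mn: "x \<bullet> h = h [^] m" "h \<bullet> x = x [^] n"
    using moved_normalizes x h by metis
  have "z \<in> generate G {h}"
    unfolding z_def mn using cyclic_mem_iff[of h]
    by (intro subgroup.m_closed[OF C] subgroup.m_inv_closed[OF C] cyclic_self) auto
  then obtain s :: nat where s: "z = h [^] s" using cyclic_mem_iff[of h] by auto
  have "z = x \<otimes> inv (h \<bullet> x)" unfolding z_def by (simp add: conjugate_def m_assoc inv_mult_group)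
  then have zx: "z = x \<otimes> inv (x [^] n)" unfolding mn .
  have "z \<in> generate G {x}"
    unfolding zx using cyclic_mem_iff[of x]
    by (intro subgroup.m_closed[OF C] subgroup.m_inv_closed[OF C] cyclic_self) auto
  then obtain t :: nat where t: "z = x [^] t" using cyclic_mem_iff[of x] by auto
  have "z = \<one>"
  proof (cases "q = r")
    case False
    then show ?thesis
      using tau_elements_pow[OF x(3), of t] tau_elements_pow[OF h(3), of s] s t by (intro tau_elements_disjoint[of z "{q}" "{r}"]) auto
  next
    case True
    obtain k l :: nat where kl: "y \<bullet> x = x [^] k" "y \<bullet> h = h [^] l" using powers x h by metis
    have [simp]: "z \<in> carrier G" using s by simp
    have xz: "x \<bullet> z = z" and hz: "h \<bullet> z = z"
      unfolding t by (simp add: conj_pow conj_self) (simp add: t[symmetric] s conj_pow conj_self)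
    have zh: "z \<otimes> h = h \<otimes> z" using hz conj_eq_iff_commute[of h z] by simp
    have xh: "x \<bullet> h = z \<otimes> h" unfolding z_def by (simp add: m_assoc)
    have "x [^] (i::nat) \<bullet> h = z [^] i \<otimes> h" for i
    proof (induction i)
      case (Suc i)
      have "x [^] Suc i = x \<otimes> x [^] i" by (rule nat_pow_Suc2) simp
      then have "x [^] Suc i \<bullet> h = x \<bullet> (x [^] i \<bullet> h)" by (simp add: conj_conj)
      also have "\<dots> = z [^] i \<otimes> (z \<otimes> h)" using Suc xz xh by (simp add: conj_mult conj_pow)
      finally show ?case by (simp add: m_assoc)
    qed simp
    then have "x [^] k \<bullet> h [^] l = (z [^] k \<otimes> h) [^] l" by (simp add: conj_pow)
    also have "\<dots> = z [^] (k * l) \<otimes> h [^] l"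
    proof -
      have "z [^] k \<otimes> h = h \<otimes> z [^] k" using group_commutes_pow[OF zh] by simp
      then have "(z [^] k \<otimes> h) [^] l = (z [^] k) [^] l \<otimes> h [^] l" by (rule pow_mult_distrib) simp_all
      then show ?thesis by (simp add: nat_pow_pow)
    qed
    finally have 1: "x [^] k \<bullet> h [^] l = z [^] (k * l) \<otimes> h [^] l" .
    have "x [^] k \<bullet> h [^] l = y \<bullet> (x \<bullet> h)"
      unfolding kl[symmetric] by (simp add: conjugate_def m_assoc inv_mult_group)
    also have "\<dots> = (y \<bullet> z) \<otimes> h [^] l" by (simp add: xh conj_mult kl)
    finally have "y \<bullet> z = z [^] (k * l)" using 1 by simp
    moreover have "y \<bullet> z = z [^] l" unfolding s by (simp add: conj_pow kl nat_pow_pow mult.commute)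
    ultimately have zkl: "[k * l = 1 * l] (mod ord z)" using pow_eq_iff_cong[of z "k * l" l] by simp
    show ?thesis
    proof (rule ccontr)
      assume "z \<noteq> \<one>"
      then have "q dvd ord z"
        using ord_of_nontrivial_prime_element[OF x(1)] tau_elements_pow[OF x(3), of t] t by simp
      then have "[k * l = 1 * l] (mod q)" using zkl cong_dvd_modulus_nat by blast
      moreover have "h \<noteq> \<one>" using h(4) y by (metis conj_one(1))
      then have "coprime l q" using exponent_coprime[OF h(1-3) _ kl(2)] True by simp
      ultimately have "[k = 1] (mod q)" using cong_mult_rcancel_nat by blast
      then show False using moved_exponent[OF x(1-3) kl(1) x(4)] by simp
    qed
  qed
  then show ?thesis unfolding z_def by (simp add: div_eq_one_iff)
qed

theorem moved_central:
  assumes x: "prime q" "x \<in> X" "x \<in> tau_elements {q} G" "y \<bullet> x \<noteq> x" and h: "h \<in> X"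
  shows "x \<bullet> h = h"
proof (rule prime_power_closure[of h])
  fix r and i :: nat assume "prime r" "h [^] i \<in> tau_elements {r} G"
  then show "x \<bullet> h [^] i = h [^] i"
    using moved_commutes_fixed[OF x, of "h [^] i"] moved_commutes_moved[OF x, of r "h [^] i"] h by auto
qed (use x h in \<open>auto simp: conj_mult\<close>)

text \<open>Two commuting elements of order \<open>q\<close> that generate different subgroups have the same exponent
  modulo \<open>q\<close>, because their product is mapped to a power of itself.\<close>

lemma exponents_cong:
  assumes x: "prime q" "x \<in> X" "x \<in> tau_elements {q} G" "y \<bullet> x \<noteq> x" "y \<bullet> x = x [^] k"
    and h: "h \<in> X" "h \<in> tau_elements {q} G" "h \<noteq> \<one>" "y \<bullet> h = h [^] m"
  shows "[k = m] (mod q)"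
proof -
  have "x \<noteq> \<one>" using x(4) by auto
  then obtain i j :: nat where ij: "x [^] i \<noteq> \<one>" "(x [^] i) [^] q = \<one>" "h [^] j \<noteq> \<one>" "(h [^] j) [^] q = \<one>"
    using prime_order_power x(1,3) h(2,3) by metis
  define a b where "a = x [^] i" and "b = h [^] j"
  have ab [simp]: "a \<in> X" "b \<in> X" using x h by (simp_all add: a_def b_def)
  have oa: "ord a = q" and ob: "ord b = q" using ord_eq_prime[OF x(1)] ij ab[THEN X_carrier] unfolding a_def b_def by blast+
  have ya: "y \<bullet> a = a [^] k" and yb: "y \<bullet> b = b [^] m"
    using x h by (simp_all add: a_def b_def conj_pow nat_pow_pow mult.commute)
  have bq: "b \<in> tau_elements {q} G" using tau_elements_pow[OF h(2)] by (simp add: b_def)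
  have "a \<bullet> b = b" using commute_pow[of x b i] moved_central[OF x(1-4), of b] x(2) by (simp add: a_def)
  then have comm: "a \<otimes> b = b \<otimes> a" using conj_eq_iff_commute[of a b] by simp
  have C: "subgroup (generate G {a}) G" by (rule cyclic_subgroup) simp
  have cycl: "[k = m] (mod q)" if b: "b \<in> generate G {a}"
  proof -
    obtain l :: nat where l: "b = a [^] l" using b cyclic_mem_iff[of a] by auto
    then have "y \<bullet> b = b [^] k" using ya by (simp add: conj_pow nat_pow_pow mult.commute)
    then show ?thesis using yb pow_eq_iff_cong[of b k m] ob by simp
  qed
  have "a \<otimes> b \<in> X" using ab subgroup.m_closed[OF X_subgroup] by blast
  then obtain t :: nat where t: "y \<bullet> (a \<otimes> b) = (a \<otimes> b) [^] t" using powers by blast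
  then have e: "a [^] k \<otimes> b [^] m = a [^] t \<otimes> b [^] t"
    using ya yb pow_mult_distrib[OF comm, of t] by (simp add: conj_mult)
  show ?thesis
  proof (cases "[m = t] (mod q)")
    case True
    then have "b [^] m = b [^] t" using pow_eq_iff_cong[of b m t] ob by simp
    then have "a [^] k = a [^] t" using e by simp
    then have "[k = t] (mod q)" using pow_eq_iff_cong[of a k t] oa by simp
    then show ?thesis using True cong_sym cong_trans by blast
  next
    case False
    have "b [^] m = inv (a [^] k) \<otimes> (a [^] t \<otimes> b [^] t)" unfolding e[symmetric] by simp
    then have "b [^] m \<otimes> inv (b [^] t) = inv (a [^] k) \<otimes> a [^] t" by (simp add: m_assoc)
    also have "\<dots> \<in> generate G {a}"
      by (rule subgroup.m_closed[OF C subgroup.m_inv_closed[OF C]]) (auto simp: cyclic_mem_iff)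
    finally show ?thesis
      by (intro cycl mem_of_power_quotient[OF x(1) bq C _ False])
  qed
qed

theorem all_moved:
  assumes x: "prime q" "x \<in> X" "x \<in> tau_elements {q} G" "y \<bullet> x \<noteq> x"
    and h: "h \<in> X" "h \<in> tau_elements {q} G" "h \<noteq> \<one>"
  shows "y \<bullet> h \<noteq> h"
proof
  assume "y \<bullet> h = h"
  moreover obtain k :: nat where "y \<bullet> x = x [^] k" using powers x by blast
  ultimately show False
    using exponents_cong[OF x _ h, of k 1] moved_exponent[OF x(1-3) _ x(4), of k] h by simp
qed

text \<open>Hence \<open>y\<close> acts on the \<open>q\<close>-elements of \<open>X\<close> either trivially or as a single power map, and both
  commute with every automorphism of \<open>X\<close>.\<close>

theorem action_commutes:
  assumes g: "g \<in> carrier G" and x: "x \<in> X"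
  shows "y \<bullet> g \<bullet> x = g \<bullet> y \<bullet> x"
proof (rule prime_power_closure[of x])
  fix q and i :: nat assume q: "prime q" and "x [^] i \<in> tau_elements {q} G"
  define u where "u = x [^] i"
  have u: "u \<in> X" "u \<in> tau_elements {q} G" using x \<open>x [^] i \<in> _\<close> by (simp_all add: u_def)
  define v where "v = g \<bullet> u"
  have v: "v \<in> X" "v \<in> tau_elements {q} G"
    using normal_conj_mem[OF X g u(1)] tau_elements_conj[OF u(2) g] by (simp_all add: v_def)
  have uv: "u = \<one> \<longleftrightarrow> v = \<one>" unfolding v_def using g u conj_inj[OF g, of u \<one>] by auto
  obtain k m :: nat where k: "y \<bullet> u = u [^] k" and m: "y \<bullet> v = v [^] m" using powers u v by metis
  have gpow: "v [^] n = g \<bullet> u [^] n" for n :: nat using g u by (simp add: v_def conj_pow)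
  have "y \<bullet> v = g \<bullet> (y \<bullet> u)"
  proof (cases "u = \<one> \<or> y \<bullet> u = u \<and> y \<bullet> v = v")
    case True
    then show ?thesis using g uv v_def by auto
  next
    case False
    have "[k = m] (mod q)"
    proof (cases "y \<bullet> u = u")
      case True
      then have "[m = k] (mod q)" using exponents_cong[OF q v _ m u _ k] False by auto
      then show ?thesis by (rule cong_sym)
    next
      case False': False
      then show ?thesis using exponents_cong[OF q u _ k v _ m] False uv by auto
    qed
    moreover have "coprime m q" using exponent_coprime[OF q v _ m] False uv by auto
    moreover have "[k ^ d = 1] (mod ord u)" by (rule pow_exponent[OF u(1) k])
    moreover have "[m ^ d = 1] (mod ord u)"
    proof -
      have "v [^] (m ^ d) = v [^] (1::nat)"
        using pow_exponent[OF v(1) m] pow_eq_iff_cong[of v "m ^ d" 1] v(1) by simp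
      then have "u [^] (m ^ d) = u [^] (1::nat)" unfolding gpow using g u(1) by (auto intro: conj_inj)
      then show ?thesis using pow_eq_iff_cong[of u "m ^ d" 1] u(1) by simp
    qed
    ultimately have "u [^] k = u [^] m" by (rule exponents_agree[OF q u])
    then show ?thesis unfolding m k gpow by simp
  qed
  then show "y \<bullet> g \<bullet> x [^] i = g \<bullet> y \<bullet> x [^] i" by (simp add: u_def v_def)
qed (use g x in \<open>auto simp: conj_mult\<close>)

end

lemma (in finite_group) coprime_power_action_section:
  assumes N: "N \<lhd> G" and M: "M \<lhd> G" "N \<subseteq> M" and y: "y \<in> carrier G" "y [^] (d::nat) = \<one>"
    and cop: "coprime d (card M div card N)"
    and pw: "\<And>x. x \<in> M \<Longrightarrow> \<exists>k::nat. (y \<bullet> x) \<otimes> inv (x [^] k) \<in> N"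
  shows "coprime_power_action (G Mod N) ((\<lambda>x. N #> x) ` M) (N #> y) d"
proof -
  interpret Q: finite_group "G Mod N" by (rule finite_group_mod[OF N])
  note MG = normal_imp_subgroup[OF M(1)] and NG = normal_imp_subgroup[OF N]
  show ?thesis
    unfolding coprime_power_action_def coprime_power_action_axioms_def
  proof (intro conjI allI impI)
    show "finite_group (G Mod N)" by (rule finite_group_mod[OF N])
    show "(\<lambda>x. N #> x) ` M \<lhd> G Mod N" by (rule mod_image_normal[OF N M(1)])
    show "N #> y \<in> carrier (G Mod N)" using y by (auto simp: carrier_FactGroup)
    show "(N #> y) [^]\<^bsub>G Mod N\<^esub> d = \<one>\<^bsub>G Mod N\<^esub>"
      using y normal.FactGroup_pow[OF N y(1)] coset_mult_one[OF subgroup.subset[OF NG]] by simp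
    show "coprime d (card ((\<lambda>x. N #> x) ` M))" using card_mod_image[OF N MG M(2)] cop by simp
    fix u assume "u \<in> (\<lambda>x. N #> x) ` M"
    then obtain x where x: "x \<in> M" "u = N #> x" by auto
    then have xG: "x \<in> carrier G" using subgroup.mem_carrier[OF MG] by blast
    obtain k :: nat where "(y \<bullet> x) \<otimes> inv (x [^] k) \<in> N" using pw x by blast
    then have "N #> (y \<bullet> x) = N #> (x [^] k)" using coset_eq_iff[OF N] y xG by simp
    then have "(N #> y) \<bullet>\<^bsub>G Mod N\<^esub> u = u [^]\<^bsub>G Mod N\<^esub> k"
      unfolding x(2) using conj_mod[OF N y(1) xG] normal.FactGroup_pow[OF N xG] by simp
    then show "\<exists>k. (N #> y) \<bullet>\<^bsub>G Mod N\<^esub> u = u [^]\<^bsub>G Mod N\<^esub> (k::nat)" ..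
  qed
qed


section \<open>Hall sets and permutability\<close>

lemma partition_on_block:
  assumes "partition_on all_primes \<sigma>" "prime p" obtains s where "s \<in> \<sigma>" "p \<in> s"
  using assms unfolding partition_on_def all_primes_def by blast

lemma partition_on_disjoint:
  assumes "partition_on all_primes \<sigma>" "s \<in> \<sigma>" "t \<in> \<sigma>" "s \<noteq> t" shows "s \<inter> t = {}"
  using assms unfolding partition_on_def disjoint_def by blast

lemma partition_on_subset_compl:
  assumes "partition_on all_primes \<sigma>" "s \<in> \<sigma>" "t \<in> \<sigma>" "s \<noteq> t" shows "t \<subseteq> prime_compl s"
  using partition_on_disjoint[OF assms] assms unfolding partition_on_def prime_compl_def by blast

context finite_group
begin

lemma hall_iff: "hall_tau_subgroup \<tau> G H \<longleftrightarrow>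
    subgroup H G \<and> tau_number \<tau> (card H) \<and> tau_number (prime_compl \<tau>) (order G div card H)"
  by (rule hall_tau_subgroup_iff[OF finite_group_axioms])

lemma hall_subgroup_elements:
  "hall_tau_subgroup \<tau> G S \<Longrightarrow> x \<in> S \<Longrightarrow> x \<in> tau_elements \<tau> G"
  using tau_elements_of_tau_subgroup by (auto simp: hall_iff)

text \<open>For a block without prime divisors of the group order the trivial subgroup is a Hall subgroup.\<close>

lemma hall_of_complete_hall_set:
  assumes "complete_hall_set \<sigma> G \<H>" "s \<in> \<sigma>" "s \<subseteq> all_primes"
  obtains S where "hall_tau_subgroup s G S"
proof (cases "s \<in> sigma_of \<sigma> G")
  case True
  then have "\<exists>!H. H \<in> \<H> \<and> hall_tau_subgroup s G H"
    using assms(1) by (simp add: complete_hall_set_def)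
  then show thesis using that by auto
next
  case False
  have "tau_number (prime_compl s) (order G)"
    using False assms order_pos by (auto simp: tau_number_def sigma_of_def prime_compl_def all_primes_def)
  then have "hall_tau_subgroup s G {\<one>}"
    using triv_subgroup by (simp add: hall_iff)
  then show thesis by (rule that)
qed

text \<open>The blocks in \<open>\<sigma>(G)\<close> are disjoint, so a Hall subgroup chosen for one of them is not one for another.\<close>

lemma complete_hall_set_exists:
  assumes part: "partition_on all_primes \<sigma>" and hall: "\<And>s. s \<in> \<sigma> \<Longrightarrow> \<exists>S. hall_tau_subgroup s G S"
  shows "\<exists>\<H>. complete_hall_set \<sigma> G \<H>"
proof -
  obtain S where S: "\<And>s. s \<in> \<sigma> \<Longrightarrow> hall_tau_subgroup s G (S s)" using hall by metis
  have inj: "s = t" if st: "s \<in> sigma_of \<sigma> G" "t \<in> sigma_of \<sigma> G" and H: "hall_tau_subgroup s G (S t)" for s t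
  proof (rule ccontr)
    assume "s \<noteq> t"
    obtain p where p: "p \<in> t" "prime p" "p dvd order G" using st(2) by (auto simp: sigma_of_def)
    have t: "hall_tau_subgroup t G (S t)" using S st by (auto simp: sigma_of_def)
    have "card (S t) = 1"
      using H t tau_number_both[of s "card (S t)" t] partition_on_disjoint[OF part _ _ \<open>s \<noteq> t\<close>] st
      by (auto simp: hall_iff sigma_of_def)
    then have "tau_number (prime_compl t) (order G)" using t by (simp add: hall_iff)
    then show False using p by (auto simp: tau_number_def prime_compl_def)
  qed
  have "complete_hall_set \<sigma> G (S ` sigma_of \<sigma> G)"
    unfolding complete_hall_set_def
  proof (intro conjI ballI impI)
    fix s assume s: "s \<in> sigma_of \<sigma> G"
    show "\<exists>!H. H \<in> S ` sigma_of \<sigma> G \<and> hall_tau_subgroup s G H"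
    proof (rule ex1I[of _ "S s"])
      show "S s \<in> S ` sigma_of \<sigma> G \<and> hall_tau_subgroup s G (S s)" using s S by (auto simp: sigma_of_def)
    next
      fix H assume "H \<in> S ` sigma_of \<sigma> G \<and> hall_tau_subgroup s G H"
      then show "H = S s" using inj[OF s] by blast
    qed
  next
    fix H assume "H \<in> S ` sigma_of \<sigma> G"
    then obtain s where "s \<in> \<sigma>" "H = S s" by (auto simp: sigma_of_def)
    then show "subgroup H G" "\<exists>s\<in>\<sigma>. hall_tau_subgroup s G H" using S by (auto simp: hall_iff)
  qed
  then show ?thesis by blast
qed

lemma card_div_eqI: "subgroup K G \<Longrightarrow> n * card K = card H \<Longrightarrow> card H div card K = n"
  using card_subgroup_pos by (metis nonzero_mult_div_cancel_right not_gr_zero)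

lemma index_dvd_index:
  assumes "subgroup A G" "subgroup B G" "subgroup C G" "A \<subseteq> B" "B \<subseteq> C"
  shows "card C div card B dvd card C div card A" "card B div card A dvd card C div card A"
proof -
  have "(card C div card B) * (card B div card A) * card A = card C"
    using card_index(1)[OF assms(1,2,4)] card_index(1)[OF assms(2,3,5)] by (simp add: mult.assoc)
  then have "card C div card A = (card C div card B) * (card B div card A)"
    by (rule card_div_eqI[OF assms(1)])
  then show "card C div card B dvd card C div card A" "card B div card A dvd card C div card A" by simp_all
qed

lemma subgroup_eq_of_index: 
  assumes "subgroup A G" "subgroup B G" "A \<subseteq> B" "card B div card A = 1" shows "A = B"
  using card_index(1)[OF assms(1-3)] assms card_subset_eq[OF finite_subgroup[OF assms(2)]] by simp

lemma hall_inter_normal: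
  assumes S: "hall_tau_subgroup \<tau> G S" and M: "M \<lhd> G"
  shows "hall_tau_subgroup \<tau> (G\<lparr>carrier := M\<rparr>) (S \<inter> M)"
proof -
  note MG = normal_imp_subgroup[OF M]
  have SG: "subgroup S G" using S by (simp add: hall_iff)
  have SM: "subgroup (S \<inter> M) G" using subgroups_Inter_pair[OF SG MG] .
  have "tau_number \<tau> (card (S \<inter> M))"
    using S card_subgroup_dvd[OF SM SG] tau_number_dvd by (auto simp: hall_iff)
  moreover have "card M div card (S \<inter> M) dvd order G div card S"
  proof -
    note MS = normal_set_mult[OF M SG]
    have "card (M <#> S) div card S dvd order G div card S"
      using index_dvd_index(2)[OF SG MS(2) subgroup_self MS(4) subgroup.subset[OF MS(2)]] by (simp add: order_def)
    moreover have "card M div card (S \<inter> M) = card (M <#> S) div card S"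
      by (rule card_div_eqI[OF SM]) (simp add: Int_commute card_set_mult_div(2)[OF MG SG MS(2)])
    ultimately show ?thesis by simp
  qed
  then have "tau_number (prime_compl \<tau>) (card M div card (S \<inter> M))"
    using S tau_number_dvd by (auto simp: hall_iff)
  ultimately show ?thesis
    unfolding hall_tau_subgroup_iff[OF finite_group_subgroup[OF MG]]
    using subgroup_incl[OF SM MG] by (simp add: order_def)
qed

text \<open>The index of \<open>U\<close> is prime to \<open>\<tau>\<close> because of \<open>S\<close>, and a \<open>\<tau>\<close>-number because of the other elements.\<close>

lemma subgroup_eq_carrier:
  assumes U: "subgroup U G" and S: "hall_tau_subgroup \<tau> G S" "S \<subseteq> U"
    and el: "\<And>p. prime p \<Longrightarrow> p \<notin> \<tau> \<Longrightarrow> tau_elements {p} G \<subseteq> U"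
  shows "U = carrier G"
proof (rule subgroup_eq_of_index[OF U subgroup_self subgroup.subset[OF U]])
  have "tau_number \<tau> (order G div card U)"
    using tau_number_card_div[OF U subgroup.subset[OF U] subgroup_self, of \<tau>] el by (auto simp: order_def)
  moreover have "tau_number (prime_compl \<tau>) (order G div card U)"
    using index_dvd_index(1)[OF _ U subgroup_self S(2) subgroup.subset[OF U]] S(1) tau_number_dvd
    by (auto simp: hall_iff order_def)
  ultimately show "card (carrier G) div card U = 1" using tau_number_both[of \<tau> _ "prime_compl \<tau>"] by (simp add: order_def)
qed

lemma set_mult_absorb:
  assumes "subgroup H G" "subgroup S G" "S \<subseteq> H" shows "H <#> S = H" "S <#> H = H"
proof -
  have one: "\<one> \<in> S" by (rule subgroup.one_closed[OF assms(2)])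
  show "H <#> S = H"
  proof
    show "H <#> S \<subseteq> H" using subgroup.m_closed[OF assms(1)] assms(3) by (auto simp: set_mult_def)
    show "H \<subseteq> H <#> S"
      using one r_one[OF subgroup.mem_carrier[OF assms(1)]] unfolding set_mult_def by force
  qed
  show "S <#> H = H"
  proof
    show "S <#> H \<subseteq> H" using subgroup.m_closed[OF assms(1)] assms(3) by (auto simp: set_mult_def)
    show "H \<subseteq> S <#> H"
      using one l_one[OF subgroup.mem_carrier[OF assms(1)]] unfolding set_mult_def by force
  qed
qed

end

section \<open>Groups in which permutability is transitive act by powers on sections\<close>

locale transitive_sigma_group = finite_group +
  fixes \<sigma> :: "nat set set" and \<H>
  assumes part: "partition_on all_primes \<sigma>" and hall: "complete_hall_set \<sigma> G \<H>"
    and trans: "PsigmaT_group \<sigma> G"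
begin

lemma hall_exists: assumes "s \<in> \<sigma>" obtains S where "hall_tau_subgroup s G S"
  using hall_of_complete_hall_set[OF hall assms] assms part that unfolding partition_on_def by blast

lemma normal_sigma_permutable: "M \<lhd> G \<Longrightarrow> sigma_permutable \<sigma> G M"
  unfolding sigma_permutable_def
  using hall normal_imp_subgroup commut_normal by (fastforce simp: hall_iff)

text \<open>The Hall \<open>s\<close>-subgroups of \<open>M\<close> cover \<open>M/N\<close>, and all other Hall subgroups of \<open>M\<close> lie in \<open>N\<close>.\<close>

lemma section_sigma_permutable:
  assumes N: "N \<lhd> G" and M: "M \<lhd> G" "N \<subseteq> M" and s: "s \<in> \<sigma>" "tau_number s (card M div card N)"
    and H: "subgroup H G" "N \<subseteq> H" "H \<subseteq> M"
  shows "sigma_permutable \<sigma> (G\<lparr>carrier := M\<rparr>) H"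
proof -
  note MG = normal_imp_subgroup[OF M(1)] and NG = normal_imp_subgroup[OF N]
  interpret M: finite_group "G\<lparr>carrier := M\<rparr>" by (rule finite_group_subgroup[OF MG])
  have "\<exists>S. hall_tau_subgroup t (G\<lparr>carrier := M\<rparr>) S" if "t \<in> \<sigma>" for t
    using hall_exists[OF that] hall_inter_normal[OF _ M(1)] by metis
  then have "\<exists>\<H>. complete_hall_set \<sigma> (G\<lparr>carrier := M\<rparr>) \<H>" by (rule M.complete_hall_set_exists[OF part])
  moreover have "H <#> S = S <#> H" if t: "t \<in> \<sigma>" and S': "hall_tau_subgroup t (G\<lparr>carrier := M\<rparr>) S" for t S
  proof -
    have S: "subgroup S G" "S \<subseteq> M" "tau_number t (card S)" "tau_number (prime_compl t) (card M div card S)"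
      using S' subgroup_of_subgroup[OF MG] by (auto simp: M.hall_iff order_def)
    show ?thesis
    proof (cases "t = s")
      case True
      note NS = normal_set_mult[OF N S(1)]
      have sub: "N <#> S \<subseteq> M" using subgroup.m_closed[OF MG] M(2) S(2) by (fastforce simp: set_mult_def)
      have "tau_number s (card M div card (N <#> S))"
        using index_dvd_index(1)[OF NG NS(2) MG NS(3) sub] s(2) tau_number_dvd by blast
      moreover have "tau_number (prime_compl s) (card M div card (N <#> S))"
        using index_dvd_index(1)[OF S(1) NS(2) MG NS(4) sub] S(4) True tau_number_dvd by blast
      ultimately have "card M div card (N <#> S) = 1" by (rule tau_number_both) simp
      then have MNS: "N <#> S = M" by (rule subgroup_eq_of_index[OF NS(2) MG sub])
      have "M \<subseteq> H <#> S" using H(2) unfolding MNS[symmetric] by (auto simp: set_mult_def)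
      moreover have "M \<subseteq> S <#> H" using H(2) NS(1) unfolding MNS[symmetric] by (auto simp: set_mult_def)
      moreover have "H <#> S \<subseteq> M" "S <#> H \<subseteq> M"
        using H(3) S(2) subgroup.m_closed[OF MG] by (auto simp: set_mult_def)
      ultimately show ?thesis by simp
    next
      case False
      have "S \<subseteq> N"
      proof
        fix x assume x: "x \<in> S"
        have "x \<in> tau_elements t G" using tau_elements_of_tau_subgroup[OF S(1,3) x] .
        then show "x \<in> N"
          using x S(2) partition_on_disjoint[OF part t s(1) False]
          by (intro tau_element_mem_normal[OF _ MG N M(2) _ s(2)]) auto
      qed
      then have "S \<subseteq> H" using H by auto
      then show ?thesis using set_mult_absorb[OF H(1) S(1)] by simp
    qed
  qed
  ultimately show ?thesis
    unfolding sigma_permutable_def using subgroup_incl[OF H(1) MG H(3)] by simp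
qed

text \<open>A subgroup \<open>H\<close> between \<open>N\<close> and \<open>M\<close> is \<open>\<sigma>\<close>-permutable in \<open>M\<close>, hence in \<open>G\<close>; so for a Hall
  \<open>t\<close>-subgroup \<open>L\<close> with \<open>t \<noteq> s\<close> the product \<open>H L\<close> is a group which meets \<open>M\<close> in \<open>H\<close>, and \<open>L\<close>
  normalizes \<open>H\<close>. The elements normalizing all such \<open>H\<close> form a normal subgroup, whose index
  is then an \<open>s\<close>-number.\<close>

theorem normalizes_section_subgroups:
  assumes N: "N \<lhd> G" and M: "M \<lhd> G" "N \<subseteq> M" and s: "s \<in> \<sigma>" "tau_number s (card M div card N)"
    and y: "y \<in> tau_elements (prime_compl s) G" and H: "subgroup H G" "N \<subseteq> H" "H \<subseteq> M" "h \<in> H"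
  shows "y \<bullet> h \<in> H"
proof -
  note MG = normal_imp_subgroup[OF M(1)] and NG = normal_imp_subgroup[OF N]
  define \<C> where "\<C> = {H. subgroup H G \<and> N \<subseteq> H \<and> H \<subseteq> M}"
  define U where "U = {u \<in> carrier G. \<forall>H\<in>\<C>. \<forall>h\<in>H. u \<bullet> h \<in> H}"
  have CC: "h \<in> carrier G" if "H \<in> \<C>" "h \<in> H" for H h
    using that subgroup.mem_carrier by (auto simp: \<C>_def)
  have U: "subgroup U G"
  proof (rule finite_subgroupI)
    show "U \<noteq> {}" using CC by (auto simp: U_def intro!: exI[of _ \<one>])
  qed (use CC in \<open>auto simp: U_def simp flip: conj_conj\<close>)
  have "U \<lhd> G"
    unfolding normal_iff_conj
  proof (intro conjI ballI U)
    fix g u assume g: "g \<in> carrier G" and u: "u \<in> U"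
    have "(g \<bullet> u) \<bullet> h \<in> H" if H: "H \<in> \<C>" and h: "h \<in> H" for H h
    proof -
      define H' where "H' = {x \<in> carrier G. g \<bullet> x \<in> H}"
      have HG: "subgroup H G" "N \<subseteq> H" "H \<subseteq> M" using H by (auto simp: \<C>_def)
      have "H' \<in> \<C>"
        unfolding \<C>_def
      proof (intro CollectI conjI subsetI)
        show "subgroup H' G"
          by (rule finite_subgroupI)
            (use g HG(1) in \<open>auto simp: H'_def conj_mult subgroup.m_closed subgroup.one_closed intro!: exI[of _ \<one>]\<close>)
        show "x \<in> H'" if "x \<in> N" for x
          using that HG(2) normal_conj_mem[OF N g] subgroup.mem_carrier[OF NG] by (auto simp: H'_def)
        fix x assume "x \<in> H'"
        then have x: "x \<in> carrier G" "g \<bullet> x \<in> M" using HG by (auto simp: H'_def)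
        then have "inv g \<bullet> g \<bullet> x \<in> M" using normal_conj_mem[OF M(1)] g by blast
        then show "x \<in> M" using x g by simp
      qed
      moreover have "inv g \<bullet> h \<in> H'" using g h CC[OF H h] by (simp add: H'_def)
      ultimately have "u \<bullet> inv g \<bullet> h \<in> H'" using u by (simp add: U_def)
      then have "g \<bullet> u \<bullet> inv g \<bullet> h \<in> H" by (simp add: H'_def)
      moreover have "g \<bullet> u \<bullet> inv g \<bullet> h = (g \<bullet> u) \<bullet> h"
        using g u CC[OF H h] by (simp add: U_def conjugate_def m_assoc inv_mult_group)
      ultimately show ?thesis by simp
    qed
    then show "g \<bullet> u \<in> U" using g u by (simp add: U_def)
  qed
  have hall_U: "L \<subseteq> U" if t: "t \<in> \<sigma>" "t \<noteq> s" and L: "hall_tau_subgroup t G L" for t L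
  proof
    fix l assume l: "l \<in> L"
    have LG: "subgroup L G" using L by (simp add: hall_iff)
    have "l \<bullet> h \<in> H" if "H \<in> \<C>" and h: "h \<in> H" for H h
    proof -
      have HG: "subgroup H G" "N \<subseteq> H" "H \<subseteq> M" using that by (auto simp: \<C>_def)
      have "sigma_permutable \<sigma> G H"
        using trans normal_sigma_permutable[OF M(1)] section_sigma_permutable[OF N M s HG]
        unfolding PsigmaT_group_def by blast
      then have "L <#> H = H <#> L" using L t by (simp add: sigma_permutable_def)
      moreover have "l \<otimes> h \<in> L <#> H" using l h by (auto simp: set_mult_def)
      ultimately obtain h' l' where hl: "h' \<in> H" "l' \<in> L" "l \<otimes> h = h' \<otimes> l'" by (auto simp: set_mult_def)
      have [simp]: "l \<in> carrier G" "l' \<in> carrier G" "h \<in> carrier G" "h' \<in> carrier G"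
        using l hl h subgroup.mem_carrier[OF LG] subgroup.mem_carrier[OF HG(1)] by auto
      have e: "l \<bullet> h = h' \<otimes> (l' \<otimes> inv l)" unfolding conjugate_def hl(3) by (simp add: m_assoc)
      then have "l' \<otimes> inv l = inv h' \<otimes> (l \<bullet> h)" by simp
      also have "\<dots> \<in> M"
        using hl(1) h HG(3)
        by (intro subgroup.m_closed[OF MG] subgroup.m_inv_closed[OF MG] normal_conj_mem[OF M(1)]) auto
      finally have "l' \<otimes> inv l \<in> M" .
      moreover have "l' \<otimes> inv l \<in> tau_elements t G"
        using hall_subgroup_elements[OF L] subgroup.m_closed[OF LG hl(2) subgroup.m_inv_closed[OF LG l]] by blast
      ultimately have "l' \<otimes> inv l \<in> N"
        using tau_element_mem_normal[OF _ MG N M(2) _ s(2)] partition_on_disjoint[OF part t(1) s(1) t(2)] by blast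
      then show ?thesis unfolding e using hl(1) HG subgroup.m_closed[OF HG(1)] by auto
    qed
    then show "l \<in> U" using subgroup.mem_carrier[OF LG l] by (simp add: U_def)
  qed
  have "p \<in> s" if p: "prime p" "p dvd order G div card U" for p
  proof (rule ccontr)
    assume "p \<notin> s"
    obtain t where t: "t \<in> \<sigma>" "p \<in> t" using partition_on_block[OF part p(1)] .
    then have "t \<noteq> s" using \<open>p \<notin> s\<close> by auto
    obtain L where L: "hall_tau_subgroup t G L" using hall_exists[OF t(1)] .
    then have "order G div card U dvd order G div card L"
      using index_dvd_index(1)[OF _ U subgroup_self hall_U[OF t(1) \<open>t \<noteq> s\<close> L] subgroup.subset[OF U]]
      by (simp add: hall_iff order_def)
    then have "p dvd order G div card L" using p(2) dvd_trans by blast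
    then show False using L p(1) t(2) by (auto simp: hall_iff tau_number_def prime_compl_def)
  qed
  moreover have "order G div card U > 0"
    using card_index(2)[OF U subgroup_self subgroup.subset[OF U]] by (simp add: order_def)
  ultimately have "tau_number s (order G div card U)" by (simp add: tau_number_def)
  then have "y \<in> U"
    using y by (intro tau_element_mem_normal[OF y subgroup_self \<open>U \<lhd> G\<close> subgroup.subset[OF U]]) (auto simp: order_def prime_compl_def)
  then show ?thesis using H by (auto simp: U_def \<C>_def)
qed

lemma section_power_action:
  assumes N: "N \<lhd> G" and M: "M \<lhd> G" "N \<subseteq> M" and s: "s \<in> \<sigma>" "tau_number s (card M div card N)"
    and y: "y \<in> tau_elements (prime_compl s) G"
  obtains d where "coprime_power_action (G Mod N) ((\<lambda>x. N #> x) ` M) (N #> y) d"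
proof -
  note MG = normal_imp_subgroup[OF M(1)] and NG = normal_imp_subgroup[OF N]
  obtain d where d: "tau_number (prime_compl s) d" "y [^] d = \<one>" "y \<in> carrier G"
    using y by (auto simp: tau_elements_def)
  have "\<exists>k::nat. (y \<bullet> x) \<otimes> inv (x [^] k) \<in> N" if x: "x \<in> M" for x
  proof -
    have xG: "x \<in> carrier G" by (rule subgroup.mem_carrier[OF MG x])
    note C = cyclic_subgroup[OF xG]
    let ?H = "N <#> generate G {x}"
    note H = normal_set_mult[OF N C]
    have "?H \<subseteq> M"
      using subgroup.m_closed[OF MG] M(2) cyclic_subset[OF MG x] by (fastforce simp: set_mult_def)
    moreover have "x \<in> ?H" using H(4) cyclic_self by blast
    ultimately have "y \<bullet> x \<in> ?H"
      using normalizes_section_subgroups[OF N M s y H(2,3)] by blast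
    then obtain n and k :: nat where nk: "n \<in> N" "y \<bullet> x = n \<otimes> x [^] k"
      using cyclic_mem_iff[OF xG] by (auto simp: set_mult_def)
    then have "(y \<bullet> x) \<otimes> inv (x [^] k) = n" using xG subgroup.mem_carrier[OF NG] by (simp add: m_assoc)
    then show ?thesis using nk(1) by blast
  qed
  moreover have "coprime d (card M div card N)"
    using tau_number_coprime[OF d(1) s(2)] by simp
  ultimately show thesis
    using coprime_power_action_section[OF N M d(3,2)] that by blast
qed

text \<open>This is the fact that the actions of \<open>y\<close> and \<open>g\<close> on \<open>M/N\<close> commute.\<close>

lemma commutator_centralizes_section:
  assumes N: "N \<lhd> G" and M: "M \<lhd> G" "N \<subseteq> M" and s: "s \<in> \<sigma>" "tau_number s (card M div card N)"
    and y: "y \<in> tau_elements (prime_compl s) G" and g: "g \<in> carrier G" and x: "x \<in> M"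
  shows "(((y \<bullet> g) \<otimes> inv g) \<bullet> x) \<otimes> inv x \<in> N"
proof -
  note MG = normal_imp_subgroup[OF M(1)] and NG = normal_imp_subgroup[OF N]
  obtain d where "coprime_power_action (G Mod N) ((\<lambda>x. N #> x) ` M) (N #> y) d"
    using section_power_action[OF N M s y] .
  then interpret A: coprime_power_action "G Mod N" "(\<lambda>x. N #> x) ` M" "N #> y" d .
  have [simp]: "x \<in> carrier G" "y \<in> carrier G" using subgroup.mem_carrier[OF MG x] y by auto
  define z where "z = inv y \<bullet> inv g \<bullet> x"
  have z: "z \<in> M" unfolding z_def using normal_conj_mem[OF M(1)] g x by simp
  then have [simp]: "z \<in> carrier G" by (rule subgroup.mem_carrier[OF MG])
  have "(N #> y) \<bullet>\<^bsub>G Mod N\<^esub> (N #> g) \<bullet>\<^bsub>G Mod N\<^esub> (N #> z) = (N #> g) \<bullet>\<^bsub>G Mod N\<^esub> (N #> y) \<bullet>\<^bsub>G Mod N\<^esub> (N #> z)"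
    using g z by (intro A.action_commutes) (auto simp: carrier_FactGroup)
  then have "N #> (y \<bullet> g \<bullet> z) = N #> (g \<bullet> y \<bullet> z)" using conj_mod[OF N] g by simp
  moreover have "y \<bullet> g \<bullet> z = ((y \<bullet> g) \<otimes> inv g) \<bullet> x" "g \<bullet> y \<bullet> z = x"
    unfolding z_def using g by (simp_all add: conjugate_def m_assoc inv_mult_group)
  ultimately show ?thesis using coset_eq_iff[OF N] g by simp
qed

end


section \<open>The structure of the groups in question\<close>

text \<open>The common ground of both directions, in terms of elements, so that it passes to subgroups. The last condition
  is what the normal complement of the \<open>s\<close>-part of \<open>D\<close> in a Hall \<open>s\<close>-subgroup is good for.\<close>

definition sigma_structure :: "nat set set \<Rightarrow> ('a, 'b) monoid_scheme \<Rightarrow> 'a set \<Rightarrow> bool" where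
  "sigma_structure \<sigma> G D \<longleftrightarrow> subgroup D G \<and>
     (\<forall>a\<in>D. \<forall>b\<in>D. a \<bullet>\<^bsub>G\<^esub> b = b) \<and>
     (\<forall>g\<in>carrier G. \<forall>d\<in>D. \<exists>k::nat. g \<bullet>\<^bsub>G\<^esub> d = d [^]\<^bsub>G\<^esub> k) \<and>
     (\<forall>q. prime q \<and> q dvd card D \<longrightarrow> tau_elements {q} G \<subseteq> D) \<and>
     (\<forall>s\<in>\<sigma>. \<forall>t\<in>\<sigma>. s \<noteq> t \<longrightarrow>
        (\<forall>x\<in>tau_elements s G. \<forall>y\<in>tau_elements t G. (x \<bullet>\<^bsub>G\<^esub> y) \<otimes>\<^bsub>G\<^esub> inv\<^bsub>G\<^esub> y \<in> D)) \<and>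
     (\<forall>s\<in>\<sigma>. \<forall>x\<in>tau_elements s G. \<forall>d\<in>D \<inter> tau_elements s G. x \<bullet>\<^bsub>G\<^esub> d = d)"

context finite_group
begin

lemma commutator_swap:
  assumes "subgroup D G" "x \<in> carrier G" "y \<in> carrier G" "(y \<bullet> x) \<otimes> inv x \<in> D"
  shows "(x \<bullet> y) \<otimes> inv y \<in> D"
proof -
  have "(x \<bullet> y) \<otimes> inv y = inv ((y \<bullet> x) \<otimes> inv x)"
    using assms by (simp add: conjugate_def m_assoc inv_mult_group)
  then show ?thesis using assms(1,4) by (simp add: subgroup.m_inv_closed)
qed

text \<open>If \<open>s\<close>-elements commute with \<open>t\<close>-elements modulo \<open>D\<close>, the normalizer of \<open>D S\<close> contains \<open>S\<close> and all
  elements of order prime to \<open>s\<close>, so it is \<open>G\<close>.\<close>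

lemma hall_normal_modulo:
  assumes part: "partition_on all_primes \<sigma>" and s: "s \<in> \<sigma>" and D: "D \<lhd> G"
    and comm: "\<And>t x y. t \<in> \<sigma> \<Longrightarrow> t \<noteq> s \<Longrightarrow> x \<in> tau_elements t G \<Longrightarrow> y \<in> tau_elements s G \<Longrightarrow> (x \<bullet> y) \<otimes> inv y \<in> D"
    and S: "hall_tau_subgroup s G S"
  shows "D <#> S \<lhd> G" "tau_elements s G \<subseteq> D <#> S" "tau_number s (card (D <#> S) div card D)"
proof -
  have SG: "subgroup S G" using S by (simp add: hall_iff)
  note DG = normal_imp_subgroup[OF D] and DS = normal_set_mult[OF D SG]
  define U where "U = {u \<in> carrier G. \<forall>x\<in>D <#> S. u \<bullet> x \<in> D <#> S}"
  note [simp] = subgroup.mem_carrier[OF DS(2)]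
  have U: "subgroup U G"
    by (rule finite_subgroupI) (auto simp: U_def simp flip: conj_conj intro!: exI[of _ \<one>])
  have "U = carrier G"
  proof (rule subgroup_eq_carrier[OF U S])
    show "S \<subseteq> U"
      using DS(4) conj_mem_subgroup[OF DS(2)] subgroup.mem_carrier[OF SG] by (auto simp: U_def)
    fix p assume p: "prime p" "p \<notin> s"
    obtain t where t: "t \<in> \<sigma>" "p \<in> t" using partition_on_block[OF part p(1)] .
    show "tau_elements {p} G \<subseteq> U"
    proof
      fix x assume "x \<in> tau_elements {p} G"
      then have x: "x \<in> tau_elements t G" "x \<in> carrier G" using tau_elements_mono[of x "{p}" t] t by auto
      have "x \<bullet> z \<in> D <#> S" if DSz: "z \<in> D <#> S" for z
      proof -
        obtain d u where z: "d \<in> D" "u \<in> S" "z = d \<otimes> u" using DSz by (auto simp: set_mult_def)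
        have [simp]: "d \<in> carrier G" "u \<in> carrier G" using z subgroup.mem_carrier[OF DG] subgroup.mem_carrier[OF SG] by auto
        have "(x \<bullet> u) \<otimes> inv u \<in> D"
          using comm[OF t(1) _ x(1) hall_subgroup_elements[OF S z(2)]] t p by auto
        then have "(x \<bullet> d) \<otimes> ((x \<bullet> u) \<otimes> inv u) \<in> D"
          using normal_conj_mem[OF D x(2) z(1)] subgroup.m_closed[OF DG] by blast
        moreover have "x \<bullet> z = (x \<bullet> d) \<otimes> ((x \<bullet> u) \<otimes> inv u) \<otimes> u"
          using x z by (simp add: conj_mult m_assoc)
        ultimately show ?thesis using z(2) unfolding set_mult_def by blast
      qed
      then show "x \<in> U" using x by (simp add: U_def)
    qed
  qed
  then show N: "D <#> S \<lhd> G" using DS(2) by (auto simp: normal_iff_conj U_def)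
  have "order G div card (D <#> S) dvd order G div card S"
    using index_dvd_index(1)[OF SG DS(2) subgroup_self DS(4) subgroup.subset[OF DS(2)]] by (simp add: order_def)
  then have "tau_number (prime_compl s) (card (carrier G) div card (D <#> S))"
    using S tau_number_dvd by (auto simp: hall_iff order_def)
  then show "tau_elements s G \<subseteq> D <#> S"
    using tau_element_mem_normal[OF _ subgroup_self N subgroup.subset[OF DS(2)] tau_elements_closed _ prime_compl_disjoint(1)]
    by blast
  show "tau_number s (card (D <#> S) div card D)"
    using card_set_mult_div(3)[OF SG DG, of s] DS(1,2) S by (simp add: hall_iff)
qed

lemma tau_elements_abelian_subgroup:
  assumes D: "subgroup D G" and ab: "\<And>a b. a \<in> D \<Longrightarrow> b \<in> D \<Longrightarrow> a \<otimes> b = b \<otimes> a"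
  shows "subgroup (D \<inter> tau_elements \<tau> G) G"
proof (rule finite_subgroupI)
  show "D \<inter> tau_elements \<tau> G \<noteq> {}" using subgroup.one_closed[OF D] by auto
qed (use ab subgroup.m_closed[OF D] tau_elements_commuting_mult in auto)

lemma tau_elements_abelian_normal:
  assumes D: "D \<lhd> G" and ab: "\<And>a b. a \<in> D \<Longrightarrow> b \<in> D \<Longrightarrow> a \<otimes> b = b \<otimes> a"
  shows "D \<inter> tau_elements \<tau> G \<lhd> G"
  unfolding normal_iff_conj
  using tau_elements_abelian_subgroup[OF normal_imp_subgroup[OF D] ab] normal_conj_mem[OF D] tau_elements_conj by auto

text \<open>Modulo the \<open>\<tau>'\<close>-part of \<open>D\<close> the elements \<open>k\<close> and \<open>a\<close> commute, and \<open>(k b a)\<^sup>n = k\<^sup>n a\<^sup>n\<close>.\<close>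

lemma fixed_part_torsion:
  assumes D: "D \<lhd> G" and ab: "\<And>a b. a \<in> D \<Longrightarrow> b \<in> D \<Longrightarrow> a \<otimes> b = b \<otimes> a"
    and k: "k \<in> carrier G" "k [^] (n::nat) = \<one>" and kba: "(k \<otimes> b \<otimes> a) [^] n = \<one>"
    and a: "a \<in> D" "a \<in> tau_elements \<tau> G" "k \<bullet> a = a" and b: "b \<in> D" "b \<in> tau_elements (prime_compl \<tau>) G"
  shows "a [^] n = \<one>"
proof -
  let ?Q = "D \<inter> tau_elements (prime_compl \<tau>) G"
  note DG = normal_imp_subgroup[OF D]
  have Q: "?Q \<lhd> G" by (rule tau_elements_abelian_normal[OF D ab])
  note QG = normal_imp_subgroup[OF Q]
  have [simp]: "a \<in> carrier G" "b \<in> carrier G" using a b by auto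
  have "k \<otimes> a = a \<otimes> k" using conj_eq_iff_commute[of k a] k a by simp
  then have ka: "a [^] m \<otimes> k = k \<otimes> a [^] m" for m :: nat using group_commutes_pow[of a k m] k by simp
  have abm: "a [^] m \<otimes> b = b \<otimes> a [^] m" for m :: nat by (rule ab[OF subgroup_pow_mem[OF DG a(1)] b(1)])
  have "\<exists>e\<in>?Q. (k \<otimes> b \<otimes> a) [^] m = e \<otimes> k [^] m \<otimes> a [^] m" for m :: nat
  proof (induction m)
    case 0
    then show ?case using subgroup.one_closed[OF QG] by (auto intro!: bexI[of _ \<one>])
  next
    case (Suc m)
    then obtain e where e: "e \<in> ?Q" "(k \<otimes> b \<otimes> a) [^] m = e \<otimes> k [^] m \<otimes> a [^] m" by blast
    have [simp]: "e \<in> carrier G" using e by auto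
    have "(k \<otimes> b \<otimes> a) [^] Suc m = e \<otimes> k [^] m \<otimes> (a [^] m \<otimes> k) \<otimes> b \<otimes> a"
      unfolding nat_pow_Suc e(2) using k(1) by (simp add: m_assoc)
    also have "\<dots> = e \<otimes> k [^] m \<otimes> k \<otimes> (a [^] m \<otimes> b) \<otimes> a"
      unfolding ka using k(1) by (simp add: m_assoc)
    also have "\<dots> = (e \<otimes> (k [^] Suc m \<bullet> b)) \<otimes> k [^] Suc m \<otimes> a [^] Suc m"
      unfolding abm using k(1) by (simp add: m_assoc conjugate_def)
    finally show ?case
      using subgroup.m_closed[OF QG e(1) normal_conj_mem[OF Q, of "k [^] Suc m" b]] b k(1) by blast
  qed
  then obtain e where e: "e \<in> ?Q" "(k \<otimes> b \<otimes> a) [^] n = e \<otimes> k [^] n \<otimes> a [^] n" by blast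
  have eG: "e \<in> carrier G" using e by auto
  then have "e \<otimes> a [^] n = \<one>" using e(2) k kba by simp
  then have "inv e = a [^] n" using eG inv_solve_left'[of "a [^] n" e \<one>] by (simp add: inv_equality inv_comm)
  then have "a [^] n \<in> tau_elements (prime_compl \<tau>) G" using e(1) tau_elements_inv[of e] by simp
  with tau_elements_pow[OF a(2)] show ?thesis by (rule tau_elements_disjoint) simp
qed

end

section \<open>The residual of a group in which permutability is transitive\<close>

locale soluble_transitive_sigma_group = transitive_sigma_group +
  assumes soluble: "\<And>H K. chief_factor G H K \<Longrightarrow> \<exists>s\<in>\<sigma>. tau_number s (card H div card K)"
begin

text \<open>This is the \<open>\<sigma>\<close>-nilpotent residual, the smallest normal subgroup whose quotient is a direct product of
  \<open>s\<close>-groups with \<open>s \<in> \<sigma>\<close>.\<close>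

definition D :: "'a set" where
  "D = generate G (\<Union>s\<in>\<sigma>. \<Union>t\<in>\<sigma> - {s}. \<Union>x\<in>tau_elements s G. \<Union>y\<in>tau_elements t G. {(x \<bullet> y) \<otimes> inv y})"

lemma commutator_mem:
  assumes "s \<in> \<sigma>" "t \<in> \<sigma>" "s \<noteq> t" "x \<in> tau_elements s G" "y \<in> tau_elements t G"
  shows "(x \<bullet> y) \<otimes> inv y \<in> D"
  unfolding D_def by (rule generate.incl) (use assms in auto)

lemma D_least:
  assumes E: "subgroup E G" and gens: "\<And>s t x y. s \<in> \<sigma> \<Longrightarrow> t \<in> \<sigma> \<Longrightarrow> s \<noteq> t \<Longrightarrow>
     x \<in> tau_elements s G \<Longrightarrow> y \<in> tau_elements t G \<Longrightarrow> (x \<bullet> y) \<otimes> inv y \<in> E"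
  shows "D \<subseteq> E"
  unfolding D_def by (rule generate_subgroup_incl[OF _ E]) (use gens in auto)

lemma D_normal: "D \<lhd> G"
  unfolding D_def
proof (rule normal_generateI)
  let ?W = "\<Union>s\<in>\<sigma>. \<Union>t\<in>\<sigma> - {s}. \<Union>x\<in>tau_elements s G. \<Union>y\<in>tau_elements t G. {(x \<bullet> y) \<otimes> inv y}"
  show "?W \<subseteq> carrier G"
    by (intro UN_least) (simp add: tau_elements_closed)
  fix h g assume "h \<in> ?W" and g: "g \<in> carrier G"
  then obtain s t x y where xy: "s \<in> \<sigma>" "t \<in> \<sigma> - {s}" "x \<in> tau_elements s G" "y \<in> tau_elements t G" "h = (x \<bullet> y) \<otimes> inv y"
    by blast
  then have [simp]: "x \<in> carrier G" "y \<in> carrier G" by auto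
  have "g \<otimes> h \<otimes> inv g = ((g \<bullet> x) \<bullet> (g \<bullet> y)) \<otimes> inv (g \<bullet> y)"
    using g xy(5) by (simp add: conjugate_def m_assoc inv_mult_group)
  also have "\<dots> \<in> ?W" using tau_elements_conj[OF xy(3) g] tau_elements_conj[OF xy(4) g] xy(1,2) by blast
  finally show "g \<otimes> h \<otimes> inv g \<in> ?W" .
qed

lemma D_subgroup: "subgroup D G"
  by (rule normal_imp_subgroup[OF D_normal])

lemma D_carrier [simp]: "d \<in> D \<Longrightarrow> d \<in> carrier G"
  by (rule subgroup.mem_carrier[OF D_subgroup])

text \<open>Of the two entries of a generating commutator at least one has order prime to \<open>s\<close>, and the commutators of that
  entry with all elements of \<open>G\<close> centralize \<open>M/N\<close>.\<close>

lemma D_centralizes_section: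
  assumes N: "N \<lhd> G" and M: "M \<lhd> G" "N \<subseteq> M" and s: "s \<in> \<sigma>" "tau_number s (card M div card N)"
    and c: "c \<in> D" and x: "x \<in> M"
  shows "(c \<bullet> x) \<otimes> inv x \<in> N"
proof -
  note MG = normal_imp_subgroup[OF M(1)] and NG = normal_imp_subgroup[OF N]
  define C where "C = {u \<in> carrier G. \<forall>x\<in>M. (u \<bullet> x) \<otimes> inv x \<in> N}"
  have [simp]: "x \<in> M \<Longrightarrow> x \<in> carrier G" for x by (rule subgroup.mem_carrier[OF MG])
  have C: "subgroup C G"
  proof (rule finite_subgroupI)
    show "C \<noteq> {}" using subgroup.one_closed[OF NG] by (auto simp: C_def intro!: exI[of _ \<one>])
    fix a b assume ab: "a \<in> C" "b \<in> C"
    then have [simp]: "a \<in> carrier G" "b \<in> carrier G" by (auto simp: C_def)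
    have "((a \<otimes> b) \<bullet> x) \<otimes> inv x \<in> N" if x: "x \<in> M" for x
    proof -
      have "((a \<otimes> b) \<bullet> x) \<otimes> inv x = ((a \<bullet> (b \<bullet> x)) \<otimes> inv (b \<bullet> x)) \<otimes> ((b \<bullet> x) \<otimes> inv x)"
        using x by (simp add: conjugate_def m_assoc inv_mult_group)
      moreover have "(a \<bullet> (b \<bullet> x)) \<otimes> inv (b \<bullet> x) \<in> N" "(b \<bullet> x) \<otimes> inv x \<in> N"
        using ab x normal_conj_mem[OF M(1)] by (auto simp: C_def)
      ultimately show ?thesis using subgroup.m_closed[OF NG] by simp
    qed
    then show "a \<otimes> b \<in> C" by (simp add: C_def)
  qed (auto simp: C_def)
  have "D \<subseteq> C"
  proof (rule D_least[OF C])
    fix a b u v assume ab: "a \<in> \<sigma>" "b \<in> \<sigma>" "a \<noteq> b" and u: "u \<in> tau_elements a G" and v: "v \<in> tau_elements b G"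
    have [simp]: "u \<in> carrier G" "v \<in> carrier G" using u v by auto
    show "(u \<bullet> v) \<otimes> inv v \<in> C"
    proof (cases "a = s")
      case False
      then have "u \<in> tau_elements (prime_compl s) G"
        using tau_elements_mono[OF u] partition_on_subset_compl[OF part s(1) ab(1)] by blast
      then show ?thesis
        using commutator_centralizes_section[OF N M s _ _ ] u v by (auto simp: C_def)
    next
      case True
      then have "v \<in> tau_elements (prime_compl s) G"
        using tau_elements_mono[OF v] partition_on_subset_compl[OF part s(1) ab(2)] ab(3) by blast
      then have "(v \<bullet> u) \<otimes> inv u \<in> C"
        using commutator_centralizes_section[OF N M s _ _ ] u v by (auto simp: C_def)
      then show ?thesis using commutator_swap[OF C] u v by blast
    qed
  qed
  then show ?thesis using c x by (auto simp: C_def)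
qed

text \<open>Otherwise there is a chief factor \<open>H/Z\<close> of \<open>G\<close> with \<open>Z = Z(D) < H \<le> D\<close>, say an \<open>s\<close>-group. If \<open>Q\<close> is the
  \<open>s'\<close>-part of \<open>Z\<close>, then \<open>D\<close> centralizes \<open>H/Q\<close>; for an \<open>s\<close>-element \<open>x\<close> of \<open>H\<close> this makes \<open>e = [c, x]\<close> an
  \<open>s'\<close>-element of \<open>Z\<close>, while \<open>x\<^sup>n = \<one>\<close> gives \<open>e\<^sup>n = \<one>\<close>. So \<open>H \<le> Z\<close>, a contradiction.\<close>

lemma D_abelian:
  assumes "a \<in> D" "b \<in> D" shows "a \<bullet> b = b"
proof -
  define Z where "Z = {z \<in> D. \<forall>c\<in>D. c \<bullet> z = z}"
  have Z: "Z \<lhd> G"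
    unfolding normal_iff_conj
  proof (intro conjI ballI)
    show "subgroup Z G"
      by (rule finite_subgroupI)
        (use subgroup.one_closed[OF D_subgroup] subgroup.m_closed[OF D_subgroup] in \<open>auto simp: Z_def conj_mult\<close>)
    fix g z assume g: "g \<in> carrier G" and z: "z \<in> Z"
    have "c \<bullet> (g \<bullet> z) = g \<bullet> z" if c: "c \<in> D" for c
    proof -
      have "c \<bullet> (g \<bullet> z) = g \<bullet> ((inv g \<bullet> c) \<bullet> z)"
        using g c z by (simp add: Z_def conjugate_def m_assoc inv_mult_group)
      also have "(inv g \<bullet> c) \<bullet> z = z" using z normal_conj_mem[OF D_normal _ c, of "inv g"] g by (simp add: Z_def)
      finally show ?thesis .
    qed
    then show "g \<bullet> z \<in> Z" using z normal_conj_mem[OF D_normal g] by (simp add: Z_def)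
  qed
  have "\<not> Z \<subset> D"
  proof
    assume "Z \<subset> D"
    then obtain H where ch: "chief_factor G H Z" "H \<subseteq> D"
      using exists_chief_factor_above[OF Z D_normal] by blast
    then have H: "H \<lhd> G" "Z \<subset> H" by (auto simp: chief_factor_def)
    obtain s where s: "s \<in> \<sigma>" "tau_number s (card H div card Z)" using soluble[OF ch(1)] by blast
    note HG = normal_imp_subgroup[OF H(1)]
    have Zab: "u \<otimes> v = v \<otimes> u" if "u \<in> Z" "v \<in> Z" for u v
      using that conj_eq_iff_commute[of u v] by (auto simp: Z_def)
    define Q where "Q = Z \<inter> tau_elements (prime_compl s) G"
    have Q: "Q \<lhd> G" unfolding Q_def by (rule tau_elements_abelian_normal[OF Z Zab])
    have QH: "Q \<subseteq> H" using H(2) by (auto simp: Q_def)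
    have compl: "x \<in> Q" if "x \<in> H" "x \<in> tau_elements (prime_compl s) G" for x
      using tau_element_mem_normal[OF that(2) HG Z _ that(1) s(2)] H(2) that by (auto simp: Q_def)
    have "tau_number s (card H div card Q)"
    proof (rule tau_number_card_div[OF normal_imp_subgroup[OF Q] QH HG])
      fix p x assume "prime p" "p \<notin> s" "x \<in> H" "x \<in> tau_elements {p} G"
      then show "x \<in> Q"
        using compl[of x] tau_elements_mono[of x "{p}" "prime_compl s"] by (auto simp: prime_compl_def all_primes_def)
    qed
    then have cQ: "(c \<bullet> x) \<otimes> inv x \<in> Q" if "c \<in> D" "x \<in> H" for c x
      using D_centralizes_section[OF Q H(1) QH s(1)] that by blast
    have fixes_s: "c \<bullet> x = x" if c: "c \<in> D" and x: "x \<in> H" "x \<in> tau_elements s G" for c x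
    proof -
      define e where "e = (c \<bullet> x) \<otimes> inv x"
      have e: "e \<in> Q" unfolding e_def by (rule cQ[OF c x(1)])
      then have eZ: "e \<in> Z" "e \<in> carrier G" by (auto simp: Q_def)
      have xD: "x \<in> D" using x ch(2) by auto
      obtain n where n: "tau_number s n" "x [^] n = \<one>" using x(2) by (auto simp: tau_elements_def)
      have comm: "e \<otimes> x = x \<otimes> e" using eZ xD conj_eq_iff_commute[of x e] by (auto simp: Z_def)
      have "c \<bullet> x = e \<otimes> x" unfolding e_def using c xD by (simp add: m_assoc)
      then have "c \<bullet> (x [^] n) = e [^] n \<otimes> x [^] n" 
        using c xD eZ pow_mult_distrib[OF comm, of n] by (simp add: conj_pow)
      then have "e [^] n = \<one>" using n c eZ by simp
      then have "e \<in> tau_elements s G" using n eZ by (auto simp: tau_elements_def)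
      then have "e = \<one>" using e by (intro tau_elements_disjoint[of e s "prime_compl s"]) (auto simp: Q_def)
      then show ?thesis unfolding e_def using c xD by (simp add: div_eq_one_iff)
    qed
    have "H \<subseteq> Z"
    proof
      fix x assume x: "x \<in> H"
      have xG: "x \<in> carrier G" by (rule subgroup.mem_carrier[OF HG x])
      obtain i j :: nat where ij: "x = x [^] i \<otimes> x [^] j" "x [^] i \<in> tau_elements s G" "x [^] j \<in> tau_elements (prime_compl s) G"
        using tau_decomposition[OF xG] by blast
      have xij: "x [^] i \<in> H" "x [^] j \<in> H" using subgroup_pow_mem[OF HG x] by auto
      have "c \<bullet> x = x" if c: "c \<in> D" for c
      proof -
        have "c \<bullet> x [^] j = x [^] j" using compl[OF xij(2) ij(3)] c by (auto simp: Q_def Z_def)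
        then have "c \<bullet> (x [^] i \<otimes> x [^] j) = x [^] i \<otimes> x [^] j"
          using fixes_s[OF c xij(1) ij(2)] c xG by (simp add: conj_mult)
        then show ?thesis using ij(1) by simp
      qed
      then show "x \<in> Z" using x ch(2) by (auto simp: Z_def)
    qed
    with H(2) show False by auto
  qed
  then have "Z = D" by (auto simp: Z_def)
  then show ?thesis using assms by (auto simp: Z_def)
qed

lemma D_comm: "a \<in> D \<Longrightarrow> b \<in> D \<Longrightarrow> a \<otimes> b = b \<otimes> a"
  using D_abelian[of a b] conj_eq_iff_commute[of a b] by simp

lemma D_tau_normal: "D \<inter> tau_elements \<tau> G \<lhd> G"
  by (rule tau_elements_abelian_normal[OF D_normal D_comm])

text \<open>If \<open>x\<close> centralizes the \<open>q\<close>-part \<open>a\<close> of \<open>c = [x, y]\<close>, then \<open>x\<^sup>n = \<one>\<close> implies \<open>a\<^sup>n = \<one>\<close>. So if no element of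
  order prime to \<open>s\<close> moved a \<open>q\<close>-element of \<open>D\<close>, all generators of \<open>D\<close> would have order prime to \<open>q\<close>.\<close>

lemma exists_moving_element:
  assumes q: "prime q" "q dvd card D" and s: "s \<in> \<sigma>" "q \<in> s"
  obtains t y d where "t \<in> \<sigma>" "t \<noteq> s" "y \<in> tau_elements t G" "d \<in> D" "d \<in> tau_elements {q} G" "y \<bullet> d \<noteq> d"
proof (rule ccontr)
  assume not: "\<not> thesis"
  note moving = that
  have fixes_q: "y \<bullet> d = d" if "t \<in> \<sigma>" "t \<noteq> s" "y \<in> tau_elements t G" "d \<in> D" "d \<in> tau_elements {q} G" for t y d
    using not moving that by metis
  define Q where "Q = D \<inter> tau_elements (prime_compl {q}) G"
  have Q: "Q \<lhd> G" unfolding Q_def by (rule D_tau_normal)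
  note QG = normal_imp_subgroup[OF Q]
  have key: "(x \<bullet> y) \<otimes> inv y \<in> Q"
    if t: "t \<in> \<sigma>" "t \<noteq> s" "x \<in> tau_elements t G" and u: "u \<in> \<sigma>" "u \<noteq> t" "y \<in> tau_elements u G" for t u x y
  proof -
    define c where "c = (x \<bullet> y) \<otimes> inv y"
    have [simp]: "x \<in> carrier G" "y \<in> carrier G" using t u by auto
    have cD: "c \<in> D" unfolding c_def using commutator_mem[OF t(1) u(1) u(2)[symmetric] t(3) u(3)] .
    obtain i j :: nat where ij: "c = c [^] i \<otimes> c [^] j" "c [^] i \<in> tau_elements {q} G" "c [^] j \<in> tau_elements (prime_compl {q}) G"
      using tau_decomposition[OF D_carrier[OF cD]] by blast
    define a b where "a = c [^] i" and "b = c [^] j"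
    have a: "a \<in> D" "a \<in> tau_elements {q} G" and b: "b \<in> D" "b \<in> tau_elements (prime_compl {q}) G"
      using ij subgroup_pow_mem[OF D_subgroup cD] by (auto simp: a_def b_def)
    have cab: "c = b \<otimes> a" using ij(1) D_comm[OF a(1) b(1)] by (simp add: a_def b_def)
    obtain n where n: "tau_number t n" "x [^] n = \<one>" using t(3) by (auto simp: tau_elements_def)
    \<comment> \<open>\<open>x\<^sup>-\<^sup>1 c\<close> is the conjugate of \<open>x\<^sup>-\<^sup>1\<close> under \<open>y\<close>\<close>
    have "inv x \<otimes> b \<otimes> a = y \<bullet> inv x"
      using a(1) b(1) by (simp add: m_assoc cab[symmetric]) (simp add: c_def conjugate_def m_assoc)
    then have "(inv x \<otimes> b \<otimes> a) [^] n = \<one>" using n(2) by (simp add: nat_pow_inv flip: conj_pow)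
    moreover have "inv x \<bullet> a = a"
      using conj_inv_cancel(1)[of x a] fixes_q[OF t a] a(1) by simp
    ultimately have "a [^] n = \<one>"
      using n(2) by (intro fixed_part_torsion[OF D_normal D_comm _ _ _ a _ b, of "inv x" n]) (simp_all add: nat_pow_inv)
    then have "a \<in> tau_elements t G" using n(1) a(1) by (auto simp: tau_elements_def)
    moreover have "{q} \<inter> t = {}" using partition_on_disjoint[OF part s(1) t(1)] t(2) s(2) by auto
    ultimately have "a = \<one>" using a(2) tau_elements_disjoint by blast
    then show ?thesis using cab b by (simp add: c_def Q_def)
  qed
  have "D \<subseteq> Q"
  proof (rule D_least[OF QG])
    fix a b u v assume ab: "a \<in> \<sigma>" "b \<in> \<sigma>" "a \<noteq> b" and u: "u \<in> tau_elements a G" and v: "v \<in> tau_elements b G"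
    show "(u \<bullet> v) \<otimes> inv v \<in> Q"
    proof (cases "a = s")
      case False
      then show ?thesis using key[of a u b v] ab u v by auto
    next
      case True
      then have "(v \<bullet> u) \<otimes> inv u \<in> Q" using key[of b v a u] ab u v by auto
      then show ?thesis using commutator_swap[OF QG] u v by blast
    qed
  qed
  moreover obtain x where "x \<in> D - {\<one>}" "x \<in> tau_elements {q} G"
    using exists_p_element_notin[of q D "{\<one>}"] q triv_subgroup D_subgroup subgroup.one_closed[OF D_subgroup] by auto
  ultimately show False
    using tau_elements_disjoint[of x "{q}" "prime_compl {q}"] by (auto simp: Q_def)
qed

text \<open>Let \<open>S\<close> be a Hall \<open>s\<close>-subgroup, \<open>T = D S\<close> and \<open>Q\<close> the \<open>q'\<close>-part of \<open>D\<close>. Then \<open>T/Q\<close> is a normal section of \<open>G\<close>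
  whose order is an \<open>s\<close>-number, and some \<open>t\<close>-element \<open>y\<close> moves a \<open>q\<close>-element of \<open>D/Q\<close>. Hence \<open>y\<close> moves all
  \<open>q\<close>-elements of \<open>T/Q\<close> and these are central. Being moved by \<open>y\<close> puts them into \<open>D/Q\<close>, since \<open>[y, x] \<in> D\<close>
  for \<open>s\<close>-elements \<open>x\<close>; and an involution cannot be moved by a power map.\<close>

lemma local_structure:
  assumes q: "prime q" "q dvd card D" and s: "s \<in> \<sigma>" "q \<in> s"
  shows "tau_elements {q} G \<subseteq> D" "odd q"
    and "\<And>x e. x \<in> tau_elements s G \<Longrightarrow> e \<in> D \<Longrightarrow> e \<in> tau_elements {q} G \<Longrightarrow> x \<bullet> e = e"
proof -
  obtain t y d where t: "t \<in> \<sigma>" "t \<noteq> s" and y: "y \<in> tau_elements t G" and d: "d \<in> D" "d \<in> tau_elements {q} G" "y \<bullet> d \<noteq> d"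
    using exists_moving_element[OF q s] .
  define Q where "Q = D \<inter> tau_elements (prime_compl {q}) G"
  have Q: "Q \<lhd> G" unfolding Q_def by (rule D_tau_normal)
  note QG = normal_imp_subgroup[OF Q]
  have Q1: "x = \<one>" if "x \<in> Q" "x \<in> tau_elements {q} G" for x
    using that tau_elements_disjoint[of x "{q}" "prime_compl {q}"] by (auto simp: Q_def)
  have Dq_diff: "a = b" if ab: "a \<in> D" "b \<in> D" "a \<in> tau_elements {q} G" "b \<in> tau_elements {q} G" "a \<otimes> inv b \<in> Q" for a b
  proof -
    have "a \<otimes> inv b \<in> tau_elements {q} G"
      using ab D_comm[OF ab(1) subgroup.m_inv_closed[OF D_subgroup ab(2)]] by (intro tau_elements_commuting_mult tau_elements_inv) auto
    then show ?thesis using Q1[OF ab(5)] ab by (simp add: div_eq_one_iff)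
  qed
  obtain S where S: "hall_tau_subgroup s G S" using hall_exists[OF s(1)] .
  define T where "T = D <#> S"
  have T: "T \<lhd> G" "tau_elements s G \<subseteq> T" "tau_number s (card T div card D)"
    unfolding T_def using hall_normal_modulo[OF part s(1) D_normal _ S] commutator_mem s(1) by blast+
  note TG = normal_imp_subgroup[OF T(1)]
  have DT: "D \<subseteq> T" unfolding T_def using normal_set_mult(3)[OF D_normal] S by (simp add: hall_iff)
  have QT: "Q \<subseteq> T" using DT by (auto simp: Q_def)
  have "tau_number s (card T div card Q)"
  proof (rule tau_number_card_div[OF QG QT TG])
    fix p x assume p: "prime p" "p \<notin> s" and x: "x \<in> T" "x \<in> tau_elements {p} G"
    have "x \<in> D" using tau_element_mem_normal[OF x(2) TG D_normal DT x(1) T(3)] p by auto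
    moreover have "p \<in> prime_compl {q}" using p s by (auto simp: prime_compl_def all_primes_def)
    then have "x \<in> tau_elements (prime_compl {q}) G" using tau_elements_mono[OF x(2)] by simp
    ultimately show "x \<in> Q" by (simp add: Q_def)
  qed
  moreover have "y \<in> tau_elements (prime_compl s) G"
    using tau_elements_mono[OF y] partition_on_subset_compl[OF part s(1) t(1)] t(2) by blast
  ultimately obtain n where "coprime_power_action (G Mod Q) ((\<lambda>x. Q #> x) ` T) (Q #> y) n"
    using section_power_action[OF Q T(1) QT s(1)] by blast
  then interpret A: coprime_power_action "G Mod Q" "(\<lambda>x. Q #> x) ` T" "Q #> y" n .
  have [simp]: "y \<in> carrier G" using y by auto
  have Qq: "Q #> x \<in> tau_elements {q} (G Mod Q)" if xq: "x \<in> tau_elements {q} G" for x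
  proof -
    obtain k where k: "tau_number {q} k" "x [^] k = \<one>" "x \<in> carrier G" using xq by (auto simp: tau_elements_def)
    have "(Q #> x) [^]\<^bsub>G Mod Q\<^esub> k = \<one>\<^bsub>G Mod Q\<^esub>"
      using normal.FactGroup_pow[OF Q k(3), of k] k(2) coset_mult_one[OF subgroup.subset[OF QG]] by simp
    then show ?thesis using k by (auto simp: tau_elements_def carrier_FactGroup)
  qed
  have Qd: "(Q #> y) \<bullet>\<^bsub>G Mod Q\<^esub> (Q #> d) \<noteq> Q #> d"
  proof
    assume "(Q #> y) \<bullet>\<^bsub>G Mod Q\<^esub> (Q #> d) = Q #> d"
    then have "(y \<bullet> d) \<otimes> inv d \<in> Q" using conj_mod[OF Q, of y d] coset_eq_iff[OF Q, of "y \<bullet> d" d] d by simp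
    then have "y \<bullet> d = d" using d normal_conj_mem[OF D_normal] tau_elements_conj by (intro Dq_diff) auto
    with d(3) show False ..
  qed
  have dT: "Q #> d \<in> (\<lambda>x. Q #> x) ` T" using d DT by auto
  have move_all: "(Q #> y) \<bullet>\<^bsub>G Mod Q\<^esub> (Q #> x) \<noteq> Q #> x" if x: "x \<in> T" "x \<in> tau_elements {q} G" "x \<notin> Q" for x
    using A.all_moved[OF q(1) dT Qq[OF d(2)] Qd _ Qq[OF x(2)]] x coset_eq_self_iff[OF Q, of x] by auto
  have qs: "x \<in> tau_elements s G" if "x \<in> tau_elements {q} G" for x
    using tau_elements_mono[OF that] s(2) by simp
  show "tau_elements {q} G \<subseteq> D"
  proof
    fix x assume x: "x \<in> tau_elements {q} G"
    show "x \<in> D"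
    proof (cases "x \<in> Q")
      case True
      then show ?thesis by (simp add: Q_def)
    next
      case False
      have xT: "x \<in> T" using qs[OF x] T(2) by auto
      have [simp]: "x \<in> carrier G" using x by auto
      have "Q #> x \<in> (\<lambda>x. Q #> x) ` D"
      proof (rule A.moved_mem[OF q(1) _ Qq[OF x] move_all[OF xT x False]])
        show "subgroup ((\<lambda>x. Q #> x) ` D) (G Mod Q)" by (rule mod_image_subgroup[OF Q D_subgroup])
        interpret h: group_hom G "G Mod Q" "\<lambda>x. Q #> x" by (rule mod_hom[OF Q])
        have "(Q #> y) \<bullet>\<^bsub>G Mod Q\<^esub> (Q #> x) \<otimes>\<^bsub>G Mod Q\<^esub> inv\<^bsub>G Mod Q\<^esub> (Q #> x) = Q #> ((y \<bullet> x) \<otimes> inv x)"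
          using conj_mod[OF Q, of y x] by (simp del: mult_FactGroup)
        also have "\<dots> \<in> (\<lambda>x. Q #> x) ` D" using commutator_mem[OF t(1) s(1) t(2) y qs[OF x]] by blast
        finally show "(Q #> y) \<bullet>\<^bsub>G Mod Q\<^esub> (Q #> x) \<otimes>\<^bsub>G Mod Q\<^esub> inv\<^bsub>G Mod Q\<^esub> (Q #> x) \<in> (\<lambda>x. Q #> x) ` D" .
      qed (use xT in simp)
      then obtain e where e: "e \<in> D" "Q #> x = Q #> e" by blast
      then have "x \<otimes> inv e \<in> Q" using coset_eq_iff[OF Q, of x e] by simp
      then have "(x \<otimes> inv e) \<otimes> e \<in> D" using e(1) subgroup.m_closed[OF D_subgroup] by (auto simp: Q_def)
      then show ?thesis using e(1) by (simp add: m_assoc)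
    qed
  qed
  show "odd q"
  proof
    assume "even q"
    then have q2: "q = 2" using q(1) primes_dvd_imp_eq two_is_prime_nat by blast
    obtain k :: nat where k: "(Q #> y) \<bullet>\<^bsub>G Mod Q\<^esub> (Q #> d) = (Q #> d) [^]\<^bsub>G Mod Q\<^esub> k" using A.powers[OF dT] by blast
    have "Q #> d \<noteq> \<one>\<^bsub>G Mod Q\<^esub>"
    proof
      assume "Q #> d = \<one>\<^bsub>G Mod Q\<^esub>"
      then have "Q #> d = Q" by simp
      then have "d = \<one>" using Q1[OF _ d(2)] coset_eq_self_iff[OF Q, of d] d(1) by simp
      with d(3) show False by simp
    qed
    then have "coprime k 2" using A.exponent_coprime[OF q(1) dT Qq[OF d(2)] _ k] q2 by simp
    moreover have "\<not> [k = 1] (mod 2)" using A.moved_exponent[OF q(1) dT Qq[OF d(2)] k Qd] q2 by simp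
    ultimately show False by (simp add: cong_def odd_iff_mod_2_eq_one)
  qed
  show "x \<bullet> e = e" if x: "x \<in> tau_elements s G" and e: "e \<in> D" "e \<in> tau_elements {q} G" for x e
  proof (cases "e = \<one>")
    case True
    then show ?thesis using x by auto
  next
    case False
    then have eQ: "e \<notin> Q" using Q1 e(2) by blast
    have xT: "x \<in> T" and eT: "e \<in> T" using x T(2) e(1) DT by auto
    have [simp]: "x \<in> carrier G" using x by auto
    have "(Q #> e) \<bullet>\<^bsub>G Mod Q\<^esub> (Q #> x) = Q #> x"
      using A.moved_central[OF q(1) _ Qq[OF e(2)] move_all[OF eT e(2) eQ]] eT xT by simp
    then have "(Q #> x) \<bullet>\<^bsub>G Mod Q\<^esub> (Q #> e) = Q #> e"
      by (rule A.conj_eq_sym[rotated 2]) (use e(1) in \<open>auto simp: carrier_FactGroup\<close>)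
    then have "(x \<bullet> e) \<otimes> inv e \<in> Q" using conj_mod[OF Q, of x e] coset_eq_iff[OF Q, of "x \<bullet> e" e] e by simp
    then show ?thesis using e normal_conj_mem[OF D_normal] tau_elements_conj by (intro Dq_diff) auto
  qed
qed

lemma s_elements_central:
  assumes s: "s \<in> \<sigma>" and x: "x \<in> tau_elements s G" and d: "d \<in> D" "d \<in> tau_elements s G"
  shows "x \<bullet> d = d"
proof -
  have xG: "x \<in> carrier G" using x by auto
  have dG: "d \<in> carrier G" using d by simp
  show ?thesis
  proof (rule prime_power_closure[OF dG, where P = "\<lambda>e. x \<bullet> e = e"])
    fix q and i :: nat assume q: "prime q" "d [^] i \<in> tau_elements {q} G"
    show "x \<bullet> d [^] i = d [^] i"
    proof (cases "d [^] i = \<one>")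
      case False
      have dD: "d [^] i \<in> D" by (rule subgroup_pow_mem[OF D_subgroup d(1)])
      have "q dvd card D" by (rule prime_dvd_card_subgroup[OF q(1) D_subgroup dD q(2) False])
      moreover have "q \<in> s"
      proof (rule ccontr)
        assume "q \<notin> s"
        then have "d [^] i = \<one>" using tau_elements_pow[OF d(2)] q(2) by (intro tau_elements_disjoint[of _ s "{q}"]) auto
        with False show False ..
      qed
      ultimately show ?thesis using local_structure(3)[OF q(1) _ s] x dD q(2) by blast
    qed (use xG in simp)
  qed (use xG dG in \<open>simp add: conj_mult\<close>)
qed

text \<open>For a \<open>q\<close>-element \<open>e\<close> of \<open>D\<close> with \<open>q \<in> s\<close>, the \<open>s\<close>-elements of \<open>G\<close> centralize \<open>e\<close> and all elements of order
  prime to \<open>s\<close> normalize the subgroup generated by \<open>e\<close>.\<close>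

lemma conj_mem_cyclic:
  assumes g: "g \<in> carrier G" and d: "d \<in> D" shows "g \<bullet> d \<in> generate G {d}"
proof -
  have prime_case: "g \<bullet> e \<in> generate G {e}"
    if q: "prime q" and e: "e \<in> D" "e \<in> tau_elements {q} G" for q e
  proof -
    let ?E = "generate G {e}"
    have C: "subgroup ?E G" using e(1) by (intro cyclic_subgroup) simp
    have [simp]: "x \<in> ?E \<Longrightarrow> x \<in> carrier G" for x by (rule subgroup.mem_carrier[OF C])
    have N: "D \<inter> tau_elements {q} G \<lhd> G" by (rule D_tau_normal)
    have eD: "?E \<subseteq> D \<inter> tau_elements {q} G" using e by (intro cyclic_subset[OF normal_imp_subgroup[OF N]]) simp
    define U where "U = {u \<in> carrier G. \<forall>x\<in>?E. u \<bullet> x \<in> ?E}"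
    have U: "subgroup U G"
      by (rule finite_subgroupI) (auto simp: U_def simp flip: conj_conj intro!: exI[of _ \<one>])
    obtain s where s: "s \<in> \<sigma>" "q \<in> s" using partition_on_block[OF part q] .
    have "g \<in> U"
    proof (rule prime_power_closure[OF g])
      fix p and i :: nat assume p: "prime p" "g [^] i \<in> tau_elements {p} G"
      obtain t where t: "t \<in> \<sigma>" "p \<in> t" using partition_on_block[OF part p(1)] .
      have u: "g [^] i \<in> tau_elements t G" using tau_elements_mono[OF p(2), of t] t by simp
      have "g [^] i \<bullet> x \<in> ?E" if x: "x \<in> ?E" for x
      proof (cases "t = s")
        case True
        have "x \<in> D" "x \<in> tau_elements s G" using x eD tau_elements_mono[of x "{q}" s] s by auto
        then show ?thesis using s_elements_central[OF s(1)] u True x by simp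
      next
        case False
        then have "g [^] i \<in> tau_elements (prime_compl s) G"
          using tau_elements_mono[OF u] partition_on_subset_compl[OF part s(1) t(1)] by blast
        moreover have "tau_number s (card (D \<inter> tau_elements {q} G) div card {\<one>})"
          using tau_number_mono[OF tau_number_card[OF normal_imp_subgroup[OF N], of "{q}"], of s] s(2) by auto
        ultimately show ?thesis
          using normalizes_section_subgroups[OF one_is_normal N _ s(1) _ _ C _ eD x]
            subgroup.one_closed[OF normal_imp_subgroup[OF N]] subgroup.one_closed[OF C] by blast
      qed
      then show "g [^] i \<in> U" using g by (simp add: U_def)
    qed (rule subgroup.m_closed[OF U])
    then show ?thesis using cyclic_self by (simp add: U_def)
  qed
  have dG: "d \<in> carrier G" using d by simp
  note C = cyclic_subgroup[OF dG]
  show ?thesis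
  proof (rule prime_power_closure[OF dG, where P = "\<lambda>e. g \<bullet> e \<in> generate G {d}"])
    fix q and i :: nat assume q: "prime q" "d [^] i \<in> tau_elements {q} G"
    have "g \<bullet> d [^] i \<in> generate G {d [^] i}"
      by (rule prime_case[OF q(1) subgroup_pow_mem[OF D_subgroup d] q(2)])
    then show "g \<bullet> d [^] i \<in> generate G {d}"
      using cyclic_subset[OF C subgroup_pow_mem[OF C cyclic_self]] by blast
  next
    fix i j :: nat
    assume "g \<bullet> d [^] i \<in> generate G {d}" "g \<bullet> d [^] j \<in> generate G {d}"
    then show "g \<bullet> (d [^] i \<otimes> d [^] j) \<in> generate G {d}"
      using subgroup.m_closed[OF C] g dG by (simp only: conj_mult nat_pow_closed)
  qed
qed

theorem D_structure: "sigma_structure \<sigma> G D"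
  unfolding sigma_structure_def
proof (intro conjI allI impI ballI)
  show "subgroup D G" by (rule D_subgroup)
  show "a \<bullet> b = b" if "a \<in> D" "b \<in> D" for a b by (rule D_abelian[OF that])
  show "\<exists>k::nat. g \<bullet> d = d [^] k" if "g \<in> carrier G" "d \<in> D" for g d
    using conj_mem_cyclic[OF that] cyclic_mem_iff[of d] that(2) by simp
  show "tau_elements {q} G \<subseteq> D" if "prime q \<and> q dvd card D" for q
    using that partition_on_block[OF part, of q] local_structure(1)[of q] by metis
  show "(x \<bullet> y) \<otimes> inv y \<in> D" if "s \<in> \<sigma>" "t \<in> \<sigma>" "s \<noteq> t" "x \<in> tau_elements s G" "y \<in> tau_elements t G" for s t x y
    by (rule commutator_mem[OF that])
  show "x \<bullet> d = d" if "s \<in> \<sigma>" "x \<in> tau_elements s G" "d \<in> D \<inter> tau_elements s G" for s x d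
    using s_elements_central[OF that(1,2)] that(3) by blast
qed

theorem odd_card_D: "odd (card D)"
proof
  assume e: "even (card D)"
  obtain s where "s \<in> \<sigma>" "2 \<in> s" using partition_on_block[OF part two_is_prime_nat] .
  then have "odd (2::nat)" using local_structure(2)[OF two_is_prime_nat e] by blast
  then show False by simp
qed

end


section \<open>The structure implies transitivity of permutability\<close>

context finite_group
begin

lemma sigma_structure_subgroup:
  assumes str: "sigma_structure \<sigma> G D" and K: "subgroup K G"
  shows "sigma_structure \<sigma> (G\<lparr>carrier := K\<rparr>) (D \<inter> K)"
proof -
  interpret K: finite_group "G\<lparr>carrier := K\<rparr>" by (rule finite_group_subgroup[OF K])
  have D: "subgroup D G" using str by (simp add: sigma_structure_def)
  have DK: "subgroup (D \<inter> K) G" by (rule subgroups_Inter_pair[OF D K])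
  have "q dvd card D" if "q dvd card (D \<inter> K)" for q
    using that card_subgroup_dvd[OF DK D] dvd_trans by blast
  moreover have "(x \<bullet> y) \<otimes> inv y \<in> K" if "x \<in> K" "y \<in> K" for x y
    using that conj_mem_subgroup[OF K] subgroup.m_closed[OF K] subgroup.m_inv_closed[OF K] by blast
  moreover have "\<exists>k::nat. g \<bullet> d = d [^] k" if "g \<in> K" "d \<in> D" for g d
    using str that subgroup.mem_carrier[OF K] by (simp add: sigma_structure_def)
  moreover have "a \<bullet> b = b" if "a \<in> D" "b \<in> D" for a b
    using str that by (simp add: sigma_structure_def)
  moreover have "tau_elements {q} G \<subseteq> D" if "prime q" "q dvd card D" for q
    using str that by (simp add: sigma_structure_def)
  moreover have "\<forall>s\<in>\<sigma>. \<forall>t\<in>\<sigma>. s \<noteq> t \<longrightarrow> (\<forall>x\<in>tau_elements s G. \<forall>y\<in>tau_elements t G. (x \<bullet> y) \<otimes> inv y \<in> D)"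
    using str by (simp add: sigma_structure_def)
  moreover have "\<forall>s\<in>\<sigma>. \<forall>x\<in>tau_elements s G. \<forall>d\<in>D \<inter> tau_elements s G. x \<bullet> d = d"
    using str by (simp add: sigma_structure_def)
  ultimately show ?thesis
    unfolding sigma_structure_def tau_elements_subgroup[OF K] using subgroup_incl[OF DK K] K
    by (simp add: conj_subgroup pow_subgroup) blast
qed

lemma conj_mem_cong:
  assumes D: "D \<lhd> G" and xy: "x \<in> carrier G" "y \<in> carrier G" "u \<in> carrier G" "v \<in> carrier G"
    and eq: "D #> x = D #> u" "D #> y = D #> v"
  shows "D #> (x \<bullet> y) = D #> (u \<bullet> v)"
  using conj_mod[OF D xy(1,2)] conj_mod[OF D xy(3,4)] eq by simp

text \<open>The product of \<open>P\<close> and \<open>S\<close> is an \<open>s\<close>-group, so it cannot be larger than \<open>S\<close>.\<close>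

lemma normal_subset_hall:
  assumes P: "P \<lhd> G" "tau_number s (card P)" and S: "hall_tau_subgroup s G S"
  shows "P \<subseteq> S"
proof -
  have SG: "subgroup S G" using S by (simp add: hall_iff)
  note PG = normal_imp_subgroup[OF P(1)] and PS = normal_set_mult[OF P(1) SG]
  have "card (P <#> S) div card S dvd order G div card S"
    using index_dvd_index(2)[OF SG PS(2) subgroup_self PS(4) subgroup.subset[OF PS(2)]] by (simp add: order_def)
  then have "tau_number (prime_compl s) (card (P <#> S) div card S)" using S tau_number_dvd by (auto simp: hall_iff)
  with card_set_mult_div(3)[OF PG SG PS(2) P(2)] have "card (P <#> S) div card S = 1" by (rule tau_number_both) simp
  then have "S = P <#> S" by (rule subgroup_eq_of_index[OF SG PS(2,4)])
  then show ?thesis using PS(3) by simp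
qed

lemma conj_hall:
  assumes S: "hall_tau_subgroup t G S" and x: "x \<in> carrier G"
  shows "hall_tau_subgroup t G ((\<lambda>u. x \<bullet> u) ` S)"
proof -
  have SG: "subgroup S G" using S by (simp add: hall_iff)
  have "card ((\<lambda>u. x \<bullet> u) ` S) = card S"
    using conj_inj[OF x] subgroup.mem_carrier[OF SG] by (intro card_image inj_onI) blast
  moreover have "subgroup ((\<lambda>u. x \<bullet> u) ` S) G"
  proof (rule finite_subgroupI)
    show "(\<lambda>u. x \<bullet> u) ` S \<noteq> {}" using subgroup.one_closed[OF SG] by blast
    show "(\<lambda>u. x \<bullet> u) ` S \<subseteq> carrier G" using x subgroup.mem_carrier[OF SG] by auto
    fix a b assume "a \<in> (\<lambda>u. x \<bullet> u) ` S" "b \<in> (\<lambda>u. x \<bullet> u) ` S"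
    then obtain u v where "u \<in> S" "v \<in> S" "a = x \<bullet> u" "b = x \<bullet> v" by blast
    then have "a \<otimes> b = x \<bullet> (u \<otimes> v)" "u \<otimes> v \<in> S"
      using x subgroup.mem_carrier[OF SG] subgroup.m_closed[OF SG] by (simp_all add: conj_mult)
    then show "a \<otimes> b \<in> (\<lambda>u. x \<bullet> u) ` S" by blast
  qed
  ultimately show ?thesis using S by (simp add: hall_iff)
qed

end

locale sigma_structured_group = finite_group +
  fixes \<sigma> :: "nat set set" and D
  assumes part: "partition_on all_primes \<sigma>" and str: "sigma_structure \<sigma> G D"
begin

lemma D_subgroup: "subgroup D G"
  using str by (simp add: sigma_structure_def)

lemma D_carrier [simp]: "d \<in> D \<Longrightarrow> d \<in> carrier G"
  by (rule subgroup.mem_carrier[OF D_subgroup])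

lemma D_powers: "g \<in> carrier G \<Longrightarrow> d \<in> D \<Longrightarrow> \<exists>k::nat. g \<bullet> d = d [^] k"
  using str by (simp add: sigma_structure_def)

lemma D_conj: "a \<in> D \<Longrightarrow> b \<in> D \<Longrightarrow> a \<bullet> b = b"
  using str by (simp add: sigma_structure_def)

lemma D_comm: "a \<in> D \<Longrightarrow> b \<in> D \<Longrightarrow> a \<otimes> b = b \<otimes> a"
  using D_conj[of a b] conj_eq_iff_commute[of a b] by simp

lemma D_hall: "prime q \<Longrightarrow> q dvd card D \<Longrightarrow> x \<in> tau_elements {q} G \<Longrightarrow> x \<in> D"
  using str by (auto simp: sigma_structure_def)

lemma D_commutator:
  assumes "s \<in> \<sigma>" "t \<in> \<sigma>" "s \<noteq> t" "x \<in> tau_elements s G" "y \<in> tau_elements t G"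
  shows "(x \<bullet> y) \<otimes> inv y \<in> D"
proof -
  have "\<forall>s\<in>\<sigma>. \<forall>t\<in>\<sigma>. s \<noteq> t \<longrightarrow> (\<forall>x\<in>tau_elements s G. \<forall>y\<in>tau_elements t G. (x \<bullet> y) \<otimes> inv y \<in> D)"
    using str by (simp add: sigma_structure_def)
  with assms show ?thesis by blast
qed

lemma D_central:
  assumes "s \<in> \<sigma>" "x \<in> tau_elements s G" "d \<in> D" "d \<in> tau_elements s G" shows "x \<bullet> d = d"
proof -
  have "\<forall>s\<in>\<sigma>. \<forall>x\<in>tau_elements s G. \<forall>d\<in>D \<inter> tau_elements s G. x \<bullet> d = d"
    using str by (simp add: sigma_structure_def)
  with assms show ?thesis by blast
qed

lemma subgroup_of_D_normal:
  assumes K: "subgroup K G" "K \<subseteq> D" shows "K \<lhd> G"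
  unfolding normal_iff_conj
proof (intro conjI ballI K(1))
  fix g x assume "g \<in> carrier G" "x \<in> K"
  then obtain k :: nat where "g \<bullet> x = x [^] k" using D_powers K(2) by blast
  then show "g \<bullet> x \<in> K" using subgroup_pow_mem[OF K(1) \<open>x \<in> K\<close>] by simp
qed

lemma D_normal: "D \<lhd> G"
  by (rule subgroup_of_D_normal[OF D_subgroup order_refl])

lemma D_tau_normal: "D \<inter> tau_elements \<tau> G \<lhd> G"
  by (rule tau_elements_abelian_normal[OF D_normal D_comm])

lemma hall_modulo_D:
  assumes "s \<in> \<sigma>" "hall_tau_subgroup s G S"
  shows "D <#> S \<lhd> G" "tau_elements s G \<subseteq> D <#> S" "tau_number s (card (D <#> S) div card D)"
  using hall_normal_modulo[OF part assms(1) D_normal _ assms(2)] D_commutator assms(1) by blast+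

text \<open>Let \<open>R\<close> be generated by the \<open>r\<close>-part of \<open>d\<close>; it is normal in \<open>G\<close>. The index of \<open>K\<close> in \<open>R K\<close> is a power of \<open>r\<close> and
  divides the index of \<open>K\<close> in \<open>K S\<close>, a \<open>t\<close>-number.\<close>

lemma permutable_contains_part:
  assumes K: "subgroup K G" and S: "hall_tau_subgroup t G S" and KS: "K <#> S = S <#> K"
    and d: "d \<in> D" "d \<in> K <#> S" and i: "d [^] (i::nat) \<in> tau_elements {r} G" and r: "r \<notin> t"
  shows "d [^] i \<in> K"
proof -
  have SG: "subgroup S G" using S by (simp add: hall_iff)
  have W: "subgroup (K <#> S) G" by (rule subgroup_set_mult_of_commute[OF K SG KS])
  have KW: "K \<subseteq> K <#> S"
    using subgroup.one_closed[OF SG] r_one[OF subgroup.mem_carrier[OF K]] unfolding set_mult_def by force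
  let ?R = "generate G {d [^] i}"
  have dD: "d [^] i \<in> D" "d [^] i \<in> K <#> S" using d subgroup_pow_mem[OF D_subgroup] subgroup_pow_mem[OF W] by auto
  then have R: "subgroup ?R G" by (intro cyclic_subgroup) simp
  have RN: "?R \<lhd> G" by (rule subgroup_of_D_normal[OF R cyclic_subset[OF D_subgroup dD(1)]])
  have "?R \<subseteq> tau_elements {r} G" using tau_elements_pow[OF i] cyclic_mem_iff[of "d [^] i"] dD(1) by auto
  then have Rr: "tau_number {r} (card ?R)" by (rule tau_number_card[OF R])
  note RK = normal_set_mult[OF RN K]
  have RKW: "?R <#> K \<subseteq> K <#> S"
    using cyclic_subset[OF W dD(2)] KW subgroup.m_closed[OF W] by (fastforce simp: set_mult_def[of G ?R K])
  have "tau_number t (card (K <#> S) div card K)"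
    using card_set_mult_div(3)[OF SG K, of t] S W unfolding KS by (simp add: hall_iff)
  then have "tau_number t (card (?R <#> K) div card K)"
    using index_dvd_index(2)[OF K RK(2) W RK(4) RKW] tau_number_dvd by blast
  with card_set_mult_div(3)[OF R K RK(2) Rr] have "card (?R <#> K) div card K = 1"
    by (rule tau_number_both) (use r in simp)
  then have "K = ?R <#> K" by (rule subgroup_eq_of_index[OF K RK(2,4)])
  then show ?thesis using RK(3) cyclic_self by blast
qed

text \<open>This condition characterizes the \<open>\<sigma>\<close>-permutable subgroups \<open>K\<close>, and in contrast to permutability it is visibly
  transitive: it speaks of single elements of \<open>K\<close> and of \<open>D\<close>.\<close>

definition absorbs_moved :: "'a set \<Rightarrow> bool" where
  "absorbs_moved K \<longleftrightarrow> (\<forall>k\<in>K. \<forall>q r x. prime q \<and> k \<in> tau_elements {q} G \<and> prime r \<and>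
     x \<in> D \<inter> tau_elements {r} G \<and> k \<bullet> x \<noteq> x \<longrightarrow> x \<in> K)"

text \<open>Let \<open>k \<in> K\<close> move \<open>x\<close>. Writing \<open>k = d s = e s'\<close> with \<open>d, e \<in> D\<close> and \<open>s, s'\<close> in the Hall
  subgroups \<open>S\<close> and \<open>x S x\<^sup>-\<^sup>1\<close>, the \<open>r\<close>-parts of \<open>d\<close> and \<open>e\<close> lie in \<open>K\<close>, and comparing the two
  factorizations shows that their quotient is the commutator of \<open>x\<close> and \<open>k\<close>.\<close>

lemma absorbs_of_permutable:
  assumes perm: "sigma_permutable \<sigma> G K"
  shows "absorbs_moved K"
  unfolding absorbs_moved_def
proof (intro ballI allI impI)
  fix k q r x
  assume k: "k \<in> K" and "prime q \<and> k \<in> tau_elements {q} G \<and> prime r \<and> x \<in> D \<inter> tau_elements {r} G \<and> k \<bullet> x \<noteq> x"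
  then have q: "prime q" "k \<in> tau_elements {q} G" and r: "prime r" and x: "x \<in> D" "x \<in> tau_elements {r} G"
    and kx: "k \<bullet> x \<noteq> x" by auto
  have K: "subgroup K G" using perm by (simp add: sigma_permutable_def)
  have [simp]: "k \<in> carrier G" "x \<in> carrier G" using q(2) x by auto
  obtain t where t: "t \<in> \<sigma>" "q \<in> t" using partition_on_block[OF part q(1)] .
  have kt: "k \<in> tau_elements t G" using tau_elements_mono[OF q(2)] t(2) by simp
  have rt: "r \<notin> t"
  proof
    assume "r \<in> t"
    then have "x \<in> tau_elements t G" using tau_elements_mono[OF x(2)] by simp
    then show False using D_central[OF t(1) kt x(1)] kx by simp
  qed
  obtain \<H> where "complete_hall_set \<sigma> G \<H>" using perm by (auto simp: sigma_permutable_def)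
  then obtain S where S: "hall_tau_subgroup t G S"
    using hall_of_complete_hall_set t(1) part unfolding partition_on_def by blast
  have factor: "\<exists>d1 d2 s. d1 \<in> D \<and> d1 \<in> K \<and> d1 \<in> tau_elements {r} G \<and> d2 \<in> D \<and> d2 \<in> tau_elements (prime_compl {r}) G \<and>
      s \<in> S' \<and> k = d1 \<otimes> d2 \<otimes> s" if S': "hall_tau_subgroup t G S'" for S'
  proof -
    have SG: "subgroup S' G" using S' by (simp add: hall_iff)
    have KS: "K <#> S' = S' <#> K" using perm t(1) S' by (simp add: sigma_permutable_def)
    have "k \<in> D <#> S'" using hall_modulo_D(2)[OF t(1) S'] kt by blast
    then obtain d s where ds: "d \<in> D" "s \<in> S'" "k = d \<otimes> s" by (auto simp: set_mult_def)
    have sG: "s \<in> carrier G" by (rule subgroup.mem_carrier[OF SG ds(2)])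
    have "d = k \<otimes> inv s" using ds sG by (simp add: m_assoc)
    then have dW: "d \<in> K <#> S'" using k subgroup.m_inv_closed[OF SG ds(2)] by (auto simp: set_mult_def)
    obtain i j :: nat where ij: "d = d [^] i \<otimes> d [^] j" "d [^] i \<in> tau_elements {r} G" "d [^] j \<in> tau_elements (prime_compl {r}) G"
      using tau_decomposition[of d "{r}"] ds by auto
    have "d [^] i \<in> K" by (rule permutable_contains_part[OF K S' KS ds(1) dW ij(2) rt])
    moreover have "d [^] i \<in> D" "d [^] j \<in> D" using subgroup_pow_mem[OF D_subgroup ds(1)] by auto
    moreover have "k = d [^] i \<otimes> d [^] j \<otimes> s" using ij(1) ds(3) by simp
    ultimately show ?thesis using ij ds(2) by blast
  qed
  obtain d1 d2 s where d: "d1 \<in> D" "d1 \<in> K" "d1 \<in> tau_elements {r} G" "d2 \<in> D" "d2 \<in> tau_elements (prime_compl {r}) G"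
    "s \<in> S" "k = d1 \<otimes> d2 \<otimes> s" using factor[OF S] by blast
  obtain e1 e2 s' where e: "e1 \<in> D" "e1 \<in> K" "e1 \<in> tau_elements {r} G" "e2 \<in> D" "e2 \<in> tau_elements (prime_compl {r}) G"
    "s' \<in> (\<lambda>u. x \<bullet> u) ` S" "k = e1 \<otimes> e2 \<otimes> s'" using factor[OF conj_hall[OF S \<open>x \<in> carrier G\<close>]] by blast
  then obtain u where u: "u \<in> S" "s' = x \<bullet> u" by blast
  have SG: "subgroup S G" using S by (simp add: hall_iff)
  have [simp]: "s \<in> carrier G" "u \<in> carrier G" using d u subgroup.mem_carrier[OF SG] by auto
  have [simp]: "d1 \<in> carrier G" "d2 \<in> carrier G" "e1 \<in> carrier G" "e2 \<in> carrier G" using d e by simp_all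
  note DD = subgroup.m_closed[OF D_subgroup] subgroup.m_inv_closed[OF D_subgroup]
  \<comment> \<open>the factor in \<open>D\<close> that links \<open>k\<close> with \<open>u\<close>, so that \<open>k\<close> and \<open>u\<close> act alike on \<open>D\<close>\<close>
  define z where "z = e1 \<otimes> e2 \<otimes> x \<otimes> (u \<bullet> inv x)"
  have uD: "u \<bullet> inv x \<in> D" using normal_conj_mem[OF D_normal] DD(2)[OF x(1)] by simp
  have z: "z \<in> D" unfolding z_def using e x uD DD by simp
  have [simp]: "z \<in> carrier G" using z by simp
  have kz: "k = z \<otimes> u" unfolding e(7) u(2) z_def by (simp add: conjugate_def m_assoc)
  have ukx: "k \<bullet> x = u \<bullet> x"
  proof -
    have "k \<bullet> x = z \<bullet> (u \<bullet> x)" unfolding kz by (simp add: conj_conj)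
    also have "\<dots> = u \<bullet> x" by (rule D_conj[OF z normal_conj_mem[OF D_normal _ x(1)]]) simp
    finally show ?thesis .
  qed
  define f where "f = s \<otimes> inv u"
  have "f = inv (d1 \<otimes> d2) \<otimes> z"
  proof -
    have "d1 \<otimes> d2 \<otimes> s = z \<otimes> u" using d(7) kz by simp
    then have "s = inv (d1 \<otimes> d2) \<otimes> (z \<otimes> u)" by (metis inv_mult_cancel(1) m_closed \<open>s \<in> carrier G\<close> \<open>d1 \<in> carrier G\<close> \<open>d2 \<in> carrier G\<close>)
    then show ?thesis unfolding f_def by (simp add: m_assoc inv_mult_group)
  qed
  then have fD: "f \<in> D" using d z DD by simp
  have f: "f \<in> tau_elements (prime_compl {r}) G"
  proof -
    have "f \<in> S" unfolding f_def using d(6) u(1) subgroup.m_closed[OF SG] subgroup.m_inv_closed[OF SG] by blast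
    then have "f \<in> tau_elements t G" by (rule hall_subgroup_elements[OF S])
    moreover have "t \<subseteq> prime_compl {r}" using rt t(1) part by (auto simp: partition_on_def prime_compl_def)
    ultimately show ?thesis by (rule tau_elements_mono)
  qed
  define v where "v = x \<otimes> inv (k \<bullet> x)"
  have vD: "v \<in> D" unfolding v_def using x(1) DD normal_conj_mem[OF D_normal _ x(1), of k] by simp
  have vr: "v \<in> tau_elements {r} G"
    unfolding v_def using x D_comm[OF x(1) DD(2)[OF normal_conj_mem[OF D_normal _ x(1)]], of k]
    by (intro tau_elements_commuting_mult tau_elements_inv tau_elements_conj) auto
  have [simp]: "v \<in> carrier G" "f \<in> carrier G" using vD fD by simp_all
  have "v = inv (e1 \<otimes> e2) \<otimes> (d1 \<otimes> d2 \<otimes> f)"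
  proof -
    have "d1 \<otimes> d2 \<otimes> f = k \<otimes> inv u" unfolding f_def d(7) by (simp add: m_assoc)
    also have "\<dots> = z" unfolding kz by (simp add: m_assoc)
    also have "\<dots> = (e1 \<otimes> e2) \<otimes> v" unfolding z_def v_def ukx by (simp add: m_assoc conj_inv)
    finally show ?thesis by simp
  qed
  also have "\<dots> = (inv e2 \<otimes> (inv e1 \<otimes> d1)) \<otimes> (d2 \<otimes> f)"
    by (simp add: m_assoc inv_mult_group)
  also have "\<dots> = (inv e1 \<otimes> d1) \<otimes> (inv e2 \<otimes> d2 \<otimes> f)"
    unfolding D_comm[OF DD(2)[OF e(4)] DD(1)[OF DD(2)[OF e(1)] d(1)]] by (simp add: m_assoc)
  finally have ve: "v = (inv e1 \<otimes> d1) \<otimes> (inv e2 \<otimes> d2 \<otimes> f)" .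
  have g1: "inv e1 \<otimes> d1 \<in> D" "inv e1 \<otimes> d1 \<in> tau_elements {r} G"
    using e d DD D_comm[OF DD(2)[OF e(1)] d(1)] by (auto intro!: tau_elements_commuting_mult tau_elements_inv)
  have g2: "inv e2 \<otimes> d2 \<otimes> f \<in> tau_elements (prime_compl {r}) G"
    using e d f fD DD D_comm[OF DD(2)[OF e(4)] d(4)] D_comm[OF DD(1)[OF DD(2)[OF e(4)] d(4)] fD]
    by (auto intro!: tau_elements_commuting_mult tau_elements_inv)
  have "inv e2 \<otimes> d2 \<otimes> f = inv (inv e1 \<otimes> d1) \<otimes> v" unfolding ve by simp
  also have "\<dots> \<in> tau_elements {r} G"
    by (rule tau_elements_commuting_mult[OF tau_elements_inv[OF g1(2)] vr D_comm[OF DD(2)[OF g1(1)] vD]])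
  finally have "inv e2 \<otimes> d2 \<otimes> f = \<one>"
    using g2 by (rule tau_elements_disjoint) simp
  then have "v = inv e1 \<otimes> d1" using ve by simp
  then have "v \<in> K" using e(2) d(2) subgroup.m_closed[OF K] subgroup.m_inv_closed[OF K] by simp
  then have vK: "(k \<bullet> x) \<otimes> inv x \<in> K"
    using subgroup.m_inv_closed[OF K, of v] by (simp add: v_def inv_mult_group)
  obtain n where n: "tau_number {q} n" "k [^] n = \<one>" using q(2) by (auto simp: tau_elements_def)
  let ?X = "D \<inter> tau_elements {r} G"
  have "q \<noteq> r" using t(2) rt by auto
  then have cop: "coprime n (card ?X)"
    using tau_number_coprime[OF n(1) tau_number_card[of ?X "{r}"]] normal_imp_subgroup[OF D_tau_normal] by simp
  interpret A: coprime_power_action G ?X k n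
    unfolding coprime_power_action_def coprime_power_action_axioms_def
    using D_tau_normal n(2) cop D_powers finite_group_axioms by auto
  show "x \<in> K" using A.moved_mem[OF r _ x(2) kx K vK] x by blast
qed

text \<open>It suffices that \<open>u k \<in> K S\<close> for \<open>u \<in> S\<close> and a \<open>t\<close>-element \<open>k\<close> of \<open>K\<close> whose order is a power of a prime that
  does not divide the order of \<open>D\<close>.
  If \<open>t \<noteq> s\<close>, then \<open>u \<bullet> k = k c\<close> with \<open>c \<in> D\<close>; if \<open>t = s\<close>, then \<open>k = e s\<^sub>1\<close> with \<open>s\<^sub>1 \<in> S\<close> and \<open>e \<in> D\<close> of order prime
  to \<open>s\<close>. In both cases each prime part of the element of \<open>D\<close> lies in \<open>K\<close>, because it is moved by \<open>k\<close>, or is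
  trivial, because it commutes with \<open>k\<close> and the orders of \<open>k\<close>, \<open>u \<bullet> k\<close> and \<open>s\<^sub>1\<close> are prime to it.\<close>

lemma permutable_of_absorbs:
  assumes K: "subgroup K G" and abs: "absorbs_moved K" and hall: "\<exists>\<H>. complete_hall_set \<sigma> G \<H>"
  shows "sigma_permutable \<sigma> G K"
proof -
  have KS: "K <#> S = S <#> K" if s: "s \<in> \<sigma>" and S: "hall_tau_subgroup s G S" for s S
  proof -
    have SG: "subgroup S G" using S by (simp add: hall_iff)
    note DD = subgroup.m_closed[OF D_subgroup] subgroup.m_inv_closed[OF D_subgroup]
    note [simp] = subgroup.mem_carrier[OF SG] subgroup.mem_carrier[OF K]
    have prime_case: "u \<otimes> k \<in> K <#> S" if u: "u \<in> S" and k: "k \<in> K" and q: "prime q" "k \<in> tau_elements {q} G" for u k q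
    proof (cases "q dvd card D")
      case True
      then have "k \<in> D" using D_hall q by blast
      then obtain j :: nat where "u \<bullet> k = k [^] j" using D_powers[of u k] u by auto
      then have "u \<bullet> k \<in> K" using subgroup_pow_mem[OF K k] by simp
      moreover have "u \<otimes> k = (u \<bullet> k) \<otimes> u" using u k by (simp add: conjugate_def m_assoc)
      ultimately show ?thesis using u unfolding set_mult_def by blast
    next
      case False
      obtain t where t: "t \<in> \<sigma>" "q \<in> t" using partition_on_block[OF part q(1)] .
      have kt: "k \<in> tau_elements t G" using tau_elements_mono[OF q(2)] t(2) by simp
      have us: "u \<in> tau_elements s G" by (rule hall_subgroup_elements[OF S u])
      obtain n where n: "tau_number {q} n" "k [^] n = \<one>" using q(2) by (auto simp: tau_elements_def)
      have absorbs: "a \<in> K" if "prime r" "a \<in> D" "a \<in> tau_elements {r} G" "k \<bullet> a \<noteq> a" for r a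
        using abs k q that unfolding absorbs_moved_def by blast
      show ?thesis
      proof (cases "t = s")
        case False
        define c where "c = inv k \<otimes> (u \<bullet> k)"
        have "(u \<bullet> k) \<otimes> inv k \<in> D" using D_commutator[OF s t(1) _ us kt] False by simp
        then have "inv k \<bullet> ((u \<bullet> k) \<otimes> inv k) \<in> D" using k by (intro normal_conj_mem[OF D_normal]) simp_all
        then have cD: "c \<in> D" unfolding c_def using k u by (simp add: conjugate_def m_assoc)
        have kc: "u \<bullet> k = k \<otimes> c" unfolding c_def using k u by simp
        have "c \<in> K"
        proof (rule mem_of_prime_parts[OF D_carrier[OF cD] K])
          fix r and i j :: nat
          assume r: "prime r" and ij: "c = c [^] i \<otimes> c [^] j" "c [^] i \<in> tau_elements {r} G" "c [^] j \<in> tau_elements (prime_compl {r}) G"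
          define a b where "a = c [^] i" and "b = c [^] j"
          have a: "a \<in> D" "a \<in> tau_elements {r} G" and b: "b \<in> D \<inter> tau_elements (prime_compl {r}) G"
            using ij subgroup_pow_mem[OF D_subgroup cD] by (auto simp: a_def b_def)
          have "a \<in> K"
          proof (cases "k \<bullet> a = a")
            case False
            then show ?thesis using absorbs[OF r a] by simp
          next
            case True
            have "c = b \<otimes> a" using ij(1) D_comm[OF a(1), of b] b by (simp add: a_def b_def)
            then have kba: "u \<bullet> k = k \<otimes> b \<otimes> a" using kc k a b by (simp add: m_assoc)
            moreover have "(u \<bullet> k) [^] n = \<one>" using n(2) u k by (simp flip: conj_pow)
            ultimately have "a [^] n = \<one>"
              using b k n(2) a by (intro fixed_part_torsion[OF D_normal D_comm _ _ _ a True, of n b]) auto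
            then have "a \<in> tau_elements {q} G" using n(1) a(1) by (auto simp: tau_elements_def)
            then have "a = \<one>" using prime_dvd_card_subgroup[OF q(1) D_subgroup a(1)] \<open>\<not> q dvd card D\<close> by blast
            then show ?thesis using subgroup.one_closed[OF K] by simp
          qed
          then show "c [^] i \<in> K" by (simp add: a_def)
        qed
        then have "u \<bullet> k \<in> K" unfolding kc using subgroup.m_closed[OF K k] by simp
        moreover have "u \<otimes> k = (u \<bullet> k) \<otimes> u" using u k by (simp add: conjugate_def m_assoc)
        ultimately show ?thesis using u unfolding set_mult_def by blast
      next
        case True
        have "k \<in> D <#> S" using hall_modulo_D(2)[OF s S] kt True by blast
        then obtain d s0 where ds: "d \<in> D" "s0 \<in> S" "k = d \<otimes> s0" by (auto simp: set_mult_def)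
        have dG: "d \<in> carrier G" using ds by simp
        obtain i j :: nat where ij: "d = d [^] i \<otimes> d [^] j" "d [^] i \<in> tau_elements s G" "d [^] j \<in> tau_elements (prime_compl s) G"
          using tau_decomposition[OF dG] by blast
        define e s1 where "e = d [^] j" and "s1 = d [^] i \<otimes> s0"
        have eD: "e \<in> D" unfolding e_def by (rule subgroup_pow_mem[OF D_subgroup ds(1)])
        have eG: "e \<in> carrier G" using eD by simp
        have "D \<inter> tau_elements s G \<subseteq> S"
          using normal_subset_hall[OF D_tau_normal tau_number_card[OF normal_imp_subgroup[OF D_tau_normal]] S] by blast
        then have "d [^] i \<in> S" using ij(2) subgroup_pow_mem[OF D_subgroup ds(1)] by blast
        then have s1: "s1 \<in> S" unfolding s1_def using subgroup.m_closed[OF SG] ds(2) by blast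
        have "d = d [^] j \<otimes> d [^] i" using ij(1) dG by (simp add: nat_pow_mult add.commute)
        then have kes: "k = e \<otimes> s1" unfolding e_def s1_def using ds dG by (metis m_assoc nat_pow_closed subgroup.mem_carrier[OF SG])
        have "e \<in> K"
        proof (rule mem_of_prime_parts[OF eG K])
          fix r and i' j' :: nat
          assume r: "prime r" and ij': "e = e [^] i' \<otimes> e [^] j'" "e [^] i' \<in> tau_elements {r} G" "e [^] j' \<in> tau_elements (prime_compl {r}) G"
          define a b where "a = e [^] i'" and "b = e [^] j'"
          have a: "a \<in> D" "a \<in> tau_elements {r} G" and b: "b \<in> D \<inter> tau_elements (prime_compl {r}) G"
            using ij' subgroup_pow_mem[OF D_subgroup eD] by (auto simp: a_def b_def)
          have [simp]: "a \<in> carrier G" "b \<in> carrier G" using a b by auto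
          have as': "a \<in> tau_elements (prime_compl s) G" using tau_elements_pow[OF ij(3)] by (simp add: a_def e_def)
          have "a \<in> K"
          proof (cases "k \<bullet> a = a")
            case False
            then show ?thesis using absorbs[OF r a] by simp
          next
            case True
            have ka: "inv k \<bullet> inv a = inv a" "k \<bullet> inv a = inv a"
              using conj_inv_cancel(1)[of k a] True k by (simp_all add: conj_inv)
            have "s1 = inv e \<otimes> k" using kes eG s1 by simp
            also have "inv e = inv b \<otimes> inv a" using ij'(1) by (simp add: a_def[symmetric] b_def[symmetric] inv_mult_group)
            also have "inv b \<otimes> inv a \<otimes> k = k \<otimes> (inv k \<bullet> inv b) \<otimes> (inv k \<bullet> inv a)"
              using k by (simp add: conjugate_def m_assoc)
            finally have s1k: "s1 = k \<otimes> (inv k \<bullet> inv b) \<otimes> inv a" unfolding ka(1) .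
            have b': "inv k \<bullet> inv b \<in> D \<inter> tau_elements (prime_compl {r}) G"
              by (rule normal_conj_mem[OF D_tau_normal _ subgroup.m_inv_closed[OF normal_imp_subgroup[OF D_tau_normal] b]])
                (use k in simp)
            obtain n' where n': "tau_number s n'" "s1 [^] n' = \<one>"
              using hall_subgroup_elements[OF S s1] by (auto simp: tau_elements_def)
            let ?N = "n * n'"
            have N: "tau_number s ?N" using n(1) n'(1) t(2) True \<open>t = s\<close> tau_number_mono[of "{q}" n s] by simp
            have "s1 [^] (n' * n) = \<one>" using s1 by (simp add: n'(2) flip: nat_pow_pow)
            then have "s1 [^] ?N = \<one>" by (simp add: mult.commute)
            moreover have "k [^] ?N = \<one>" using k by (simp add: n(2) flip: nat_pow_pow)
            ultimately have N1: "k [^] ?N = \<one>" "s1 [^] ?N = \<one>" by simp_all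
            have "inv a [^] ?N = \<one>"
              using b' k N1 s1k ka(2) tau_elements_inv[OF a(2)] DD(2)[OF a(1)]
              by (intro fixed_part_torsion[OF D_normal D_comm, of k ?N "inv k \<bullet> inv b" "inv a" "{r}"]) auto
            then have "a [^] ?N = \<one>" by (simp add: nat_pow_inv)
            then have "a \<in> tau_elements s G"
              unfolding tau_elements_def using N \<open>a \<in> carrier G\<close> by blast
            then have "a = \<one>" using as' by (rule tau_elements_disjoint) simp
            then show ?thesis using subgroup.one_closed[OF K] by simp
          qed
          then show "e [^] i' \<in> K" by (simp add: a_def)
        qed
        moreover obtain m :: nat where "u \<bullet> e = e [^] m" using D_powers[OF _ eD, of u] u by auto
        ultimately have "u \<bullet> e \<in> K" using subgroup_pow_mem[OF K] by simp
        moreover have "u \<otimes> s1 \<in> S" using subgroup.m_closed[OF SG u s1] .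
        moreover have "u \<otimes> k = (u \<bullet> e) \<otimes> (u \<otimes> s1)" unfolding kes using u s1 eG by (simp add: conjugate_def m_assoc)
        ultimately show ?thesis unfolding set_mult_def by blast
      qed
    qed
    have all: "u \<otimes> k \<in> K <#> S" if u: "u \<in> S" and k: "k \<in> K" for u k
    proof -
      have "\<forall>u\<in>S. u \<otimes> k \<in> K <#> S"
      proof (rule prime_power_closure[of k])
        show "k \<in> carrier G" using k by simp
        show "\<forall>u\<in>S. u \<otimes> k [^] i \<in> K <#> S" if "prime q" "k [^] i \<in> tau_elements {q} G" for q and i :: nat
          using prime_case[OF _ subgroup_pow_mem[OF K k] that] by blast
        fix i j :: nat
        assume i: "\<forall>u\<in>S. u \<otimes> k [^] i \<in> K <#> S" and j: "\<forall>u\<in>S. u \<otimes> k [^] j \<in> K <#> S"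
        show "\<forall>u\<in>S. u \<otimes> (k [^] i \<otimes> k [^] j) \<in> K <#> S"
        proof
          fix u assume u: "u \<in> S"
          then obtain k1 u1 where 1: "k1 \<in> K" "u1 \<in> S" "u \<otimes> k [^] i = k1 \<otimes> u1" using i unfolding set_mult_def by blast
          then obtain k2 u2 where 2: "k2 \<in> K" "u2 \<in> S" "u1 \<otimes> k [^] j = k2 \<otimes> u2" using j unfolding set_mult_def by blast
          have "u \<otimes> (k [^] i \<otimes> k [^] j) = (u \<otimes> k [^] i) \<otimes> k [^] j" using u k by (simp add: m_assoc)
          also have "\<dots> = k1 \<otimes> (u1 \<otimes> k [^] j)" unfolding 1(3) using 1(1,2) k by (simp add: m_assoc)
          also have "\<dots> = (k1 \<otimes> k2) \<otimes> u2" unfolding 2(3) using 1(1,2) 2(1,2) by (simp add: m_assoc)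
          finally show "u \<otimes> (k [^] i \<otimes> k [^] j) \<in> K <#> S"
            using subgroup.m_closed[OF K 1(1) 2(1)] 2(2) unfolding set_mult_def by blast
        qed
      qed
      then show ?thesis using u by blast
    qed
    show ?thesis
    proof
      show "S <#> K \<subseteq> K <#> S" using all unfolding set_mult_def[of G S K] by blast
      show "K <#> S \<subseteq> S <#> K"
      proof
        fix z assume "z \<in> K <#> S"
        then obtain k u where z: "k \<in> K" "u \<in> S" "z = k \<otimes> u" by (auto simp: set_mult_def)
        have "inv u \<otimes> inv k \<in> K <#> S"
          using all[OF subgroup.m_inv_closed[OF SG z(2)] subgroup.m_inv_closed[OF K z(1)]] .
        then obtain k' u' where z': "k' \<in> K" "u' \<in> S" "inv u \<otimes> inv k = k' \<otimes> u'" by (auto simp: set_mult_def)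
        have "z = inv (inv u \<otimes> inv k)" using z by (simp add: inv_mult_group)
        also have "\<dots> = inv u' \<otimes> inv k'" unfolding z'(3) using z' by (simp add: inv_mult_group)
        finally show "z \<in> S <#> K"
          using subgroup.m_inv_closed[OF SG z'(2)] subgroup.m_inv_closed[OF K z'(1)] unfolding set_mult_def by blast
      qed
    qed
  qed
  then show ?thesis unfolding sigma_permutable_def using K hall by simp
qed

theorem PsigmaT: "PsigmaT_group \<sigma> G"
  unfolding PsigmaT_group_def
proof (intro allI impI)
  fix H K assume "sigma_permutable \<sigma> G H \<and> sigma_permutable \<sigma> (G\<lparr>carrier := H\<rparr>) K"
  then have H: "sigma_permutable \<sigma> G H" and K: "sigma_permutable \<sigma> (G\<lparr>carrier := H\<rparr>) K" by auto
  have HG: "subgroup H G" using H by (simp add: sigma_permutable_def)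
  have KG: "subgroup K G" "K \<subseteq> H" using K subgroup_of_subgroup[OF HG] by (auto simp: sigma_permutable_def)
  interpret H: sigma_structured_group "G\<lparr>carrier := H\<rparr>" \<sigma> "D \<inter> H"
    using finite_group_subgroup[OF HG] sigma_structure_subgroup[OF str HG] part
    by (simp add: sigma_structured_group_def sigma_structured_group_axioms_def)
  have absH: "absorbs_moved H" by (rule absorbs_of_permutable[OF H])
  have absK: "H.absorbs_moved K" by (rule H.absorbs_of_permutable[OF K])
  have "absorbs_moved K"
    unfolding absorbs_moved_def
  proof (intro ballI allI impI)
    fix k q r x
    assume k: "k \<in> K" and *: "prime q \<and> k \<in> tau_elements {q} G \<and> prime r \<and> x \<in> D \<inter> tau_elements {r} G \<and> k \<bullet> x \<noteq> x"
    then have "x \<in> H" using absH KG(2) unfolding absorbs_moved_def by blast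
    then show "x \<in> K"
      using absK k * KG(2) conj_subgroup[OF HG, of k x] unfolding H.absorbs_moved_def tau_elements_subgroup[OF HG] by auto
  qed
  then show "sigma_permutable \<sigma> G K"
    using permutable_of_absorbs[OF KG(1)] H by (auto simp: sigma_permutable_def)
qed

text \<open>If \<open>H \<inter> D\<close> is not contained in \<open>K\<close>, the chief factor \<open>H/K\<close> is covered by a cyclic subgroup of \<open>D\<close>,
  which is normal in \<open>G\<close>; otherwise by a normal subgroup that modulo \<open>D\<close> is an \<open>s\<close>-group.\<close>

theorem chief_factor_index_number:
  assumes hall: "\<And>s. s \<in> \<sigma> \<Longrightarrow> \<exists>S. hall_tau_subgroup s G S" and ch: "chief_factor G H K"
  shows "\<exists>s\<in>\<sigma>. tau_number s (card H div card K)"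
proof -
  have H: "H \<lhd> G" and K: "K \<lhd> G" "K \<subset> H" and min: "\<And>L. L \<lhd> G \<Longrightarrow> K \<subset> L \<Longrightarrow> L \<subseteq> H \<Longrightarrow> L = H"
    using ch by (auto simp: chief_factor_def)
  note HG = normal_imp_subgroup[OF H] and KG = normal_imp_subgroup[OF K(1)]
  have cover: "tau_number s (card H div card K)"
    if L: "L \<lhd> G" "L \<subseteq> H" "x \<in> L" "x \<notin> K" and Ln: "\<And>l. l \<in> L \<Longrightarrow> \<exists>n. tau_number s n \<and> l [^] (n::nat) \<in> K" for L x s
  proof -
    note LG = normal_imp_subgroup[OF L(1)]
    have sub: "K <#> L \<subseteq> H" using K(2) L(2) subgroup.m_closed[OF HG] by (fastforce simp: set_mult_def)
    have "K <#> L = H"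
      using min[OF normal_subgroup_set_mult_closed[OF K(1) L(1)]] sub normal_set_mult(3,4)[OF K(1) LG] L(3,4) by blast
    show ?thesis
    proof (rule tau_number_card_div[OF KG _ HG])
      fix p h assume p: "prime p" "p \<notin> s" and h: "h \<in> H" "h \<in> tau_elements {p} G"
      obtain k l where kl: "k \<in> K" "l \<in> L" "h = k \<otimes> l" using h(1) \<open>K <#> L = H\<close> by (auto simp: set_mult_def)
      obtain n where n: "tau_number s n" "l [^] (n::nat) \<in> K" using Ln[OF kl(2)] by blast
      have [simp]: "h \<in> carrier G" "l \<in> carrier G" "k \<in> carrier G"
        using h kl subgroup.mem_carrier[OF LG] subgroup.mem_carrier[OF KG] by auto
      have "K #> h = K #> l" using kl(1) coset_eq_iff[OF K(1), of h l] unfolding kl(3) by (simp add: m_assoc)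
      then have "K #> (h [^] n) = K #> (l [^] n)" using normal.FactGroup_pow[OF K(1)] by (metis \<open>h \<in> carrier G\<close> \<open>l \<in> carrier G\<close>)
      also have "\<dots> = K" using coset_eq_self_iff[OF K(1)] n(2) by simp
      finally have "h [^] n \<in> K" using coset_eq_self_iff[OF K(1)] by simp
      then show "h \<in> K" using tau_element_mem[OF h(2) KG n(1)] p by simp
    qed (use K in auto)
  qed
  show ?thesis
  proof (cases "H \<inter> D \<subseteq> K")
    case False
    then obtain y where y: "y \<in> H" "y \<in> D" "y \<notin> K" by blast
    have yG: "y \<in> carrier G" by (rule subgroup.mem_carrier[OF HG y(1)])
    have "\<exists>q i. prime q \<and> y [^] (i::nat) \<in> tau_elements {q} G \<and> y [^] i \<notin> K"
    proof (rule ccontr)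
      assume "\<not> ?thesis"
      then have "y \<in> K"
        using prime_power_closure[OF yG, of "\<lambda>z. z \<in> K"] subgroup.m_closed[OF KG] by blast
      with y(3) show False ..
    qed
    then obtain q and i :: nat where q: "prime q" "y [^] i \<in> tau_elements {q} G" "y [^] i \<notin> K" by blast
    define x where "x = y [^] i"
    have x: "x \<in> H" "x \<in> D" "x \<in> tau_elements {q} G" "x \<notin> K" "x \<in> carrier G"
      using q y yG subgroup_pow_mem[OF HG] subgroup_pow_mem[OF D_subgroup] by (simp_all add: x_def)
    define L where "L = generate G {x}"
    have L: "subgroup L G" unfolding L_def by (rule cyclic_subgroup[OF x(5)])
    have LN: "L \<lhd> G" using L cyclic_subset[OF D_subgroup x(2)] subgroup_of_D_normal by (simp add: L_def)
    have LH: "L \<subseteq> H" unfolding L_def by (rule cyclic_subset[OF HG x(1)])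
    have xL: "x \<in> L" unfolding L_def by (rule cyclic_self)
    obtain s where s: "s \<in> \<sigma>" "q \<in> s" using partition_on_block[OF part q(1)] .
    have "\<exists>n. tau_number s n \<and> l [^] (n::nat) \<in> K" if "l \<in> L" for l
    proof -
      have "l \<in> tau_elements {q} G" using that tau_elements_pow[OF x(3)] cyclic_mem_iff[OF x(5)] by (auto simp: L_def)
      then obtain n where "tau_number {q} n" "l [^] n = \<one>" by (auto simp: tau_elements_def)
      then show ?thesis using tau_number_mono[of "{q}" n s] s(2) subgroup.one_closed[OF KG] by auto
    qed
    then show ?thesis using cover[OF LN LH xL x(4)] s(1) by blast
  next
    case True
    have "card H div card K > 0" using card_index(2)[OF KG HG] K(2) by blast
    then obtain p where p: "prime p" "p dvd card H div card K"
      using chief_factor_index[OF ch] prime_factor_nat by blast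
    obtain x where x: "x \<in> H" "x \<notin> K" "x \<in> tau_elements {p} G"
      using exists_p_element_notin[OF p KG _ HG] K(2) by blast
    obtain s where s: "s \<in> \<sigma>" "p \<in> s" using partition_on_block[OF part p(1)] .
    obtain S where S: "hall_tau_subgroup s G S" using hall[OF s(1)] by blast
    note T = hall_modulo_D[OF s(1) S]
    define L where "L = (D <#> S) \<inter> H"
    have L: "L \<lhd> G" unfolding L_def by (rule normal_subgroup_intersect[OF T(1) H])
    have xL: "x \<in> L" using x T(2) tau_elements_mono[OF x(3), of s] s(2) by (auto simp: L_def)
    have "\<exists>n. tau_number s n \<and> l [^] (n::nat) \<in> K" if l: "l \<in> L" for l
    proof (intro exI conjI)
      show "tau_number s (card (D <#> S) div card D)" by (rule T(3))
      have "D \<subseteq> D <#> S" using normal_set_mult(3)[OF D_normal] S by (simp add: hall_iff)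
      then have "l [^] (card (D <#> S) div card D) \<in> D"
        using l by (intro pow_index_mem[OF normal_imp_subgroup[OF T(1)] D_normal]) (auto simp: L_def)
      moreover have "l [^] (card (D <#> S) div card D) \<in> H" using l subgroup_pow_mem[OF HG] by (auto simp: L_def)
      ultimately show "l [^] (card (D <#> S) div card D) \<in> K" using True by blast
    qed
    then show ?thesis using cover[OF L _ xL x(2)] s(1) by (auto simp: L_def)
  qed
qed

end


section \<open>Direct products of normal Hall subgroups\<close>

context finite_group
begin

text \<open>The product of two normal \<open>\<tau>\<close>-subgroups is one, so a largest one exists.\<close>

lemma O_tau_spec:
  shows "O_tau \<tau> G \<lhd> G" "tau_number \<tau> (card (O_tau \<tau> G))"
    "\<And>N. N \<lhd> G \<Longrightarrow> tau_number \<tau> (card N) \<Longrightarrow> N \<subseteq> O_tau \<tau> G"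
proof -
  let ?P = "\<lambda>N. N \<lhd> G \<and> tau_group \<tau> (G\<lparr>carrier := N\<rparr>)"
  have P: "?P N \<longleftrightarrow> N \<lhd> G \<and> tau_number \<tau> (card N)" for N
    using tau_group_iff[of N \<tau>] normal_imp_subgroup[of N] by auto
  have "?P {\<one>}" unfolding P using one_is_normal by simp
  moreover have "card N \<le> order G" if "?P N" for N
    using card_mono[OF fin subgroup.subset[OF normal_imp_subgroup[of N]]] that by (simp add: order_def)
  then have "\<forall>N. ?P N \<longrightarrow> card N < Suc (order G)" by (simp add: less_Suc_eq_le)
  ultimately obtain N where N: "?P N" "\<And>L. ?P L \<Longrightarrow> card L \<le> card N"
    using ex_has_greatest_nat[of ?P "{\<one>}" card "Suc (order G)"] by blast
  have max: "L \<subseteq> N" if L: "?P L" for L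
  proof -
    note NG = normal_imp_subgroup[of N] and LG = normal_imp_subgroup[of L]
    have NL: "N <#> L \<lhd> G" using normal_subgroup_set_mult_closed N(1) L by blast
    have sub: "N \<subseteq> N <#> L" "L \<subseteq> N <#> L" using normal_set_mult(3,4) N(1) L LG by blast+
    have "tau_number \<tau> (card N * card L)" using N(1) L unfolding P by simp
    then have "tau_number \<tau> (card (N <#> L))"
      using card_set_mult_dvd[of N L] N(1) L NG LG tau_number_dvd by blast
    then have "card (N <#> L) \<le> card N" using N(2) NL unfolding P by blast
    then have "N = N <#> L"
      using card_seteq[OF finite_subgroup[OF normal_imp_subgroup[OF NL]] sub(1)] by simp
    then show ?thesis using sub(2) by simp
  qed
  have "O_tau \<tau> G = N"
    unfolding O_tau_def by (rule Greatest_equality) (use N(1) max in auto)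
  then show "O_tau \<tau> G \<lhd> G" "tau_number \<tau> (card (O_tau \<tau> G))"
    "\<And>N. N \<lhd> G \<Longrightarrow> tau_number \<tau> (card N) \<Longrightarrow> N \<subseteq> O_tau \<tau> G"
    using N(1) max unfolding P by simp_all
qed

lemma O_tau_eqI:
  assumes N: "N \<lhd> G" "N = tau_elements \<tau> G" shows "O_tau \<tau> G = N"
proof
  show "O_tau \<tau> G \<subseteq> N"
    using O_tau_spec(1,2)[of \<tau>] tau_elements_of_tau_subgroup normal_imp_subgroup N(2) by blast
  show "N \<subseteq> O_tau \<tau> G"
    using N tau_number_card[OF normal_imp_subgroup[OF N(1)]] by (intro O_tau_spec(3)) auto
qed

lemma generate_superset: "A \<subseteq> generate G A"
  by (auto intro: generate.incl)

lemma generate_normal_union: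
  assumes "finite I" "\<And>i. i \<in> I \<Longrightarrow> N i \<lhd> G" "\<And>i. i \<in> I \<Longrightarrow> tau_number (\<tau> i) (card (N i))"
  shows "generate G (\<Union>i\<in>I. N i) \<lhd> G \<and> tau_number (\<Union>i\<in>I. \<tau> i) (card (generate G (\<Union>i\<in>I. N i)))"
  using assms
proof (induction I rule: finite_induct)
  case empty
  then show ?case using generate_empty one_is_normal by simp
next
  case (insert i I)
  let ?V = "generate G (\<Union>i\<in>I. N i)"
  let ?W = "generate G (\<Union>i\<in>insert i I. N i)"
  have V: "?V \<lhd> G" "tau_number (\<Union>i\<in>I. \<tau> i) (card ?V)" using insert by auto
  have Ni: "N i \<lhd> G" "tau_number (\<tau> i) (card (N i))" using insert.prems by auto
  note VG = normal_imp_subgroup[OF V(1)] and NG = normal_imp_subgroup[OF Ni(1)]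
  note NV = normal_set_mult[OF Ni(1) VG]
  have sub: "(\<Union>i\<in>insert i I. N i) \<subseteq> carrier G"
    using insert.prems(1) subgroup.subset[OF normal_imp_subgroup] by blast
  then have "(\<Union>i\<in>I. N i) \<subseteq> ?V" using generate_superset[of "\<Union>i\<in>I. N i"] by blast
  then have "?W \<subseteq> N i <#> ?V" using NV(3,4) by (intro generate_subgroup_incl[OF _ NV(2)]) blast
  then have "card ?W dvd card (N i) * card ?V"
    using card_subgroup_dvd[OF generate_is_subgroup[OF sub] NV(2)] card_set_mult_dvd[OF NG VG] dvd_trans by blast
  moreover have "tau_number (\<Union>i\<in>insert i I. \<tau> i) (card (N i) * card ?V)"
    using tau_number_mono[OF Ni(2)] tau_number_mono[OF V(2)] by (simp add: Un_upper1 Un_upper2)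
  ultimately have "tau_number (\<Union>i\<in>insert i I. \<tau> i) (card ?W)" using tau_number_dvd by blast
  moreover have "?W \<lhd> G"
  proof (rule normal_generateI[OF sub])
    fix h g assume "h \<in> (\<Union>i\<in>insert i I. N i)" "g \<in> carrier G"
    then show "g \<otimes> h \<otimes> inv g \<in> (\<Union>i\<in>insert i I. N i)"
      using insert.prems(1) normal_conj_mem unfolding conjugate_def by blast
  qed
  ultimately show ?case by simp
qed

text \<open>The other factors generate a normal subgroup complementing \<open>N s\<close>, whose order is prime to \<open>s\<close>.\<close>

lemma direct_product_of_halls:
  assumes part: "partition_on all_primes \<sigma>" "finite \<sigma>"
    and dp: "internal_direct_product G \<sigma> N" and N: "\<And>s. s \<in> \<sigma> \<Longrightarrow> tau_number s (card (N s))"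
  shows "s \<in> \<sigma> \<Longrightarrow> tau_elements s G \<subseteq> N s"
    and "\<lbrakk>s \<in> \<sigma>; t \<in> \<sigma>; s \<noteq> t; x \<in> N s; y \<in> N t\<rbrakk> \<Longrightarrow> x \<bullet> y = y"
proof -
  have Nn: "N s \<lhd> G" if "s \<in> \<sigma>" for s using dp that by (simp add: internal_direct_product_def)
  note NG = normal_imp_subgroup[OF Nn]
  have gen: "generate G (\<Union>s\<in>\<sigma>. N s) = carrier G"
    and triv: "\<And>s. s \<in> \<sigma> \<Longrightarrow> N s \<inter> generate G (\<Union>j\<in>\<sigma> - {s}. N j) = {\<one>}"
    using dp by (simp_all add: internal_direct_product_def)
  show "tau_elements s G \<subseteq> N s" if s: "s \<in> \<sigma>"
  proof
    fix x assume x: "x \<in> tau_elements s G"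
    let ?V = "generate G (\<Union>j\<in>\<sigma> - {s}. N j)"
    have V: "?V \<lhd> G" "tau_number (\<Union>j\<in>\<sigma> - {s}. j) (card ?V)"
      using generate_normal_union[of "\<sigma> - {s}" N "\<lambda>j. j"] part(2) Nn N by auto
    note VG = normal_imp_subgroup[OF V(1)]
    note NV = normal_set_mult[OF Nn[OF s] VG]
    have sub: "(\<Union>j\<in>\<sigma> - {s}. N j) \<subseteq> carrier G" using subgroup.subset[OF NG] by blast
    have "(\<Union>j\<in>\<sigma>. N j) \<subseteq> N s <#> ?V"
      using NV(3,4) generate_superset[of "\<Union>j\<in>\<sigma> - {s}. N j"] by blast
    then have "carrier G \<subseteq> N s <#> ?V" using generate_subgroup_incl[OF _ NV(2)] gen by metis
    then have W: "N s <#> ?V = carrier G" using subgroup.subset[OF NV(2)] by auto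
    have "card (carrier G) = card ?V * card (N s)"
      using card_set_mult[OF NG[OF s] VG] triv[OF s] W by (simp add: mult.commute)
    then have "card (carrier G) div card (N s) = card ?V"
      using card_div_eqI[OF NG[OF s]] by metis
    then have "tau_number (\<Union>j\<in>\<sigma> - {s}. j) (card (carrier G) div card (N s))" using V(2) by simp
    moreover have "s \<inter> (\<Union>j\<in>\<sigma> - {s}. j) = {}" using partition_on_disjoint[OF part(1) s] by blast
    ultimately show "x \<in> N s"
      using tau_element_mem_normal[OF x subgroup_self Nn[OF s] subgroup.subset[OF NG[OF s]] tau_elements_closed[OF x]] by blast
  qed
  show "x \<bullet> y = y" if st: "s \<in> \<sigma>" "t \<in> \<sigma>" "s \<noteq> t" and x: "x \<in> N s" and y: "y \<in> N t"
  proof -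
    have [simp]: "x \<in> carrier G" "y \<in> carrier G"
      using subgroup.mem_carrier[OF NG] st x y by blast+
    have "(x \<bullet> y) \<otimes> inv y = x \<otimes> (y \<bullet> inv x)" by (simp add: conjugate_def m_assoc)
    moreover have "(x \<bullet> y) \<otimes> inv y \<in> N t"
      using normal_conj_mem[OF Nn[OF st(2)] _ y, of x] subgroup.m_closed[OF NG[OF st(2)]] subgroup.m_inv_closed[OF NG[OF st(2)] y] by simp
    moreover have "x \<otimes> (y \<bullet> inv x) \<in> N s"
      using normal_conj_mem[OF Nn[OF st(1)] _ subgroup.m_inv_closed[OF NG[OF st(1)] x], of y] subgroup.m_closed[OF NG[OF st(1)] x] by simp
    moreover have "N t \<subseteq> generate G (\<Union>j\<in>\<sigma> - {s}. N j)"
      using st generate_superset[of "\<Union>j\<in>\<sigma> - {s}. N j"] by blast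
    ultimately have "(x \<bullet> y) \<otimes> inv y = \<one>" using triv[OF st(1)] by auto
    then show ?thesis by (simp add: div_eq_one_iff)
  qed
qed

lemma power_automorphism_iff:
  assumes D: "subgroup D G" "\<And>a b. a \<in> D \<Longrightarrow> b \<in> D \<Longrightarrow> a \<otimes> b = b \<otimes> a" and g: "g \<in> carrier G"
  shows "power_automorphism (G\<lparr>carrier := D\<rparr>) (\<lambda>d. g \<otimes> d \<otimes> inv g) \<longleftrightarrow> (\<forall>d\<in>D. \<exists>k::nat. g \<bullet> d = d [^] k)"
proof
  note [simp] = subgroup.mem_carrier[OF D(1)]
  assume pa: "power_automorphism (G\<lparr>carrier := D\<rparr>) (\<lambda>d. g \<otimes> d \<otimes> inv g)"
  show "\<forall>d\<in>D. \<exists>k::nat. g \<bullet> d = d [^] k"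
  proof
    fix d assume d: "d \<in> D"
    let ?K = "generate G {d}"
    have "subgroup ?K G" using d by (intro cyclic_subgroup) simp
    then have "subgroup ?K (G\<lparr>carrier := D\<rparr>)" by (rule subgroup_incl[OF _ D(1) cyclic_subset[OF D(1) d]])
    then have "(\<lambda>d. g \<otimes> d \<otimes> inv g) ` ?K = ?K" using pa by (simp add: power_automorphism_def)
    moreover have "d \<in> ?K" by (rule cyclic_self)
    ultimately have "g \<bullet> d \<in> ?K" unfolding conjugate_def by blast
    then show "\<exists>k::nat. g \<bullet> d = d [^] k" using cyclic_mem_iff d by simp
  qed
next
  note [simp] = subgroup.mem_carrier[OF D(1)]
  assume pw: "\<forall>d\<in>D. \<exists>k::nat. g \<bullet> d = d [^] k"
  have inj: "inj_on (\<lambda>d. g \<otimes> d \<otimes> inv g) D"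
    using conj_inj[OF g] unfolding conjugate_def by (intro inj_onI) auto
  have img: "(\<lambda>d. g \<otimes> d \<otimes> inv g) ` K = K" if K: "subgroup K G" "K \<subseteq> D" for K
  proof (rule card_subset_eq[OF finite_subgroup[OF K(1)]])
    show "(\<lambda>d. g \<otimes> d \<otimes> inv g) ` K \<subseteq> K"
    proof
      fix z assume "z \<in> (\<lambda>d. g \<otimes> d \<otimes> inv g) ` K"
      then obtain d where d: "d \<in> K" "z = g \<bullet> d" by (auto simp: conjugate_def)
      then obtain k :: nat where "z = d [^] k" using pw K(2) by blast
      then show "z \<in> K" using subgroup_pow_mem[OF K(1) d(1)] by simp
    qed
    show "card ((\<lambda>d. g \<otimes> d \<otimes> inv g) ` K) = card K"
      using inj K(2) by (intro card_image) (rule inj_on_subset)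
  qed
  have "(\<lambda>d. g \<otimes> d \<otimes> inv g) \<in> hom (G\<lparr>carrier := D\<rparr>) (G\<lparr>carrier := D\<rparr>)"
    using img[OF D(1) order_refl] g by (intro homI) (auto simp: m_assoc)
  then have "(\<lambda>d. g \<otimes> d \<otimes> inv g) \<in> iso (G\<lparr>carrier := D\<rparr>) (G\<lparr>carrier := D\<rparr>)"
    using inj img[OF D(1) order_refl] by (intro isoI) (auto simp: bij_betw_def)
  then show "power_automorphism (G\<lparr>carrier := D\<rparr>) (\<lambda>d. g \<otimes> d \<otimes> inv g)"
    unfolding power_automorphism_def using img subgroup_of_subgroup[OF D(1)] by blast
qed

lemma hall_subgroup_iff: "subgroup D G \<Longrightarrow> hall_subgroup G D \<longleftrightarrow> coprime (card D) (order G div card D)"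
  by (simp add: hall_subgroup_def card_rcosets_div_order)

lemma coprime_indexI:
  assumes K: "subgroup K G" "K \<subseteq> H" and H: "subgroup H G"
    and el: "\<And>q x. prime q \<Longrightarrow> q dvd card K \<Longrightarrow> x \<in> H \<Longrightarrow> x \<in> tau_elements {q} G \<Longrightarrow> x \<in> K"
  shows "coprime (card K) (card H div card K)"
proof (rule ccontr)
  assume "\<not> ?thesis"
  then obtain q where q: "prime q" "q dvd gcd (card K) (card H div card K)"
    using prime_factor_nat coprime_iff_gcd_eq_1 by metis
  then obtain x where "x \<in> H - K" "x \<in> tau_elements {q} G"
    using exists_p_element_notin[OF q(1) _ K H] by auto
  then show False using el[of q x] q by auto
qed

lemma comm_group_subgroup_iff:
  "subgroup D G \<Longrightarrow> comm_group (G\<lparr>carrier := D\<rparr>) \<longleftrightarrow> (\<forall>a\<in>D. \<forall>b\<in>D. a \<otimes> b = b \<otimes> a)"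
proof
  assume D: "subgroup D G" and "comm_group (G\<lparr>carrier := D\<rparr>)"
  then interpret D: comm_group "G\<lparr>carrier := D\<rparr>" by simp
  show "\<forall>a\<in>D. \<forall>b\<in>D. a \<otimes> b = b \<otimes> a" using D.m_comm by simp
next
  assume D: "subgroup D G" and c: "\<forall>a\<in>D. \<forall>b\<in>D. a \<otimes> b = b \<otimes> a"
  show "comm_group (G\<lparr>carrier := D\<rparr>)"
    by (rule group.group_comm_groupI[OF subgroup_imp_group[OF D]]) (use c in simp)
qed

lemma O_tau_abelian:
  assumes D: "subgroup D G" "\<And>a b. a \<in> D \<Longrightarrow> b \<in> D \<Longrightarrow> a \<otimes> b = b \<otimes> a"
  shows "O_tau \<tau> (G\<lparr>carrier := D\<rparr>) = D \<inter> tau_elements \<tau> G"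
proof -
  interpret D: finite_group "G\<lparr>carrier := D\<rparr>" by (rule finite_group_subgroup[OF D(1)])
  have eq: "tau_elements \<tau> (G\<lparr>carrier := D\<rparr>) = D \<inter> tau_elements \<tau> G"
    using tau_elements_subgroup[OF D(1)] by blast
  have DD: "D \<lhd> G\<lparr>carrier := D\<rparr>" using D.normal_self by simp
  have "D \<inter> tau_elements \<tau> (G\<lparr>carrier := D\<rparr>) \<lhd> G\<lparr>carrier := D\<rparr>"
    by (rule D.tau_elements_abelian_normal[OF DD]) (simp add: D(2))
  then show ?thesis unfolding eq Int_left_absorb by (rule D.O_tau_eqI) (simp only: eq)
qed

end

section \<open>From the structure to the decomposition and back\<close>

context sigma_structured_group
begin

text \<open>The complement \<open>M\<close> and the complement of the \<open>s\<close>-part \<open>P\<close> of \<open>D\<close> in a Hall \<open>s\<close>-subgroup \<open>E\<close> both come from the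
  Schur-Zassenhaus theorem. In \<open>M\<close> the \<open>s\<close>-elements form the normal subgroup \<open>D S \<inter> M\<close>, for a Hall \<open>s\<close>-subgroup \<open>S\<close> of
  \<open>G\<close>; and the complement of \<open>P\<close> in \<open>E\<close> is normal since \<open>P\<close> is central in \<open>E\<close>.\<close>

theorem decomposition:
  assumes fin\<sigma>: "finite \<sigma>" and hall: "\<forall>s\<in>\<sigma>. \<exists>S. hall_tau_subgroup s G S"
  shows "D \<lhd> G" "comm_group (G\<lparr>carrier := D\<rparr>)" "hall_subgroup G D"
    and "\<And>g. g \<in> carrier G \<Longrightarrow> power_automorphism (G\<lparr>carrier := D\<rparr>) (\<lambda>d. g \<otimes> d \<otimes> inv g)"
    and "\<exists>M. internal_semidirect G D M \<and>
          internal_direct_product (G\<lparr>carrier := M\<rparr>) \<sigma> (\<lambda>\<tau>. O_tau \<tau> (G\<lparr>carrier := M\<rparr>))"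
    and "\<And>s E. s \<in> \<sigma> \<Longrightarrow> hall_tau_subgroup s G E \<Longrightarrow>
          has_normal_complement (G\<lparr>carrier := E\<rparr>) (O_tau s (G\<lparr>carrier := D\<rparr>))"
proof -
  note D = D_subgroup and DN = D_normal and Dc = D_comm
  show "D \<lhd> G" by (rule DN)
  show comm: "comm_group (G\<lparr>carrier := D\<rparr>)" using comm_group_subgroup_iff[OF D] Dc by blast
  have cop: "coprime (card D) (order G div card D)"
    unfolding order_def using D_hall
    by (intro coprime_indexI[OF D subgroup.subset[OF D] subgroup_self]) blast
  then show "hall_subgroup G D" using hall_subgroup_iff[OF D] by simp
  show "power_automorphism (G\<lparr>carrier := D\<rparr>) (\<lambda>d. g \<otimes> d \<otimes> inv g)" if "g \<in> carrier G" for g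
    using power_automorphism_iff[OF D Dc that] D_powers[OF that] by blast
  obtain M where M: "subgroup M G" "D \<inter> M = {\<one>}" "D <#> M = carrier G"
    using abelian_normal_complement[OF DN comm cop] .
  interpret M: finite_group "G\<lparr>carrier := M\<rparr>" by (rule finite_group_subgroup[OF M(1)])
  have MN: "M \<inter> tau_elements s G \<lhd> G\<lparr>carrier := M\<rparr>" if s: "s \<in> \<sigma>" for s
  proof -
    obtain S where S: "hall_tau_subgroup s G S" using hall s by blast
    note T = hall_modulo_D[OF s S]
    have DT: "D \<subseteq> D <#> S" using normal_set_mult(3)[OF DN] S by (simp add: hall_iff)
    have "(D <#> S) \<inter> M = M \<inter> tau_elements s G"
    proof
      show "M \<inter> tau_elements s G \<subseteq> (D <#> S) \<inter> M" using T(2) by blast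
      show "(D <#> S) \<inter> M \<subseteq> M \<inter> tau_elements s G"
      proof
        fix x assume x: "x \<in> (D <#> S) \<inter> M"
        then have "x [^] (card (D <#> S) div card D) \<in> D"
          using pow_index_mem[OF normal_imp_subgroup[OF T(1)] DN DT] by blast
        moreover have "x [^] (card (D <#> S) div card D) \<in> M" using x subgroup_pow_mem[OF M(1)] by blast
        ultimately have "x [^] (card (D <#> S) div card D) = \<one>" using M(2) by blast
        then show "x \<in> M \<inter> tau_elements s G"
          using x T(3) subgroup.mem_carrier[OF M(1)] by (auto simp: tau_elements_def)
      qed
    qed
    then show ?thesis using normal_Int_subgroup[OF M(1) T(1)] by simp
  qed
  have O: "O_tau s (G\<lparr>carrier := M\<rparr>) = M \<inter> tau_elements s G" if s: "s \<in> \<sigma>" for s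
    using M.O_tau_eqI[OF MN[OF s]] by (simp add: tau_elements_subgroup[OF M(1)] Int_commute)
  have num: "tau_number s (card (M \<inter> tau_elements s G))" if s: "s \<in> \<sigma>" for s
    using M.tau_number_card[OF normal_imp_subgroup[OF MN[OF s]], of s] by (simp add: tau_elements_subgroup[OF M(1)])
  have "internal_direct_product (G\<lparr>carrier := M\<rparr>) \<sigma> (\<lambda>s. M \<inter> tau_elements s G)"
    unfolding internal_direct_product_def
  proof (intro conjI ballI)
    show "M \<inter> tau_elements s G \<lhd> G\<lparr>carrier := M\<rparr>" if "s \<in> \<sigma>" for s by (rule MN[OF that])
    have sub: "(\<Union>s\<in>\<sigma>. M \<inter> tau_elements s G) \<subseteq> carrier (G\<lparr>carrier := M\<rparr>)" by auto
    let ?W = "generate (G\<lparr>carrier := M\<rparr>) (\<Union>s\<in>\<sigma>. M \<inter> tau_elements s G)"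
    have W: "subgroup ?W (G\<lparr>carrier := M\<rparr>)" by (rule M.generate_is_subgroup[OF sub])
    show "?W = carrier (G\<lparr>carrier := M\<rparr>)"
    proof
      show "?W \<subseteq> carrier (G\<lparr>carrier := M\<rparr>)" by (rule subgroup.subset[OF W])
      show "carrier (G\<lparr>carrier := M\<rparr>) \<subseteq> ?W"
      proof
        fix m assume m: "m \<in> carrier (G\<lparr>carrier := M\<rparr>)"
        show "m \<in> ?W"
        proof (rule M.prime_power_closure[OF m, where P = "\<lambda>z. z \<in> ?W"])
          fix q and i :: nat
          assume q: "prime q" and mi: "m [^]\<^bsub>G\<lparr>carrier := M\<rparr>\<^esub> i \<in> tau_elements {q} (G\<lparr>carrier := M\<rparr>)"
          obtain s where s: "s \<in> \<sigma>" "q \<in> s" using partition_on_block[OF part q] .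
          then have "m [^]\<^bsub>G\<lparr>carrier := M\<rparr>\<^esub> i \<in> M \<inter> tau_elements s G"
            using M.tau_elements_mono[OF mi, of s] by (simp add: tau_elements_subgroup[OF M(1)])
          then show "m [^]\<^bsub>G\<lparr>carrier := M\<rparr>\<^esub> i \<in> ?W" using s(1) by (intro generate.incl) blast
        qed (rule subgroup.m_closed[OF W])
      qed
    qed
    fix s assume s: "s \<in> \<sigma>"
    let ?V = "generate (G\<lparr>carrier := M\<rparr>) (\<Union>j\<in>\<sigma> - {s}. M \<inter> tau_elements j G)"
    have V: "?V \<lhd> G\<lparr>carrier := M\<rparr>" "tau_number (\<Union>j\<in>\<sigma> - {s}. j) (card ?V)"
      using M.generate_normal_union[of "\<sigma> - {s}" "\<lambda>j. M \<inter> tau_elements j G" "\<lambda>j. j"] fin\<sigma> MN num by auto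
    note VM = normal_imp_subgroup[OF V(1)]
    show "M \<inter> tau_elements s G \<inter> ?V = {\<one>\<^bsub>G\<lparr>carrier := M\<rparr>\<^esub>}"
    proof
      show "{\<one>\<^bsub>G\<lparr>carrier := M\<rparr>\<^esub>} \<subseteq> M \<inter> tau_elements s G \<inter> ?V"
        using subgroup.one_closed[OF VM] subgroup.one_closed[OF M(1)] by simp
      show "M \<inter> tau_elements s G \<inter> ?V \<subseteq> {\<one>\<^bsub>G\<lparr>carrier := M\<rparr>\<^esub>}"
      proof
        fix x assume x: "x \<in> M \<inter> tau_elements s G \<inter> ?V"
        have "x \<in> tau_elements (\<Union>j\<in>\<sigma> - {s}. j) (G\<lparr>carrier := M\<rparr>)"
          using M.tau_elements_of_tau_subgroup[OF VM V(2)] x by blast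
        then have "x \<in> tau_elements (\<Union>j\<in>\<sigma> - {s}. j) G" by (simp add: tau_elements_subgroup[OF M(1)])
        moreover have "s \<inter> (\<Union>j\<in>\<sigma> - {s}. j) = {}" using partition_on_disjoint[OF part s] by blast
        ultimately have "x = \<one>" using x tau_elements_disjoint by blast
        then show "x \<in> {\<one>\<^bsub>G\<lparr>carrier := M\<rparr>\<^esub>}" by simp
      qed
    qed
  qed
  then have "internal_direct_product (G\<lparr>carrier := M\<rparr>) \<sigma> (\<lambda>\<tau>. O_tau \<tau> (G\<lparr>carrier := M\<rparr>))"
    unfolding internal_direct_product_def by (simp add: O)
  moreover have "internal_semidirect G D M"
    unfolding internal_semidirect_def complement_in_def using DN D M by simp
  ultimately show "\<exists>M. internal_semidirect G D M \<and>
          internal_direct_product (G\<lparr>carrier := M\<rparr>) \<sigma> (\<lambda>\<tau>. O_tau \<tau> (G\<lparr>carrier := M\<rparr>))" by blast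

  fix s E assume s: "s \<in> \<sigma>" and E: "hall_tau_subgroup s G E"
  have EG: "subgroup E G" using E by (simp add: hall_iff)
  interpret E: finite_group "G\<lparr>carrier := E\<rparr>" by (rule finite_group_subgroup[OF EG])
  define P where "P = D \<inter> tau_elements s G"
  have P: "P \<lhd> G" unfolding P_def by (rule D_tau_normal)
  note PG = normal_imp_subgroup[OF P]
  have PE: "P \<subseteq> E"
    using normal_subset_hall[OF P _ E] tau_number_card[OF PG, of s] by (auto simp: P_def)
  have P': "P \<lhd> G\<lparr>carrier := E\<rparr>" by (rule normal_restrict_supergroup[OF EG P PE])
  have commP: "comm_group ((G\<lparr>carrier := E\<rparr>)\<lparr>carrier := P\<rparr>)"
    using comm_group_subgroup_iff[OF PG] Dc by (simp add: P_def)
  have "coprime (card P) (card E div card P)"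
  proof (rule coprime_indexI[OF PG PE EG])
    fix q x assume q: "prime q" "q dvd card P" and x: "x \<in> E" "x \<in> tau_elements {q} G"
    have "q dvd card D" using q(2) card_subgroup_dvd[OF PG D] dvd_trans by (auto simp: P_def)
    then have "x \<in> D" using D_hall[OF q(1)] x(2) by blast
    then show "x \<in> P" using hall_subgroup_elements[OF E x(1)] by (simp add: P_def)
  qed
  then have copP: "coprime (card P) (order (G\<lparr>carrier := E\<rparr>) div card P)" by (simp add: order_def)
  obtain N where N: "subgroup N (G\<lparr>carrier := E\<rparr>)" "P \<inter> N = {\<one>\<^bsub>G\<lparr>carrier := E\<rparr>\<^esub>}"
      "P <#>\<^bsub>G\<lparr>carrier := E\<rparr>\<^esub> N = carrier (G\<lparr>carrier := E\<rparr>)"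
    using E.abelian_normal_complement[OF P' commP copP] .
  have NE: "subgroup N G" "N \<subseteq> E" using N(1) subgroup_of_subgroup[OF EG] by auto
  have "N \<lhd> G\<lparr>carrier := E\<rparr>"
    unfolding E.normal_iff_conj
  proof (intro conjI ballI N(1))
    fix g n assume "g \<in> carrier (G\<lparr>carrier := E\<rparr>)" and n: "n \<in> N"
    then have "g \<in> E" by simp
    then obtain a m where g: "a \<in> P" "m \<in> N" "g = a \<otimes> m" using N(3) by (auto simp: set_mult_def)
    have mn: "m \<bullet> n \<in> N" by (rule conj_mem_subgroup[OF NE(1) g(2) n])
    have [simp]: "a \<in> carrier G" "m \<in> carrier G" "n \<in> carrier G" "m \<bullet> n \<in> carrier G"
      using g n mn subgroup.mem_carrier[OF PG] subgroup.mem_carrier[OF NE(1)] by auto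
    have "m \<bullet> n \<in> tau_elements s G" using hall_subgroup_elements[OF E] mn NE(2) by blast
    then have "(m \<bullet> n) \<bullet> a = a" using D_central[OF s] g(1) by (auto simp: P_def)
    then have "a \<bullet> (m \<bullet> n) = m \<bullet> n" by (rule conj_eq_sym[rotated 2]) simp_all
    then have "g \<bullet> n = m \<bullet> n" unfolding g(3) by (simp add: conj_conj)
    then show "g \<bullet>\<^bsub>G\<lparr>carrier := E\<rparr>\<^esub> n \<in> N" using conj_subgroup[OF EG \<open>g \<in> E\<close>, of n] n NE(2) mn by auto
  qed
  moreover have "O_tau s (G\<lparr>carrier := D\<rparr>) = P" unfolding P_def by (rule O_tau_abelian[OF D Dc])
  ultimately show "has_normal_complement (G\<lparr>carrier := E\<rparr>) (O_tau s (G\<lparr>carrier := D\<rparr>))"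
    unfolding has_normal_complement_def complement_in_def
    using N normal_imp_subgroup[OF P'] by auto
qed

end

context finite_group
begin

text \<open>Modulo \<open>D\<close> an \<open>s\<close>-element is an element of the \<open>s\<close>-factor of \<open>M\<close>, so elements belonging to different blocks commute
  modulo \<open>D\<close>. For a block \<open>{p}\<close> with \<open>p\<close> dividing the order of \<open>D\<close>, all \<open>p\<close>-elements lie in the abelian group
  \<open>D\<close>; for a block \<open>s\<close> with a Hall subgroup \<open>E\<close> as in the hypothesis, every \<open>s\<close>-element lies in \<open>D E\<close>, and \<open>E\<close> is the direct product of the \<open>s\<close>-part of \<open>D\<close> and
  a normal subgroup.\<close>

theorem structure_of_decomposition:
  assumes part: "partition_on all_primes \<sigma>" "finite \<sigma>"
    and semi: "internal_semidirect G D M" and comm: "comm_group (G\<lparr>carrier := D\<rparr>)" and hallD: "hall_subgroup G D"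
    and dp: "internal_direct_product (G\<lparr>carrier := M\<rparr>) \<sigma> (\<lambda>\<tau>. O_tau \<tau> (G\<lparr>carrier := M\<rparr>))"
    and pw: "\<And>g. g \<in> carrier G \<Longrightarrow> power_automorphism (G\<lparr>carrier := D\<rparr>) (\<lambda>d. g \<otimes> d \<otimes> inv g)"
    and compl: "\<And>s. s \<in> \<sigma> \<Longrightarrow> (\<exists>p. s = {p}) \<or> (\<exists>E. hall_tau_subgroup s G E \<and>
            has_normal_complement (G\<lparr>carrier := E\<rparr>) (O_tau s (G\<lparr>carrier := D\<rparr>)))"
  shows "sigma_structure \<sigma> G D"
proof -
  have DN: "D \<lhd> G" and D: "subgroup D G" and M: "subgroup M G" "D <#> M = carrier G" "D \<inter> M = {\<one>}"
    using semi by (auto simp: internal_semidirect_def complement_in_def)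
  note [simp] = subgroup.mem_carrier[OF D] subgroup.mem_carrier[OF M(1)]
  have Dc: "a \<otimes> b = b \<otimes> a" if "a \<in> D" "b \<in> D" for a b using comm comm_group_subgroup_iff[OF D] that by blast
  interpret M: finite_group "G\<lparr>carrier := M\<rparr>" by (rule finite_group_subgroup[OF M(1)])
  have hall: "x \<in> D" if q: "prime q" "q dvd card D" and x: "x \<in> tau_elements {q} G" for q x
  proof -
    have "coprime (card D) (order G div card D)" using hallD hall_subgroup_iff[OF D] by simp
    then have "\<not> q dvd order G div card D"
      using q not_coprimeI by (metis not_prime_unit)
    moreover have "order G div card D > 0" using card_index(2)[OF D subgroup_self subgroup.subset[OF D]] by (simp add: order_def)
    ultimately have "tau_number (prime_compl {q}) (card (carrier G) div card D)"
      using tau_number_prime_compl by (simp add: order_def)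
    then show ?thesis
      using tau_element_mem_normal[OF x subgroup_self DN subgroup.subset[OF D] tau_elements_closed[OF x] _ prime_compl_disjoint(1)] by blast
  qed
  have rep: "\<exists>m. m \<in> O_tau s (G\<lparr>carrier := M\<rparr>) \<and> m \<in> M \<and> D #> x = D #> m" if s: "s \<in> \<sigma>" and x: "x \<in> tau_elements s G" for s x
  proof -
    obtain n where n: "tau_number s n" "x [^] n = \<one>" "x \<in> carrier G" using x by (auto simp: tau_elements_def)
    have "x \<in> D <#> M" using n(3) M(2) by simp
    then obtain d m where dm: "d \<in> D" "m \<in> M" "x = d \<otimes> m" by (auto simp: set_mult_def)
    have eq: "D #> x = D #> m" using dm coset_eq_iff[OF DN, of x m] by (simp add: m_assoc)
    then have "D #> (x [^] n) = D #> (m [^] n)" using normal.FactGroup_pow[OF DN] n(3) dm(2) by (metis subgroup.mem_carrier[OF M(1)])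
    then have "D #> (m [^] n) = D" using n(2) coset_mult_one[OF subgroup.subset[OF D]] by simp
    then have "m [^] n \<in> D" using coset_eq_self_iff[OF DN, of "m [^] n"] dm(2) by simp
    then have "m [^] n = \<one>" using M(3) subgroup_pow_mem[OF M(1) dm(2)] by blast
    then have "m \<in> tau_elements s G" using n(1) dm(2) by (auto simp: tau_elements_def)
    then have "m \<in> tau_elements s (G\<lparr>carrier := M\<rparr>)"
      using dm(2) by (simp add: tau_elements_subgroup[OF M(1)])
    then have "m \<in> O_tau s (G\<lparr>carrier := M\<rparr>)"
      using M.direct_product_of_halls(1)[OF part dp M.O_tau_spec(2) s] by blast
    then show ?thesis using dm(2) eq by blast
  qed
  have commutator: "(x \<bullet> y) \<otimes> inv y \<in> D"
    if st: "s \<in> \<sigma>" "t \<in> \<sigma>" "s \<noteq> t" and x: "x \<in> tau_elements s G" and y: "y \<in> tau_elements t G" for s t x y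
  proof -
    have [simp]: "x \<in> carrier G" "y \<in> carrier G" using x y by auto
    obtain m where m: "m \<in> O_tau s (G\<lparr>carrier := M\<rparr>)" "m \<in> M" "D #> x = D #> m" using rep[OF st(1) x] by blast
    obtain n where n: "n \<in> O_tau t (G\<lparr>carrier := M\<rparr>)" "n \<in> M" "D #> y = D #> n" using rep[OF st(2) y] by blast
    have "m \<bullet>\<^bsub>G\<lparr>carrier := M\<rparr>\<^esub> n = n"
      by (rule M.direct_product_of_halls(2)[OF part dp M.O_tau_spec(2) st m(1) n(1)])
    then have "m \<bullet> n = n" using conj_subgroup[OF M(1) m(2) n(2)] by simp
    then have "D #> (x \<bullet> y) = D #> y"
      using conj_mem_cong[OF DN _ _ _ _ m(3) n(3)] m(2) n(2,3) by simp
    then show ?thesis using coset_eq_iff[OF DN, of "x \<bullet> y" y] by simp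
  qed
  have central: "x \<bullet> d = d" if s: "s \<in> \<sigma>" and x: "x \<in> tau_elements s G" and d: "d \<in> D" "d \<in> tau_elements s G" for s x d
  proof -
    have [simp]: "x \<in> carrier G" using x by auto
    from compl[OF s] consider p where "s = {p}"
      | E where "hall_tau_subgroup s G E" "has_normal_complement (G\<lparr>carrier := E\<rparr>) (O_tau s (G\<lparr>carrier := D\<rparr>))"
      by blast
    then show ?thesis
    proof cases
      case 1
      show ?thesis
      proof (cases "d = \<one>")
        case False
        have p: "prime p" using s part(1) 1 by (auto simp: partition_on_def all_primes_def)
        have "p dvd card D" using prime_dvd_card_subgroup[OF p D d(1) _ False] d(2) 1 by simp
        then have "x \<in> D" using hall[OF p] x 1 by simp
        then show ?thesis using Dc[OF _ d(1)] conj_eq_iff_commute[of x d] d(1) by simp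
      qed simp
    next
      case 2
      have EG: "subgroup E G" using 2(1) by (simp add: hall_iff)
      note DE = normal_set_mult[OF DN EG]
      have "x \<in> D <#> E"
        using hall_normal_modulo(2)[OF part(1) s DN _ 2(1)] commutator s x by blast
      then obtain a e where ae: "a \<in> D" "e \<in> E" "x = a \<otimes> e" by (auto simp: set_mult_def)
      have eG: "e \<in> carrier G" by (rule subgroup.mem_carrier[OF EG ae(2)])
      define P where "P = D \<inter> tau_elements s G"
      have P: "P \<lhd> G" unfolding P_def by (rule tau_elements_abelian_normal[OF DN Dc])
      obtain N where N: "N \<lhd> G\<lparr>carrier := E\<rparr>" "complement_in (G\<lparr>carrier := E\<rparr>) P N"
        using 2(2) O_tau_abelian[OF D Dc, of s] unfolding has_normal_complement_def P_def by auto
      have NG: "subgroup N G" "N \<subseteq> E" and PE: "P \<subseteq> E" and PN: "P <#> N = E" "P \<inter> N = {\<one>}"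
        using N(2) subgroup_of_subgroup[OF EG] by (auto simp: complement_in_def)
      interpret E: finite_group "G\<lparr>carrier := E\<rparr>" by (rule finite_group_subgroup[OF EG])
      obtain b n where bn: "b \<in> P" "n \<in> N" "e = b \<otimes> n" using ae(2) PN(1) by (auto simp: set_mult_def)
      have dP: "d \<in> P" using d by (simp add: P_def)
      have bD: "b \<in> D" using bn(1) by (simp add: P_def)
      have [simp]: "n \<in> carrier G" "b \<in> carrier G" "d \<in> carrier G" using bn bD d subgroup.mem_carrier[OF NG(1)] by auto
      have "(n \<bullet> d) \<otimes> inv d \<in> P"
        using normal_conj_mem[OF P _ dP] subgroup.m_closed[OF normal_imp_subgroup[OF P]] subgroup.m_inv_closed[OF normal_imp_subgroup[OF P] dP] by simp
      moreover have "(n \<bullet> d) \<otimes> inv d = n \<otimes> (d \<bullet> inv n)" by (simp add: conjugate_def m_assoc)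
      moreover have "d \<bullet> inv n \<in> N"
      proof -
        have dE: "d \<in> E" using dP PE by blast
        have n': "inv n \<in> N" by (rule subgroup.m_inv_closed[OF NG(1) bn(2)])
        have "d \<bullet>\<^bsub>G\<lparr>carrier := E\<rparr>\<^esub> inv n \<in> N"
          by (rule E.normal_conj_mem[OF N(1) _ n']) (simp add: dE)
        moreover have "inv n \<in> E" using n' NG(2) by blast
        ultimately show ?thesis using conj_subgroup[OF EG dE] by simp
      qed
      then have "n \<otimes> (d \<bullet> inv n) \<in> N" using subgroup.m_closed[OF NG(1) bn(2)] by simp
      ultimately have "(n \<bullet> d) \<otimes> inv d = \<one>" using PN(2) by auto
      then have nd: "n \<bullet> d = d" by (simp add: div_eq_one_iff)
      have Dd: "c \<bullet> d = d" if "c \<in> D" for c using Dc[OF that d(1)] conj_eq_iff_commute[of c d] that by simp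
      have "x \<bullet> d = a \<bullet> b \<bullet> n \<bullet> d" unfolding ae(3) bn(3) using ae(1) by (simp add: conj_conj m_assoc)
      then show ?thesis using nd Dd[OF bD] Dd[OF ae(1)] by simp
    qed
  qed
  show ?thesis
    unfolding sigma_structure_def
  proof (intro conjI allI impI ballI)
    show "subgroup D G" by (rule D)
    show "a \<bullet> b = b" if "a \<in> D" "b \<in> D" for a b
      using Dc[OF that] conj_eq_iff_commute[of a b] that by simp
    show "\<exists>k::nat. g \<bullet> d = d [^] k" if "g \<in> carrier G" "d \<in> D" for g d
      using pw[OF that(1)] power_automorphism_iff[OF D Dc that(1)] that(2) by blast
    show "tau_elements {q} G \<subseteq> D" if "prime q \<and> q dvd card D" for q using hall that by blast
    show "(x \<bullet> y) \<otimes> inv y \<in> D" if "s \<in> \<sigma>" "t \<in> \<sigma>" "s \<noteq> t" "x \<in> tau_elements s G" "y \<in> tau_elements t G" for s t x y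
      by (rule commutator[OF that])
    show "x \<bullet> d = d" if "s \<in> \<sigma>" "x \<in> tau_elements s G" "d \<in> D \<inter> tau_elements s G" for s x d
      using central[OF that(1,2)] that(3) by blast
  qed
qed

lemma sylow_hall: "prime p \<Longrightarrow> \<exists>S. hall_tau_subgroup {p} G S"
proof -
  assume p: "prime p"
  obtain P where P: "subgroup P G" "tau_number {p} (card P)" "\<not> p dvd order G div card P"
    using sylow_subgroup[OF p] .
  then have "tau_number (prime_compl {p}) (order G div card P)"
    using card_index(2)[OF P(1) subgroup_self subgroup.subset[OF P(1)]] tau_number_prime_compl by (simp add: order_def)
  then show ?thesis using P by (auto simp: hall_iff)
qed

lemma pi_soluble_iff:
  "pi_soluble \<pi> G \<longleftrightarrow> (\<forall>H K. chief_factor G H K \<longrightarrow> (\<exists>s\<in>sigma0 \<pi>. tau_number s (card H div card K)))"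
proof -
  have "tau_group s (G\<lparr>carrier := H\<rparr> Mod K) \<longleftrightarrow> tau_number s (card H div card K)" if "chief_factor G H K" for s H K
    using that normal_imp_subgroup[of H] by (intro tau_group_mod_iff) (auto simp: chief_factor_def)
  then show ?thesis by (auto simp: pi_soluble_def sigma0_def)
qed

end

theorem corollary1p7:
  fixes G :: "('a, 'b) monoid_scheme" (structure) and \<pi> :: "nat set"
  assumes "group G" and "finite (carrier G)"
    and "finite \<pi>" and "\<pi> \<subseteq> all_primes"
  shows "(pi_soluble \<pi> G \<and> PsigmaT_group (sigma0 \<pi>) G) \<longleftrightarrow>
    (\<exists>D M.
       internal_semidirect G D M \<and>
       comm_group (G\<lparr>carrier := D\<rparr>) \<and> hall_subgroup G D \<and> odd (card D) \<and>
       internal_direct_product (G\<lparr>carrier := M\<rparr>) (sigma0 \<pi>) (\<lambda>\<tau>. O_tau \<tau> (G\<lparr>carrier := M\<rparr>)) \<and>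
       (\<forall>g\<in>carrier G. power_automorphism (G\<lparr>carrier := D\<rparr>) (\<lambda>d. g \<otimes> d \<otimes> inv g)) \<and>
       (\<exists>E. hall_tau_subgroup (prime_compl \<pi>) G E \<and>
            has_normal_complement (G\<lparr>carrier := E\<rparr>) (O_tau (prime_compl \<pi>) (G\<lparr>carrier := D\<rparr>))))"
    (is "?L \<longleftrightarrow> ?R")
proof -
  interpret finite_group G using assms(1,2) by (simp add: finite_group_def finite_group_axioms_def)
  have part: "partition_on all_primes (sigma0 \<pi>)" by (rule partition_on_sigma0[OF assms(3,4)])
  have fin\<sigma>: "finite (sigma0 \<pi>)" using assms(3) by (simp add: sigma0_def)
  have blocks: "s = prime_compl \<pi> \<or> (\<exists>p. prime p \<and> s = {p})" if "s \<in> sigma0 \<pi>" for s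
    using that assms(4) by (auto simp: sigma0_def all_primes_def)
  have compl: "prime_compl \<pi> \<in> sigma0 \<pi>" by (simp add: sigma0_def)
  show ?thesis
  proof
    assume L: ?L
    then have chief: "\<exists>s\<in>sigma0 \<pi>. tau_number s (card H div card K)" if "chief_factor G H K" for H K
      using that by (simp add: pi_soluble_iff)
    have "\<exists>E. hall_tau_subgroup (prime_compl \<pi>) G E"
    proof -
      have "tau_number (prime_compl \<pi>) (card H div card K) \<or>
          (\<exists>p. prime p \<and> p \<notin> prime_compl \<pi> \<and> tau_number {p} (card H div card K))" if "chief_factor G H K" for H K
        using chief[OF that] assms(4) by (auto simp: sigma0_def prime_compl_def all_primes_def)
      then show ?thesis using hall_subgroup_exists by metis
    qed
    then have hall: "\<forall>s\<in>sigma0 \<pi>. \<exists>S. hall_tau_subgroup s G S"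
      using blocks sylow_hall by blast
    then obtain \<H> where "complete_hall_set (sigma0 \<pi>) G \<H>" using complete_hall_set_exists[OF part] by blast
    then interpret R: soluble_transitive_sigma_group G "sigma0 \<pi>" \<H>
      using L part chief by unfold_locales auto
    interpret S: sigma_structured_group G "sigma0 \<pi>" R.D
      using part R.D_structure by unfold_locales
    note dec = S.decomposition[OF fin\<sigma> hall]
    obtain E where E: "hall_tau_subgroup (prime_compl \<pi>) G E" using hall compl by blast
    show ?R using dec(1-5) dec(6)[OF compl E] E R.odd_card_D by blast
  next
    assume ?R
    then obtain D M E where R: "internal_semidirect G D M" "comm_group (G\<lparr>carrier := D\<rparr>)" "hall_subgroup G D"
      "internal_direct_product (G\<lparr>carrier := M\<rparr>) (sigma0 \<pi>) (\<lambda>\<tau>. O_tau \<tau> (G\<lparr>carrier := M\<rparr>))"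
      "\<forall>g\<in>carrier G. power_automorphism (G\<lparr>carrier := D\<rparr>) (\<lambda>d. g \<otimes> d \<otimes> inv g)"
      and E: "hall_tau_subgroup (prime_compl \<pi>) G E"
        "has_normal_complement (G\<lparr>carrier := E\<rparr>) (O_tau (prime_compl \<pi>) (G\<lparr>carrier := D\<rparr>))" by blast
    have "sigma_structure (sigma0 \<pi>) G D"
      using R E blocks by (intro structure_of_decomposition[OF part fin\<sigma> R(1-4)]) blast+
    then interpret S: sigma_structured_group G "sigma0 \<pi>" D
      using part by unfold_locales
    have hall: "\<exists>S. hall_tau_subgroup s G S" if "s \<in> sigma0 \<pi>" for s
      using blocks[OF that] sylow_hall E(1) by blast
    have "pi_soluble \<pi> G"
      unfolding pi_soluble_iff using S.chief_factor_index_number[OF hall] by blast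
    then show ?L using S.PsigmaT by blast
  qed
qed


end
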